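(* Let $\Gamma$ be a finite simple graph whose edges are labeled by integers $\ge 2$, and let $A_\Gamma$ be the associated Artin group. Suppose that $A_\Gamma$ is irreducible and that $\Gamma$ is not a clique. Let $\Gamma_0$ be the maximal clique factor of $\Gamma$. Then $A_\Gamma$ is virtually directly indecomposable; that is, it cannot be decomposed as a direct product of two infinite subgroups. Moreover, if $A_{\Gamma_0}$ contains no nontrivial finite subgroup that is a factor of a direct decomposition of $A_{\Gamma_0}$, then $A_\Gamma$ is directly indecomposable.
   Context: Let $\Gamma$ be a finite simple graph with vertex set $V(\Gamma)$ and edge set $E(\Gamma)$, each edge $e$ with endpoints $s_e,t_e$ being labeled by an integer $\mu(e)\ge 2$. The Artin group associated with $\Gamma$ is $$A_\Gamma=\langle V(\Gamma)\mid \underbrace{s_et_es_et_e\cdots}_{\text{length }\mu(e)}=\underbrace{t_es_et_es_e\cdots}_{\text{length }\mu(e)}\ (e\in E(\Gamma))\rangle .$$ The Coxeter graph $\Gamma^t$ is the simple graph with vertex set $V(\Gamma)$ in which two distinct vertices are joined by an edge if and only if either they are not adjacent in $\Gamma$, or they are joined in $\Gamma$ by an edge with label $\ge 3$. $A_\Gamma$ is irreducible if $\Gamma^t$ is connected. $\Gamma$ is a clique if any two distinct vertices of $\Gamma$ are adjacent. The join of simple graphs is obtained from their disjoint union by adding an edge between any two vertices belonging to different graphs. Every finite simple graph $\Gamma$ has a unique decomposition as a join of indecomposable factors (factors that are not joins of two or more nonempty graphs). The maximal clique factor $\Gamma_0$ of $\Gamma$ is the join of all the indecomposable factors consisting of a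 single vertex ($\Gamma_0=\emptyset$ if there are none). $A_{\Gamma_0}$ denotes the subgroup of $A_\Gamma$ generated by $V(\Gamma_0)$ (trivial if $\Gamma_0=\emptyset$), which is naturally the Artin group associated with the labeled graph $\Gamma_0$. A group is directly indecomposable if it cannot be decomposed as a direct product of two nontrivial subgroups. *)

theory Defs
  imports "HOL-Algebra.Elementary_Groups" "Graph_Theory.Graph_Theory"
begin

section \<open>Groups given by generators and relations\<close>

text \<open>
  A letter \<^term>\<open>(s, True)\<close> stands for the generator \<^term>\<open>s\<close> and \<^term>\<open>(s, False)\<close> for its
  formal inverse. A relation \<open>l = r\<close> is given as the pair of words \<open>(l, r)\<close>.
\<close>

type_synonym 'a word = "('a \<times> bool) list"

definition words :: "'a set \<Rightarrow> 'a word set" where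
  "words S = lists (S \<times> UNIV)"

inductive_set pres_rel :: "'a set \<Rightarrow> ('a word \<times> 'a word) set \<Rightarrow> ('a word \<times> 'a word) set"
  for S :: "'a set" and R :: "('a word \<times> 'a word) set" where
  refl: "w \<in> words S \<Longrightarrow> (w, w) \<in> pres_rel S R"
| sym: "(v, w) \<in> pres_rel S R \<Longrightarrow> (w, v) \<in> pres_rel S R"
| trans: "(u, v) \<in> pres_rel S R \<Longrightarrow> (v, w) \<in> pres_rel S R \<Longrightarrow> (u, w) \<in> pres_rel S R"
| cancel: "u \<in> words S \<Longrightarrow> v \<in> words S \<Longrightarrow> s \<in> S \<Longrightarrow>
    (u @ [(s, b), (s, \<not> b)] @ v, u @ v) \<in> pres_rel S R"
| relation: "(l, r) \<in> R \<Longrightarrow> l \<in> words S \<Longrightarrow> r \<in> words S \<Longrightarrow> u \<in> words S \<Longrightarrow> v \<in> words S \<Longrightarrow>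
    (u @ l @ v, u @ r @ v) \<in> pres_rel S R"

definition presented_group :: "'a set \<Rightarrow> ('a word \<times> 'a word) set \<Rightarrow> 'a word set monoid" where
  "presented_group S R =
     \<lparr>carrier = words S // pres_rel S R,
      monoid.mult = (\<lambda>X Y. \<Union>x\<in>X. \<Union>y\<in>Y. pres_rel S R `` {x @ y}),
      one = pres_rel S R `` {[]}\<rparr>"

lemma words_append [simp]: "u @ v \<in> words S \<longleftrightarrow> u \<in> words S \<and> v \<in> words S"
  by (auto simp: words_def)

lemma words_Nil [simp]: "[] \<in> words S"
  by (auto simp: words_def)

lemma words_Cons [simp]: "x # w \<in> words S \<longleftrightarrow> fst x \<in> S \<and> w \<in> words S"
  by (cases x) (auto simp: words_def)

lemma pres_rel_words:
  assumes "(u, v) \<in> pres_rel S R"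
  shows "u \<in> words S \<and> v \<in> words S"
  using assms by induction auto

lemma equiv_pres_rel: "equiv (words S) (pres_rel S R)"
proof (rule equivI)
  show "pres_rel S R \<subseteq> words S \<times> words S"
    by (auto dest: pres_rel_words)
  show "refl_on (words S) (pres_rel S R)"
    by (auto simp: refl_on_def intro: pres_rel.refl)
  show "Relation.sym (pres_rel S R)"
    by (auto simp: Relation.sym_def intro: pres_rel.sym)
  show "Relation.trans (pres_rel S R)"
    by (meson transI pres_rel.trans)
qed

lemma pres_rel_appendL:
  assumes "(v, w) \<in> pres_rel S R" "u \<in> words S"
  shows "(u @ v, u @ w) \<in> pres_rel S R"
  using assms
proof induction
  case (cancel u' v s b)
  then show ?case using pres_rel.cancel[of "u @ u'" S v s b R] by simp
next
  case (relation l r u' v)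
  then show ?case using pres_rel.relation[of l r R S "u @ u'" v] by simp
qed (auto intro: pres_rel.refl pres_rel.sym pres_rel.trans)

lemma pres_rel_appendR:
  assumes "(v, w) \<in> pres_rel S R" "u \<in> words S"
  shows "(v @ u, w @ u) \<in> pres_rel S R"
  using assms
proof induction
  case (cancel u' v s b)
  then show ?case using pres_rel.cancel[of u' S "v @ u" s b R] by simp
next
  case (relation l r u' v)
  then show ?case using pres_rel.relation[of l r R S u' "v @ u"] by simp
qed (auto intro: pres_rel.refl pres_rel.sym pres_rel.trans)

lemma congruent2_append:
  "congruent2 (pres_rel S R) (pres_rel S R) (\<lambda>x y. pres_rel S R `` {x @ y})"
proof (rule congruent2I')
  fix u u' v v' assume "(u, u') \<in> pres_rel S R" "(v, v') \<in> pres_rel S R"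
  then have "(u @ v, u' @ v') \<in> pres_rel S R"
    by (meson pres_rel_appendL pres_rel_appendR pres_rel_words pres_rel.trans)
  then show "pres_rel S R `` {u @ v} = pres_rel S R `` {u' @ v'}"
    by (rule equiv_class_eq[OF equiv_pres_rel])
qed

lemma presented_group_mult:
  assumes "u \<in> words S" "v \<in> words S"
  shows "pres_rel S R `` {u} \<otimes>\<^bsub>presented_group S R\<^esub> pres_rel S R `` {v} = pres_rel S R `` {u @ v}"
  using UN_equiv_class2[OF equiv_pres_rel equiv_pres_rel congruent2_append assms]
  by (simp add: presented_group_def)

lemma pres_rel_left_inverse:
  assumes "w \<in> words S"
  shows "(rev (map (\<lambda>(s, b). (s, \<not> b)) w) @ w, []) \<in> pres_rel S R"
  using assms
proof (induction w)
  case Nil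
  show ?case by (simp add: pres_rel.refl)
next
  case (Cons x w)
  obtain s b where x: "x = (s, b)" by (cases x)
  let ?i = "rev (map (\<lambda>(s, b). (s, \<not> b)) w)"
  have "?i \<in> words S"
    using Cons.prems by (auto simp: words_def in_lists_conv_set)
  then have "(?i @ [(s, \<not> b), (s, \<not> \<not> b)] @ w, ?i @ w) \<in> pres_rel S R"
    using Cons.prems x by (intro pres_rel.cancel) auto
  then show ?case
    using Cons x by (auto intro: pres_rel.trans)
qed

lemma presented_group_carrierE:
  assumes "X \<in> carrier (presented_group S R)"
  obtains w where "w \<in> words S" "X = pres_rel S R `` {w}"
  using assms by (auto simp: presented_group_def quotient_def)

lemma presented_group_carrierI:
  "w \<in> words S \<Longrightarrow> pres_rel S R `` {w} \<in> carrier (presented_group S R)"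
  by (auto simp: presented_group_def quotient_def)

lemma presented_group_one: "\<one>\<^bsub>presented_group S R\<^esub> = pres_rel S R `` {[]}"
  by (simp add: presented_group_def)

lemma group_presented_group: "group (presented_group S R)"
proof (rule groupI)
  fix X assume "X \<in> carrier (presented_group S R)"
  then obtain w where w: "w \<in> words S" "X = pres_rel S R `` {w}"
    by (rule presented_group_carrierE)
  let ?i = "rev (map (\<lambda>(s, b). (s, \<not> b)) w)"
  have i: "?i \<in> words S"
    using w by (auto simp: words_def in_lists_conv_set)
  have "pres_rel S R `` {?i} \<otimes>\<^bsub>presented_group S R\<^esub> X = \<one>\<^bsub>presented_group S R\<^esub>"
    using equiv_class_eq[OF equiv_pres_rel pres_rel_left_inverse[OF w(1)]] w i
    by (simp add: presented_group_mult presented_group_one)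
  then show "\<exists>Y\<in>carrier (presented_group S R).
      Y \<otimes>\<^bsub>presented_group S R\<^esub> X = \<one>\<^bsub>presented_group S R\<^esub>"
    using presented_group_carrierI[OF i] by blast
next
  fix X Y Z assume "X \<in> carrier (presented_group S R)" "Y \<in> carrier (presented_group S R)"
    "Z \<in> carrier (presented_group S R)"
  then show "X \<otimes>\<^bsub>presented_group S R\<^esub> Y \<otimes>\<^bsub>presented_group S R\<^esub> Z =
      X \<otimes>\<^bsub>presented_group S R\<^esub> (Y \<otimes>\<^bsub>presented_group S R\<^esub> Z)"
    by (elim presented_group_carrierE) (simp add: presented_group_mult)
next
  fix X Y assume "X \<in> carrier (presented_group S R)" "Y \<in> carrier (presented_group S R)"
  then show "X \<otimes>\<^bsub>presented_group S R\<^esub> Y \<in> carrier (presented_group S R)"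
    by (elim presented_group_carrierE) (simp add: presented_group_mult presented_group_carrierI)
next
  show "\<one>\<^bsub>presented_group S R\<^esub> \<in> carrier (presented_group S R)"
    by (simp add: presented_group_one presented_group_carrierI)
next
  fix X assume "X \<in> carrier (presented_group S R)"
  then show "\<one>\<^bsub>presented_group S R\<^esub> \<otimes>\<^bsub>presented_group S R\<^esub> X = X"
    by (elim presented_group_carrierE) (simp add: presented_group_mult presented_group_one)
qed


section \<open>Direct decompositions\<close>

definition direct_decomposition :: "('g, 'm) monoid_scheme \<Rightarrow> 'g set \<Rightarrow> 'g set \<Rightarrow> bool" where
  "direct_decomposition G H K \<longleftrightarrow>
     H \<lhd> G \<and> K \<lhd> G \<and> H \<inter> K = {\<one>\<^bsub>G\<^esub>} \<and> H <#>\<^bsub>G\<^esub> K = carrier G"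

definition directly_indecomposable :: "('g, 'm) monoid_scheme \<Rightarrow> bool" where
  "directly_indecomposable G \<longleftrightarrow>
     \<not> (\<exists>H K. direct_decomposition G H K \<and> H \<noteq> {\<one>\<^bsub>G\<^esub>} \<and> K \<noteq> {\<one>\<^bsub>G\<^esub>})"

definition virtually_directly_indecomposable :: "('g, 'm) monoid_scheme \<Rightarrow> bool" where
  "virtually_directly_indecomposable G \<longleftrightarrow>
     \<not> (\<exists>H K. direct_decomposition G H K \<and> infinite H \<and> infinite K)"


section \<open>Artin groups\<close>

text \<open>
  A finite simple graph is a \<^locale>\<open>pair_graph\<close>, that is, a finite symmetric loop-free digraph.
  The two arcs \<open>(s, t)\<close> and \<open>(t, s)\<close> represent the single edge \<open>{s, t}\<close>; a labelling is a function
  on unordered pairs, and only its values on edges matter.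
\<close>

fun alternating_word :: "nat \<Rightarrow> 'a \<Rightarrow> 'a \<Rightarrow> 'a word" where
  "alternating_word 0 s t = []"
| "alternating_word (Suc n) s t = (s, True) # alternating_word n t s"

definition artin_relations ::
    "'a pair_pre_digraph \<Rightarrow> ('a set \<Rightarrow> nat) \<Rightarrow> ('a word \<times> 'a word) set" where
  "artin_relations \<Gamma> \<mu> =
     {(alternating_word (\<mu> {s, t}) s t, alternating_word (\<mu> {s, t}) t s) |s t. (s, t) \<in> parcs \<Gamma>}"

definition artin_group :: "'a pair_pre_digraph \<Rightarrow> ('a set \<Rightarrow> nat) \<Rightarrow> 'a word set monoid" where
  "artin_group \<Gamma> \<mu> = presented_group (pverts \<Gamma>) (artin_relations \<Gamma> \<mu>)"

definition artin_generator ::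
    "'a pair_pre_digraph \<Rightarrow> ('a set \<Rightarrow> nat) \<Rightarrow> 'a \<Rightarrow> 'a word set" where
  "artin_generator \<Gamma> \<mu> s = pres_rel (pverts \<Gamma>) (artin_relations \<Gamma> \<mu>) `` {[(s, True)]}"

text \<open>The subgroup of the Artin group of \<open>\<Gamma>\<close> generated by the vertices of a subgraph \<open>\<Delta>\<close>.\<close>

definition artin_subgroup ::
    "'a pair_pre_digraph \<Rightarrow> ('a set \<Rightarrow> nat) \<Rightarrow> 'a pair_pre_digraph \<Rightarrow> 'a word set monoid" where
  "artin_subgroup \<Gamma> \<mu> \<Delta> =
     subgroup_generated (artin_group \<Gamma> \<mu>) (artin_generator \<Gamma> \<mu> ` pverts \<Delta>)"

lemma group_artin_group: "group (artin_group \<Gamma> \<mu>)"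
  by (simp add: artin_group_def group_presented_group)

lemma artin_generator_carrier:
  "s \<in> pverts \<Gamma> \<Longrightarrow> artin_generator \<Gamma> \<mu> s \<in> carrier (artin_group \<Gamma> \<mu>)"
  by (simp add: artin_generator_def artin_group_def presented_group_carrierI)

definition coxeter_graph ::
    "'a pair_pre_digraph \<Rightarrow> ('a set \<Rightarrow> nat) \<Rightarrow> 'a pair_pre_digraph" where
  "coxeter_graph \<Gamma> \<mu> =
     \<lparr>pverts = pverts \<Gamma>,
      parcs = {(u, v). u \<in> pverts \<Gamma> \<and> v \<in> pverts \<Gamma> \<and> u \<noteq> v \<and>
                ((u, v) \<notin> parcs \<Gamma> \<or> (u, v) \<in> parcs \<Gamma> \<and> 3 \<le> \<mu> {u, v})}\<rparr>"

definition artin_irreducible :: "'a pair_pre_digraph \<Rightarrow> ('a set \<Rightarrow> nat) \<Rightarrow> bool" where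
  "artin_irreducible \<Gamma> \<mu> \<longleftrightarrow> Digraph_Component.connected (with_proj (coxeter_graph \<Gamma> \<mu>))"

definition is_clique :: "'a pair_pre_digraph \<Rightarrow> bool" where
  "is_clique \<Gamma> \<longleftrightarrow> (\<forall>u\<in>pverts \<Gamma>. \<forall>v\<in>pverts \<Gamma>. u \<noteq> v \<longrightarrow> (u, v) \<in> parcs \<Gamma>)"


section \<open>Joins and the maximal clique factor\<close>

definition graph_join :: "'a pair_pre_digraph set \<Rightarrow> 'a pair_pre_digraph" where
  "graph_join \<G> =
     \<lparr>pverts = (\<Union>G\<in>\<G>. pverts G),
      parcs = (\<Union>G\<in>\<G>. parcs G) \<union>
              {(u, v). \<exists>G\<in>\<G>. \<exists>H\<in>\<G>. G \<noteq> H \<and> u \<in> pverts G \<and> v \<in> pverts H}\<rparr>"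

text \<open>\<open>\<Gamma>\<close> is the (internal) join of the family \<open>\<G>\<close> of nonempty, pairwise disjoint graphs.\<close>

definition join_decomposition :: "'a pair_pre_digraph \<Rightarrow> 'a pair_pre_digraph set \<Rightarrow> bool" where
  "join_decomposition \<Gamma> \<G> \<longleftrightarrow>
     (\<forall>G\<in>\<G>. pair_graph G \<and> pverts G \<noteq> {}) \<and>
     pairwise (\<lambda>G H. disjnt (pverts G) (pverts H)) \<G> \<and>
     \<Gamma> = graph_join \<G>"

definition join_indecomposable :: "'a pair_pre_digraph \<Rightarrow> bool" where
  "join_indecomposable \<Gamma> \<longleftrightarrow>
     \<not> (\<exists>\<G>. join_decomposition \<Gamma> \<G> \<and> (\<exists>G\<in>\<G>. \<exists>H\<in>\<G>. G \<noteq> H))"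

text \<open>
  Existence and uniqueness of the decomposition into indecomposable factors is
  proved in \<open>ex1_join_factors\<close> below.
\<close>

definition join_factors :: "'a pair_pre_digraph \<Rightarrow> 'a pair_pre_digraph set" where
  "join_factors \<Gamma> = (THE \<G>. join_decomposition \<Gamma> \<G> \<and> (\<forall>G\<in>\<G>. join_indecomposable G))"

definition maximal_clique_factor :: "'a pair_pre_digraph \<Rightarrow> 'a pair_pre_digraph" where
  "maximal_clique_factor \<Gamma> = graph_join {G \<in> join_factors \<Gamma>. \<exists>v. pverts G = {v}}"

lemma join_decompositionD:
  assumes "join_decomposition \<Gamma> \<G>"
  shows "\<And>G. G \<in> \<G> \<Longrightarrow> pair_graph G"
    and "\<And>G. G \<in> \<G> \<Longrightarrow> pverts G \<noteq> {}"
    and "\<And>G H v. G \<in> \<G> \<Longrightarrow> H \<in> \<G> \<Longrightarrow> v \<in> pverts G \<Longrightarrow> v \<in> pverts H \<Longrightarrow> G = H"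
    and "\<And>v. v \<in> pverts \<Gamma> \<longleftrightarrow> (\<exists>G\<in>\<G>. v \<in> pverts G)"
    and "\<And>G u v. (u, v) \<in> parcs G \<Longrightarrow> G \<in> \<G> \<Longrightarrow> u \<in> pverts G \<and> v \<in> pverts G"
    and "\<And>u v. (u, v) \<in> parcs \<Gamma> \<longleftrightarrow> (\<exists>G\<in>\<G>. (u, v) \<in> parcs G) \<or>
           (\<exists>G\<in>\<G>. \<exists>H\<in>\<G>. G \<noteq> H \<and> u \<in> pverts G \<and> v \<in> pverts H)"
proof -
  show *: "pair_graph G" if "G \<in> \<G>" for G
    using assms that by (auto simp: join_decomposition_def)
  show "u \<in> pverts G \<and> v \<in> pverts G" if "(u, v) \<in> parcs G" "G \<in> \<G>" for G u v
  proof -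
    interpret pair_graph G using * that by blast
    show ?thesis using in_arcsD1 in_arcsD2 that by blast
  qed
qed (use assms in \<open>auto simp: join_decomposition_def graph_join_def pairwise_def disjnt_iff\<close>)

lemma join_decomposition_parcs:
  assumes "join_decomposition \<Gamma> \<G>" "G \<in> \<G>" "u \<in> pverts G" "v \<in> pverts G"
  shows "(u, v) \<in> parcs G \<longleftrightarrow> (u, v) \<in> parcs \<Gamma>"
  using join_decompositionD[OF assms(1)] assms(2-) by metis

lemma pair_graph_restrict:
  assumes "pair_graph \<Gamma>" "U \<subseteq> pverts \<Gamma>"
  shows "pair_graph \<lparr>pverts = U, parcs = parcs \<Gamma> \<inter> U \<times> U\<rparr>"
proof -
  interpret pair_graph \<Gamma> by fact
  show ?thesis
    using assms(2) finite_subset[OF assms(2)] pair_finite_verts pair_finite_arcs no_loops'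
      pair_sym_arcs
    by unfold_locales (auto simp: symmetric_def sym_def)
qed

lemma join_factors_subset:
  fixes \<Gamma> G :: "'a pair_pre_digraph"
  assumes "join_decomposition \<Gamma> \<G>" "join_decomposition \<Gamma> \<H>"
    and "G \<in> \<G>" "join_indecomposable G"
  obtains H :: "'a pair_pre_digraph" where "H \<in> \<H>" "pverts G \<subseteq> pverts H"
proof -
  note G = join_decompositionD[OF assms(1)] and H = join_decompositionD[OF assms(2)]
  define r where "r H = \<lparr>pverts = pverts G \<inter> pverts H,
    parcs = parcs G \<inter> (pverts G \<inter> pverts H) \<times> (pverts G \<inter> pverts H)\<rparr>" for H :: "'a pair_pre_digraph"
  define \<K> where "\<K> = r ` {H \<in> \<H>. pverts G \<inter> pverts H \<noteq> {}}"
  have r: "pverts (r H) = pverts G \<inter> pverts H" for H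
    by (simp add: r_def)
  have pr: "(u, v) \<in> parcs (r H) \<longleftrightarrow> (u, v) \<in> parcs G \<and> u \<in> pverts G \<inter> pverts H \<and>
      v \<in> pverts G \<inter> pverts H" for H u v
    by (auto simp: r_def)
  have pg: "pair_graph (r H)" for H
    unfolding r_def by (rule pair_graph_restrict) (use G(1) assms(3) in auto)
  have disj: "pairwise (\<lambda>G H. disjnt (pverts G) (pverts H)) \<K>"
    unfolding pairwise_def disjnt_iff \<K>_def using H(3) by (auto simp: r)
  have join: "G = graph_join \<K>"
  proof -
    have cover: "\<exists>H\<in>\<H>. v \<in> pverts H" if "v \<in> pverts G" for v
      using G(4) H(4) assms(3) that by blast
    have "pverts G = pverts (graph_join \<K>)"
      using cover by (auto simp: graph_join_def \<K>_def r)
    moreover have "(u, v) \<in> parcs G \<longleftrightarrow> (u, v) \<in> parcs (graph_join \<K>)" for u v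
    proof
      assume uv: "(u, v) \<in> parcs G"
      then have G': "u \<in> pverts G" "v \<in> pverts G" using G(5) assms(3) by blast+
      obtain H1 H2 where h: "H1 \<in> \<H>" "u \<in> pverts H1" "H2 \<in> \<H>" "v \<in> pverts H2"
        using cover G' by blast
      show "(u, v) \<in> parcs (graph_join \<K>)"
      proof (cases "r H1 = r H2")
        case True
        then have "v \<in> pverts H1" using G' h by (metis IntD2 IntI r)
        then have "(u, v) \<in> parcs (r H1)" "r H1 \<in> \<K>" using uv G' h by (auto simp: pr \<K>_def)
        then show ?thesis by (auto simp: graph_join_def)
      next
        case False
        moreover have "r H1 \<in> \<K>" "r H2 \<in> \<K>" "u \<in> pverts (r H1)" "v \<in> pverts (r H2)"
          using G' h by (auto simp: \<K>_def r)
        ultimately show ?thesis unfolding graph_join_def by auto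
      qed
    next
      assume "(u, v) \<in> parcs (graph_join \<K>)"
      then consider H where "H \<in> \<H>" "(u, v) \<in> parcs (r H)"
        | H1 H2 where "H1 \<in> \<H>" "H2 \<in> \<H>" "r H1 \<noteq> r H2" "u \<in> pverts (r H1)" "v \<in> pverts (r H2)"
        by (auto simp: graph_join_def \<K>_def)
      then show "(u, v) \<in> parcs G"
      proof cases
        case 1
        then show ?thesis by (simp add: pr)
      next
        case 2
        then have "H1 \<noteq> H2" "u \<in> pverts H1" "v \<in> pverts H2" by (auto simp: r)
        then have "(u, v) \<in> parcs \<Gamma>" unfolding H(6) using 2(1,2) by blast
        then show ?thesis
          using join_decomposition_parcs[OF assms(1,3)] 2 by (auto simp: r)
      qed
    qed
    ultimately show ?thesis by (intro pair_pre_digraph.equality) auto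
  qed
  have "\<forall>K\<in>\<K>. pair_graph K \<and> pverts K \<noteq> {}"
    using pg by (auto simp: \<K>_def r)
  with disj join have "join_decomposition G \<K>"
    unfolding join_decomposition_def by (intro conjI)
  with assms(4) have eq: "K = K'" if "K \<in> \<K>" "K' \<in> \<K>" for K K'
    using that unfolding join_indecomposable_def by blast
  obtain v where v: "v \<in> pverts G" using G(2) assms(3) by blast
  then have "v \<in> pverts \<Gamma>" using G(4)[of v] assms(3) by blast
  then obtain H where h: "H \<in> \<H>" "v \<in> pverts H" using H(4)[of v] by blast
  have "pverts G \<subseteq> pverts H"
  proof
    fix u assume u: "u \<in> pverts G"
    then have "u \<in> pverts \<Gamma>" using G(4)[of u] assms(3) by blast
    then obtain H' where h': "H' \<in> \<H>" "u \<in> pverts H'" using H(4)[of u] by blast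
    have "r H = r H'" using u v h h' by (intro eq) (auto simp: \<K>_def)
    then have "u \<in> pverts (r H)" using u h' by (auto simp: r)
    then show "u \<in> pverts H" by (simp add: r)
  qed
  with h show thesis using that by blast
qed

lemma join_factors_unique_subset:
  assumes "join_decomposition \<Gamma> \<G>" "\<forall>G\<in>\<G>. join_indecomposable G"
    and "join_decomposition \<Gamma> \<H>" "\<forall>H\<in>\<H>. join_indecomposable H"
  shows "\<G> \<subseteq> \<H>"
proof
  note D1 = join_decompositionD[OF assms(1)] and D2 = join_decompositionD[OF assms(3)]
  fix G assume G: "G \<in> \<G>"
  obtain H where H: "H \<in> \<H>" "pverts G \<subseteq> pverts H"
    using join_factors_subset[OF assms(1,3) G] assms(2) G by blast
  obtain G' where G': "G' \<in> \<G>" "pverts H \<subseteq> pverts G'"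
    using join_factors_subset[OF assms(3,1) H(1)] assms(4) H(1) by blast
  have "G = G'" using D1(2)[OF G] D1(3)[OF G G'(1)] H(2) G'(2) by blast
  then have eq: "pverts G = pverts H" using H G' by blast
  have "(u, v) \<in> parcs G \<longleftrightarrow> (u, v) \<in> parcs H" for u v
    using join_decomposition_parcs[OF assms(1) G] join_decomposition_parcs[OF assms(3) H(1)]
      D1(5)[OF _ G] D2(5)[OF _ H(1)] eq by metis
  then have "G = H" using eq by (intro pair_pre_digraph.equality) auto
  with H show "G \<in> \<H>" by simp
qed

lemma ex_join_factors:
  assumes "pair_graph \<Gamma>"
  shows "\<exists>\<G>. join_decomposition \<Gamma> \<G> \<and> (\<forall>G\<in>\<G>. join_indecomposable G)"
  using assms
proof (induction "card (pverts \<Gamma>)" arbitrary: \<Gamma> rule: less_induct)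
  case less
  interpret pair_graph \<Gamma> by fact
  consider "pverts \<Gamma> = {}" | "pverts \<Gamma> \<noteq> {}" "join_indecomposable \<Gamma>" | "\<not> join_indecomposable \<Gamma>"
    by blast
  then show ?case
  proof cases
    case 1
    then have "parcs \<Gamma> = {}" using in_arcsD1 by auto
    with 1 have "join_decomposition \<Gamma> {}"
      by (auto simp: join_decomposition_def graph_join_def)
    then show ?thesis by blast
  next
    case 2
    have "\<Gamma> = graph_join {\<Gamma>}"
      by (auto simp: graph_join_def)
    then have "join_decomposition \<Gamma> {\<Gamma>}"
      using 2 less.prems by (auto simp: join_decomposition_def)
    then show ?thesis using 2 by blast
  next
    case 3
    then obtain \<G> A B where \<G>: "join_decomposition \<Gamma> \<G>" and AB: "A \<in> \<G>" "B \<in> \<G>" "A \<noteq> B"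
      by (auto simp: join_indecomposable_def)
    note D = join_decompositionD[OF \<G>]
    have "pverts G \<subset> pverts \<Gamma>" if G: "G \<in> \<G>" for G
    proof -
      obtain C where C: "C \<in> \<G>" "C \<noteq> G" using AB by metis
      then obtain v where "v \<in> pverts C" "v \<notin> pverts G" using D(2)[of C] D(3)[of C G] G by blast
      then show ?thesis using C(1) D(4)[of v] D(4) G by (auto simp only: D(4))
    qed
    then have "card (pverts G) < card (pverts \<Gamma>)" if "G \<in> \<G>" for G
      using that pair_finite_verts by (simp add: psubset_card_mono)
    then have "\<forall>G\<in>\<G>. \<exists>\<K>. join_decomposition G \<K> \<and> (\<forall>K\<in>\<K>. join_indecomposable K)"
      using less.hyps[OF _ D(1)] by blast
    from bchoice[OF this] obtain F where F: "\<And>G. G \<in> \<G> \<Longrightarrow> join_decomposition G (F G)"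
        "\<And>G K. G \<in> \<G> \<Longrightarrow> K \<in> F G \<Longrightarrow> join_indecomposable K"
      by blast
    note DF = join_decompositionD[OF F(1)]
    let ?U = "\<Union>G\<in>\<G>. F G"
    have sub: "v \<in> pverts G" if "G \<in> \<G>" "K \<in> F G" "v \<in> pverts K" for G K v
      using DF(4)[OF that(1), of v] that by blast
    have cov: "\<exists>K\<in>F G. v \<in> pverts K" if "G \<in> \<G>" "v \<in> pverts G" for G v
      using DF(4)[OF that(1), of v] that by blast
    have FF: "K = K'" if "G \<in> \<G>" "G' \<in> \<G>" "K \<in> F G" "K' \<in> F G'" "v \<in> pverts K" "v \<in> pverts K'"
      for G G' K K' v
    proof -
      have "G = G'"
        using D(3)[OF that(1,2)] sub[OF that(1,3,5)] sub[OF that(2,4,6)] by blast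
      then show ?thesis using DF(3)[OF that(1,3) _ that(5,6)] that(4) by blast
    qed
    have "\<Gamma> = graph_join ?U"
    proof -
      have "v \<in> pverts \<Gamma> \<longleftrightarrow> v \<in> pverts (graph_join ?U)" for v
      proof -
        have "v \<in> pverts (graph_join ?U) \<longleftrightarrow> (\<exists>G\<in>\<G>. \<exists>K\<in>F G. v \<in> pverts K)"
          by (simp add: graph_join_def)
        also have "\<dots> \<longleftrightarrow> (\<exists>G\<in>\<G>. v \<in> pverts G)"
          using DF(4) by (intro bex_cong) (rule HOL.refl, simp)
        finally show ?thesis by (simp only: D(4))
      qed
      then have "pverts \<Gamma> = pverts (graph_join ?U)" by blast
      moreover have "(u, v) \<in> parcs \<Gamma> \<longleftrightarrow> (u, v) \<in> parcs (graph_join ?U)" for u v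
      proof
        assume "(u, v) \<in> parcs \<Gamma>"
        then have "(\<exists>G\<in>\<G>. (u, v) \<in> parcs G) \<or>
            (\<exists>G\<in>\<G>. \<exists>H\<in>\<G>. G \<noteq> H \<and> u \<in> pverts G \<and> v \<in> pverts H)"
          by (simp only: D(6))
        then consider G where "G \<in> \<G>" "(u, v) \<in> parcs G"
          | G H where "G \<in> \<G>" "H \<in> \<G>" "G \<noteq> H" "u \<in> pverts G" "v \<in> pverts H"
          by blast
        then show "(u, v) \<in> parcs (graph_join ?U)"
        proof cases
          case 1
          then have "(\<exists>K\<in>F G. (u, v) \<in> parcs K) \<or>
              (\<exists>K\<in>F G. \<exists>L\<in>F G. K \<noteq> L \<and> u \<in> pverts K \<and> v \<in> pverts L)"
            by (simp only: DF(6)[OF 1(1)])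
          then have "(\<exists>K\<in>?U. (u, v) \<in> parcs K) \<or>
              (\<exists>K\<in>?U. \<exists>L\<in>?U. K \<noteq> L \<and> u \<in> pverts K \<and> v \<in> pverts L)"
            using 1(1) by blast
          then show ?thesis by (simp add: graph_join_def)
        next
          case 2
          obtain K where K: "K \<in> F G" "u \<in> pverts K" using cov[OF 2(1,4)] by blast
          obtain L where L: "L \<in> F H" "v \<in> pverts L" using cov[OF 2(2,5)] by blast
          have "v \<in> pverts G" if "K = L" using sub[OF 2(1) K(1)] L(2) that by blast
          then have "K \<noteq> L" using D(3)[OF 2(1,2) _ 2(5)] 2(3) by blast
          then have "\<exists>K\<in>?U. \<exists>L\<in>?U. K \<noteq> L \<and> u \<in> pverts K \<and> v \<in> pverts L"
            using 2 K L by blast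
          then show ?thesis by (simp add: graph_join_def)
        qed
      next
        assume "(u, v) \<in> parcs (graph_join ?U)"
        then consider G K where "G \<in> \<G>" "K \<in> F G" "(u, v) \<in> parcs K"
          | G K H L where "G \<in> \<G>" "H \<in> \<G>" "K \<in> F G" "L \<in> F H" "K \<noteq> L" "u \<in> pverts K" "v \<in> pverts L"
          by (simp add: graph_join_def) blast
        then show "(u, v) \<in> parcs \<Gamma>"
        proof cases
          case 1
          then have "(u, v) \<in> parcs G" unfolding DF(6)[OF 1(1)] by blast
          then show ?thesis using 1(1) unfolding D(6) by blast
        next
          case 2
          show ?thesis
          proof (cases "G = H")
            case True
            then have "(u, v) \<in> parcs G" using 2 unfolding DF(6)[OF 2(1)] by blast
            then show ?thesis using 2(1) unfolding D(6) by blast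
          next
            case False
            then show ?thesis
              using sub[OF 2(1,3,6)] sub[OF 2(2,4,7)] 2(1,2) unfolding D(6) by blast
          qed
        qed
      qed
      ultimately show ?thesis by (intro pair_pre_digraph.equality) auto
    qed
    moreover have "pairwise (\<lambda>G H. disjnt (pverts G) (pverts H)) ?U"
      unfolding pairwise_def disjnt_iff using FF by blast
    ultimately have "join_decomposition \<Gamma> ?U"
      using DF(1,2) by (auto simp: join_decomposition_def)
    moreover have "\<forall>K\<in>?U. join_indecomposable K" using F(2) by blast
    ultimately show ?thesis by blast
  qed
qed

lemma ex1_join_factors:
  assumes "pair_graph \<Gamma>"
  shows "\<exists>!\<G>. join_decomposition \<Gamma> \<G> \<and> (\<forall>G\<in>\<G>. join_indecomposable G)"
  using ex_join_factors[OF assms] join_factors_unique_subset by (metis subset_antisym)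

lemma join_factors:
  assumes "pair_graph \<Gamma>"
  shows "join_decomposition \<Gamma> (join_factors \<Gamma>)" "\<forall>G\<in>join_factors \<Gamma>. join_indecomposable G"
  using theI'[OF ex1_join_factors[OF assms]] unfolding join_factors_def by blast+

end

theory Submission
  imports Defs Complex_Main
begin

text \<open>
  Let \<open>S\<close> be the vertex set and let \<open>s\<close>, \<open>t\<close> be non-adjacent vertices. The Artin group is the
  amalgamated product of the parabolic subgroups on \<open>S - {s}\<close> and \<open>S - {t}\<close> over the one on
  \<open>S - {s, t}\<close>, so it acts on the Bass--Serre tree, and \<open>s t\<close> translates an axis. If the group is a
  product of commuting subgroups \<open>H\<close> and \<open>K\<close>, then the components of \<open>s t\<close> in \<open>H\<close> and \<open>K\<close> preserve
  this axis and one of them, say the one in \<open>H\<close>, translates it. Then \<open>K\<close> preserves the axis, and it fixes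
  the axis pointwise, because otherwise \<open>H\<close> and hence the whole group would preserve the axis as well. So
  \<open>K\<close> is contained in the edge stabiliser, the parabolic subgroup on \<open>S - {s, t}\<close>. Only the cocycle
  counting the edges of the path from a base vertex to its image is needed, not the tree itself.

  On the other hand, a normal subgroup \<open>K\<close> in the parabolic subgroup on a proper subset \<open>X\<close> is trivial:
  for \<open>s \<notin> X\<close>, applying the set-theoretic retraction of Charney and Paris onto the parabolic subgroup on
  \<open>X\<close> to \<open>K = s K s\<^sup>-\<^sup>1\<close> shows that \<open>K\<close> already lies in the parabolic subgroup on the elements of \<open>X\<close>
  commuting with \<open>s\<close>, and irreducibility allows one to shrink \<open>X\<close> in this way down to the empty set.
\<close>

section \<open>Translations of an axis in a Bass--Serre tree\<close>

lemma (in group) inv_mult_cancel [simp]: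
  assumes "x \<in> carrier G" "y \<in> carrier G"
  shows "inv x \<otimes> (x \<otimes> y) = y" "x \<otimes> (inv x \<otimes> y) = y"
  using assms by (simp_all flip: m_assoc)

lemma (in group) commute_inv:
  assumes "x \<in> carrier G" "z \<in> carrier G" "x \<otimes> z = z \<otimes> x"
  shows "x \<otimes> inv z = inv z \<otimes> x"
proof -
  have "inv z \<otimes> (z \<otimes> (x \<otimes> inv z)) = inv z \<otimes> (x \<otimes> (z \<otimes> inv z))"
    using assms by (simp only: m_assoc[symmetric] m_closed inv_closed)
  then show ?thesis using assms by simp
qed

text \<open>
  The cosets of \<open>A\<close> and \<open>B\<close> are the vertices and those of \<open>C\<close> the edges of the tree; \<open>\<beta> x y\<close> is the
  multiplicity of the edge \<open>y C\<close> in the path from the vertex \<open>A\<close> to \<open>x A\<close>.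
\<close>

locale axis_cocycle = group G for G (structure) +
  fixes A B C :: "'a set" and s t :: 'a and \<beta> :: "'a \<Rightarrow> 'a \<Rightarrow> int"
  assumes subA: "subgroup A G" and subB: "subgroup B G" and subC: "subgroup C G"
    and CA: "C \<subseteq> A" and CB: "C \<subseteq> B"
    and sA: "s \<in> A" and tB: "t \<in> B" and sC: "s \<notin> C" and tC: "t \<notin> C"
    and powA: "\<And>n :: int. (s \<otimes> t) [^] n \<in> A \<Longrightarrow> n = 0"
    and powB: "\<And>n :: int. (s \<otimes> t) [^] n \<in> B \<Longrightarrow> n = 0"
    and cocycle: "\<And>x x' y. x \<in> carrier G \<Longrightarrow> x' \<in> carrier G \<Longrightarrow> y \<in> carrier G \<Longrightarrow>
      \<beta> (x \<otimes> x') y = \<beta> x y + \<beta> x' (inv x \<otimes> y)"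
    and cocycle_A: "\<And>a y. a \<in> A \<Longrightarrow> y \<in> carrier G \<Longrightarrow> \<beta> a y = 0"
    and cocycle_t: "\<And>y. y \<in> carrier G \<Longrightarrow> \<beta> t y = of_bool (inv t \<otimes> y \<in> C) - of_bool (y \<in> C)"
    and finite_support: "\<And>x. x \<in> carrier G \<Longrightarrow>
      \<exists>F. finite F \<and> F \<subseteq> carrier G \<and> (\<forall>y\<in>carrier G. \<beta> x y \<noteq> 0 \<longrightarrow> (\<exists>f\<in>F. inv f \<otimes> y \<in> C))"
begin

section \<open>Edges of the axis of \<open>s \<otimes> t\<close>\<close>

lemma in_carrier [simp, intro]:
  "x \<in> A \<Longrightarrow> x \<in> carrier G" "x \<in> B \<Longrightarrow> x \<in> carrier G" "x \<in> C \<Longrightarrow> x \<in> carrier G"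
  using subA subB subC by (auto dest: subgroup.mem_carrier)

lemma s_t_carrier [simp]: "s \<in> carrier G" "t \<in> carrier G"
  using sA tB by auto

definition g :: 'a where "g = s \<otimes> t"

text \<open>The edges represented by \<open>g [^] i\<close> and by
  \<open>g [^] i \<otimes> s\<close> alternate along the axis: those of 1 and \<open>s\<close> meet
  in the vertex \<open>A\<close>, those of \<open>s\<close> and \<open>g\<close> in the coset of
  \<open>B\<close> through \<open>s\<close>.\<close>

definition on_g :: "int \<Rightarrow> 'a \<Rightarrow> bool" where "on_g i y \<longleftrightarrow> g [^] (- i) \<otimes> y \<in> C"
definition on_s :: "int \<Rightarrow> 'a \<Rightarrow> bool" where "on_s i y \<longleftrightarrow> inv s \<otimes> (g [^] (- i) \<otimes> y) \<in> C"

lemma g_carrier [simp]: "g \<in> carrier G" by (simp add: g_def)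

lemma g_pow_A: "g [^] (n::int) \<in> A \<Longrightarrow> n = 0" and g_pow_B: "g [^] (n::int) \<in> B \<Longrightarrow> n = 0"
  using powA powB by (simp_all add: g_def)

lemma g_pow_C: "g [^] (n::int) \<in> C \<Longrightarrow> n = 0"
  using g_pow_A CA by blast

lemma one_C [simp]: "\<one> \<in> C"
  using subC by (rule subgroup.one_closed)

lemma C_div: "x \<in> C \<Longrightarrow> y \<in> C \<Longrightarrow> x \<otimes> inv y \<in> C"
  using subC by (simp add: subgroup.m_closed subgroup.m_inv_closed)

lemma pow_shift [simp]:
  "y \<in> carrier G \<Longrightarrow> g [^] (i::int) \<otimes> (g [^] (j::int) \<otimes> y) = g [^] (i + j) \<otimes> y"
  by (simp add: int_pow_mult m_assoc)

lemma div_eq: "a \<in> carrier G \<Longrightarrow> b \<in> carrier G \<Longrightarrow> y \<in> carrier G \<Longrightarrow> (a \<otimes> y) \<otimes> inv (b \<otimes> y) = a \<otimes> inv b"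
  by (simp add: inv_mult_group m_assoc)

lemma on_g_unique:
  assumes "y \<in> carrier G" "on_g i y" "on_g j y"
  shows "i = j"
proof -
  have "g [^] (- i) \<otimes> inv (g [^] (- j)) \<in> C"
    using C_div[of "g [^] (- i) \<otimes> y" "g [^] (- j) \<otimes> y"] assms by (simp add: on_g_def div_eq)
  then have "g [^] (j - i) \<in> C"
    by (simp flip: int_pow_neg int_pow_mult)
  then show ?thesis using g_pow_C by force
qed

text \<open>The quotient of the two members of \<open>C\<close> is a power of \<open>g\<close>
  conjugated by \<open>s\<close>. As \<open>s\<close> lies in \<open>A\<close>, the power itself
  lies in \<open>A\<close>.\<close>

lemma on_s_unique:
  assumes "y \<in> carrier G" "on_s i y" "on_s j y"
  shows "i = j"
proof -
  have "inv s \<otimes> g [^] (- i) \<otimes> inv (inv s \<otimes> g [^] (- j)) \<in> C"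
    using C_div[of "inv s \<otimes> g [^] (- i) \<otimes> y" "inv s \<otimes> g [^] (- j) \<otimes> y"] assms
      div_eq[of "inv s \<otimes> g [^] (- i)" "inv s \<otimes> g [^] (- j)" y]
    by (metis g_carrier int_pow_closed inv_closed m_assoc m_closed on_s_def s_t_carrier(1))
  moreover have "inv s \<otimes> g [^] (- i) \<otimes> inv (inv s \<otimes> g [^] (- j)) = inv s \<otimes> g [^] (j - i) \<otimes> s"
    by (simp add: inv_mult_group m_assoc flip: int_pow_neg)
  ultimately have "inv s \<otimes> g [^] (j - i) \<otimes> s \<in> A" using CA by auto
  then have "s \<otimes> (inv s \<otimes> g [^] (j - i) \<otimes> s) \<otimes> inv s \<in> A"
    using sA subA by (simp add: subgroup.m_closed subgroup.m_inv_closed)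
  then have "g [^] (j - i) \<in> A" by (simp add: m_assoc)
  then show ?thesis using g_pow_A by force
qed

text \<open>Otherwise the quotient \<open>g [^] (j - i) \<otimes> s\<close> would lie in
  \<open>C\<close>. Then the power lies in \<open>A\<close>, its exponent is zero, and
  \<open>s\<close> would lie in \<open>C\<close>.\<close>

lemma not_on_g_on_s:
  assumes "y \<in> carrier G" "on_g i y" "on_s j y"
  shows False
proof -
  have *: "g [^] (- i) \<otimes> inv (inv s \<otimes> g [^] (- j)) \<in> C"
    using C_div[of "g [^] (- i) \<otimes> y" "inv s \<otimes> g [^] (- j) \<otimes> y"] assms
      div_eq[of "g [^] (- i)" "inv s \<otimes> g [^] (- j)" y]
    by (metis g_carrier int_pow_closed inv_closed m_assoc m_closed on_g_def on_s_def s_t_carrier(1))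
  have eq: "g [^] (- i) \<otimes> inv (inv s \<otimes> g [^] (- j)) = g [^] (j - i) \<otimes> s"
    by (simp add: inv_mult_group m_assoc flip: int_pow_neg)
  have "g [^] (j - i) \<otimes> s \<otimes> inv s \<in> A"
    using * CA sA subA unfolding eq by (blast intro: subgroup.m_closed subgroup.m_inv_closed)
  then have "g [^] (j - i) \<in> A" by (simp add: m_assoc)
  then have "j = i" using g_pow_A by force
  then have "s \<in> C" using * unfolding eq by simp
  then show False using sC by simp
qed

lemma on_g_pow: "y \<in> carrier G \<Longrightarrow> on_g i (g [^] (n::int) \<otimes> y) \<longleftrightarrow> on_g (i - n) y"
  by (simp add: on_g_def)

lemma on_s_pow: "y \<in> carrier G \<Longrightarrow> on_s i (g [^] (n::int) \<otimes> y) \<longleftrightarrow> on_s (i - n) y"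
  by (simp add: on_s_def)

lemma on_g_C: "y \<in> carrier G \<Longrightarrow> c \<in> C \<Longrightarrow> on_g i y \<Longrightarrow> on_g i (y \<otimes> c)"
  unfolding on_g_def using subC by (simp flip: m_assoc) (rule subgroup.m_closed)

section \<open>The cocycle along the axis\<close>

lemma cocycle_one: "y \<in> carrier G \<Longrightarrow> \<beta> \<one> y = 0"
  using cocycle_A subA by (simp add: subgroup.one_closed)

lemma cocycle_g: "y \<in> carrier G \<Longrightarrow> \<beta> g y = of_bool (on_g 1 y) - of_bool (on_s 0 y)"
  using cocycle[of s t y] cocycle_A[OF sA]
  by (simp add: g_def on_g_def on_s_def cocycle_t int_pow_neg inv_mult_group m_assoc)

text \<open>Each period of the path from \<open>A\<close> to its image crosses one edge of type
  \<open>on_s\<close> with sign -1 and one of type \<open>on_g\<close> with sign +1; the induction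
  appends the last period.\<close>

lemma cocycle_g_pow:
  "y \<in> carrier G \<Longrightarrow>
    \<beta> (g [^] int n) y = (\<Sum>i<n. of_bool (on_g (int i + 1) y) - of_bool (on_s (int i) y))"
proof (induction n arbitrary: y)
  case 0
  then show ?case by (simp add: cocycle_one)
next
  case (Suc n)
  have "g [^] int (Suc n) = g [^] int n \<otimes> g"
    using int_pow_mult[of g "int n" 1] by (simp add: add.commute)
  then have "\<beta> (g [^] int (Suc n)) y = \<beta> (g [^] int n) y + \<beta> g (g [^] (- int n) \<otimes> y)"
    using Suc.prems by (simp add: cocycle int_pow_neg)
  also have "\<beta> g (g [^] (- int n) \<otimes> y) = of_bool (on_g (int n + 1) y) - of_bool (on_s (int n) y)"
    using Suc.prems by (simp add: cocycle_g on_g_pow on_s_pow add.commute)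
  finally show ?case
    using Suc by simp
qed


lemma cocycle_pow_minus:
  assumes "x \<in> carrier G" "y \<in> carrier G"
  shows "\<beta> (x [^] (- n)) y = - \<beta> (x [^] n) (x [^] (n::int) \<otimes> y)"
proof -
  have "x [^] (- n) \<otimes> x [^] n = \<one>" using assms by (simp flip: int_pow_mult)
  then have "\<beta> (x [^] (- n)) y + \<beta> (x [^] n) (inv (x [^] (- n)) \<otimes> y) = 0"
    using cocycle[of "x [^] (- n)" "x [^] n" y] assms cocycle_one by simp
  then show ?thesis using assms by (simp add: int_pow_neg)
qed

text \<open>The characteristic function of the axis of \<open>s \<otimes> t\<close> in the Bass--Serre tree, edges being
  counted with sign according to their orientation along the axis.\<close>

definition axis :: "'a \<Rightarrow> int" where
  "axis y = of_bool (\<exists>i. on_g i y) - of_bool (\<exists>i. on_s i y)"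

text \<open>The sums run over the windows from \<open>d\<close> to \<open>d + n - 1\<close> and from
  \<open>d - n\<close> to \<open>d - 1\<close>. These are disjoint and adjacent, so for large
  \<open>n\<close> the only possible index is caught exactly once.\<close>

lemma sum_of_bool_unique:
  fixes P :: "int \<Rightarrow> bool"
  assumes "\<And>i j. P i \<Longrightarrow> P j \<Longrightarrow> i = j"
  shows "\<exists>N. \<forall>n\<ge>N. (\<Sum>i<n. of_bool (P (int i + d))) + (\<Sum>i<n. of_bool (P (int i + d - int n))) =
    (of_bool (\<exists>i. P i) :: int)"
proof (cases "\<exists>k. P k")
  case True
  then obtain k where "P k" by blast
  with assms have P: "P i \<longleftrightarrow> i = k" for i by blast
  have 1: "(\<Sum>i<n. of_bool (int i + e = k)) = (of_bool (e \<le> k \<and> k < int n + e) :: int)" for n :: nat and e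
  proof -
    have "(\<Sum>i<n. of_bool (int i + e = k)) = (\<Sum>i<n. if i = nat (k - e) then of_bool (e \<le> k) else 0 :: int)"
      by (intro sum.cong refl) auto
    also have "\<dots> = of_bool (e \<le> k \<and> k < int n + e)"
      by (subst sum.delta) auto
    finally show ?thesis .
  qed
  show ?thesis
  proof (intro exI allI impI)
    fix n assume n: "nat (\<bar>k\<bar> + \<bar>d\<bar> + 1) \<le> n"
    have *: "int i + d - int n = int i + (d - int n)" for i by simp
    show "(\<Sum>i<n. of_bool (P (int i + d))) + (\<Sum>i<n. of_bool (P (int i + d - int n))) =
      (of_bool (\<exists>i. P i) :: int)"
      unfolding P 1 * using n by auto
  qed
qed auto

text \<open>The difference counts the path between the images of \<open>A\<close> under
  \<open>g [^] (- int n)\<close> and \<open>g [^] int n\<close>, which exhausts the axis as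
  \<open>n\<close> grows.\<close>

lemma axis_limit:
  assumes y: "y \<in> carrier G"
  shows "\<exists>N. \<forall>n\<ge>N. \<beta> (g [^] int n) y - \<beta> (g [^] (- int n)) y = axis y"
proof -
  obtain N where N: "\<And>n. N \<le> n \<Longrightarrow> (\<Sum>i<n. of_bool (on_g (int i + 1) y)) +
      (\<Sum>i<n. of_bool (on_g (int i + 1 - int n) y)) = (of_bool (\<exists>i. on_g i y) :: int)"
    using sum_of_bool_unique[of "\<lambda>i. on_g i y" 1] on_g_unique[OF y] by blast
  obtain M where M: "\<And>n. M \<le> n \<Longrightarrow> (\<Sum>i<n. of_bool (on_s (int i + 0) y)) +
      (\<Sum>i<n. of_bool (on_s (int i + 0 - int n) y)) = (of_bool (\<exists>i. on_s i y) :: int)"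
    using sum_of_bool_unique[of "\<lambda>i. on_s i y" 0] on_s_unique[OF y] by blast
  show ?thesis
  proof (intro exI[of _ "max M N"] allI impI)
    fix n assume "max M N \<le> n"
    then show "\<beta> (g [^] int n) y - \<beta> (g [^] (- int n)) y = axis y"
      using N[of n] M[of n] y
      unfolding cocycle_pow_minus[OF g_carrier y] axis_def
      by (simp add: cocycle_g_pow on_g_pow on_s_pow sum_subtractf)
  qed
qed

section \<open>Elements translating the axis\<close>

text \<open>\<open>translates z j\<close>: the element \<open>z\<close> acts on the axis as the \<open>j\<close>-th power of \<open>s \<otimes> t\<close>.\<close>

definition translates :: "'a \<Rightarrow> int \<Rightarrow> bool" where
  "translates z j \<longleftrightarrow> z \<in> carrier G \<and> (\<forall>i. on_g (i + j) (z \<otimes> g [^] i))"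

lemma translates_carrier: "translates z j \<Longrightarrow> z \<in> carrier G"
  by (simp add: translates_def)

lemma on_g_iff: "y \<in> carrier G \<Longrightarrow> on_g i y \<longleftrightarrow> (\<exists>c\<in>C. y = g [^] i \<otimes> c)"
  unfolding on_g_def
  by (metis (no_types, opaque_lifting) g_carrier in_carrier(3) int_pow_closed int_pow_neg inv_closed
      inv_mult_cancel(1,2) m_closed)

lemma translates_iff:
  "translates z j \<longleftrightarrow> z \<in> carrier G \<and> (\<forall>i. \<exists>c\<in>C. z \<otimes> g [^] i = g [^] (i + j) \<otimes> c)"
  unfolding translates_def using on_g_iff by (metis g_carrier int_pow_closed m_closed)

lemma translates_mult:
  assumes "translates x i" "translates y j"
  shows "translates (x \<otimes> y) (i + j)"
proof -
  have xy: "x \<in> carrier G" "y \<in> carrier G" using assms translates_carrier by auto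
  have "on_g (k + (i + j)) (x \<otimes> y \<otimes> g [^] k)" for k
  proof -
    obtain c where c: "c \<in> C" "y \<otimes> g [^] k = g [^] (k + j) \<otimes> c"
      using assms(2) unfolding translates_iff by blast
    then have "x \<otimes> y \<otimes> g [^] k = x \<otimes> g [^] (k + j) \<otimes> c" using xy by (simp add: m_assoc)
    moreover have "on_g (k + j + i) (x \<otimes> g [^] (k + j))" using assms(1) by (simp add: translates_def)
    ultimately show ?thesis using on_g_C c xy by (simp add: add_ac)
  qed
  then show ?thesis using xy by (simp add: translates_def)
qed

lemma translates_inv:
  assumes "translates x i"
  shows "translates (inv x) (- i)"
proof -
  have x: "x \<in> carrier G" using assms translates_carrier by auto
  have "on_g (k + - i) (inv x \<otimes> g [^] k)" for k
  proof -
    obtain c where c: "c \<in> C" "x \<otimes> g [^] (k - i) = g [^] k \<otimes> c"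
      using assms unfolding translates_iff by (metis diff_add_cancel)
    then have "g [^] k = x \<otimes> g [^] (k - i) \<otimes> inv c" using x by (simp add: m_assoc)
    then have "inv x \<otimes> g [^] k = inv x \<otimes> (x \<otimes> (g [^] (k - i) \<otimes> inv c))"
      using x c by (metis g_carrier in_carrier(3) int_pow_closed inv_closed m_assoc)
    then have "inv x \<otimes> g [^] k = g [^] (k - i) \<otimes> inv c" using x c by simp
    moreover have "inv c \<in> C" using c subC by (simp add: subgroup.m_inv_closed)
    ultimately show ?thesis using x by (subst on_g_iff) auto
  qed
  then show ?thesis using x by (simp add: translates_def)
qed

lemma translates_one: "translates \<one> 0"
  by (auto simp: translates_def on_g_def simp flip: int_pow_mult)

lemma translates_pow: "translates x i \<Longrightarrow> translates (x [^] (n::int)) (i * n)"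
proof -
  assume x: "translates x i"
  then have xc: "x \<in> carrier G" by (rule translates_carrier)
  have nat: "translates (x [^] int n) (i * int n)" for n
  proof (induction n)
    case (Suc n)
    have "x [^] int (Suc n) = x [^] int n \<otimes> x"
      using int_pow_mult[of x "int n" 1] xc by (simp add: add.commute)
    then show ?case using translates_mult[OF Suc x] by (simp add: algebra_simps)
  qed (simp add: translates_one)
  show ?thesis
  proof (cases "n \<ge> 0")
    case True
    then show ?thesis using nat[of "nat n"] by simp
  next
    case False
    then show ?thesis using translates_inv[OF nat[of "nat (- n)"]] xc by (simp add: int_pow_neg)
  qed
qed

text \<open>At exponent 0, \<open>translates\<close> gives \<open>z = g [^] j \<otimes> c\<close>
  with \<open>c\<close> in \<open>C\<close>, and \<open>c\<close> fixes the base vertex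
  \<open>A\<close>.\<close>

lemma cocycle_translates:
  assumes "translates z j" "y \<in> carrier G"
  shows "\<beta> z y = \<beta> (g [^] j) y"
proof -
  obtain c where c: "c \<in> C" "z \<otimes> g [^] (0::int) = g [^] (0 + j) \<otimes> c"
    using assms unfolding translates_iff by blast
  then have "z = g [^] j \<otimes> c" using assms translates_carrier by simp
  then show ?thesis using c assms cocycle[of "g [^] j" c y] cocycle_A[of c] CA by auto
qed


section \<open>Free action of translations on edges\<close>

text \<open>Finitely many edges carry a nonzero value of \<open>\<beta> x\<close>, and by freeness
  each of them contains \<open>z [^] n \<otimes> y\<close> for at most one \<open>n\<close>. The
  variable \<open>c\<close> admits any representative of the edge.\<close>

lemma finite_orbit_support:
  assumes x: "x \<in> carrier G" and y: "y \<in> carrier G" and z: "z \<in> carrier G"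
    and free: "\<And>n::int. inv y \<otimes> (z [^] n \<otimes> y) \<in> C \<Longrightarrow> n = 0"
  shows "finite {n::int. \<exists>c\<in>C. \<beta> x (z [^] n \<otimes> y \<otimes> c) \<noteq> 0}" (is "finite ?S")
proof -
  obtain F where F: "finite F" "F \<subseteq> carrier G"
      "\<And>v. v \<in> carrier G \<Longrightarrow> \<beta> x v \<noteq> 0 \<Longrightarrow> \<exists>f\<in>F. inv f \<otimes> v \<in> C"
    using finite_support[OF x] by blast
  let ?T = "\<lambda>f. {n::int. inv f \<otimes> (z [^] n \<otimes> y) \<in> C}"
  have "finite (?T f)" if "f \<in> F" for f
  proof -
    have f: "f \<in> carrier G" using F that by auto
    have "m = n" if "m \<in> ?T f" "n \<in> ?T f" for m n
    proof -
      have "inv (inv f \<otimes> (z [^] m \<otimes> y)) \<otimes> (inv f \<otimes> (z [^] n \<otimes> y)) \<in> C"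
        using that subC by (simp add: subgroup.m_closed subgroup.m_inv_closed)
      also have "inv (inv f \<otimes> (z [^] m \<otimes> y)) \<otimes> (inv f \<otimes> (z [^] n \<otimes> y)) =
          inv y \<otimes> (inv (z [^] m) \<otimes> (z [^] n \<otimes> y))"
        using y z f by (simp add: inv_mult_group m_assoc)
      also have "\<dots> = inv y \<otimes> (z [^] (n - m) \<otimes> y)"
        using int_pow_mult[of z "- m" n] y z by (simp add: int_pow_neg m_assoc)
      finally show "m = n" using free by force
    qed
    then show ?thesis by (metis (no_types, lifting) finite.simps finite_subset insertCI subsetI)
  qed
  moreover have "?S \<subseteq> (\<Union>f\<in>F. ?T f)"
  proof
    fix n assume "n \<in> ?S"
    then obtain c where c: "c \<in> C" "\<beta> x (z [^] n \<otimes> y \<otimes> c) \<noteq> 0" by blast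
    then obtain f where f: "f \<in> F" "inv f \<otimes> (z [^] n \<otimes> y \<otimes> c) \<in> C"
      using F(3) y z by (metis in_carrier(3) int_pow_closed m_closed)
    have "inv f \<otimes> (z [^] n \<otimes> y \<otimes> c) \<otimes> inv c \<in> C"
      using C_div f c by blast
    moreover have "f \<in> carrier G" using f F by auto
    ultimately have "inv f \<otimes> (z [^] n \<otimes> y) \<in> C" using c y z by (simp add: m_assoc)
    then show "n \<in> (\<Union>f\<in>F. ?T f)" using f by blast
  qed
  ultimately show ?thesis using F(1) by (meson finite_UN_I finite_subset)
qed

text \<open>If \<open>z\<close> fixed the edge \<open>y\<close>, then the path from the base point to its image under \<open>z\<^sup>k\<close> would
  be bounded, while it has length growing with \<open>k\<close>.\<close>

lemma translates_free_pos:
  assumes z: "translates z j" and j: "j > 0" and y: "y \<in> carrier G"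
    and fx: "inv y \<otimes> (z \<otimes> y) \<in> C"
  shows False
proof -
  have zc: "z \<in> carrier G" using z by (rule translates_carrier)
  have pow: "\<exists>c\<in>C. z [^] int k \<otimes> y = y \<otimes> c" for k
  proof (induction k)
    case 0
    then show ?case using y by (auto intro: bexI[of _ \<one>])
  next
    case (Suc k)
    then obtain c where c: "c \<in> C" "z [^] int k \<otimes> y = y \<otimes> c" by blast
    have "z [^] int (Suc k) = z \<otimes> z [^] int k"
      using int_pow_mult[of z 1 "int k"] zc by simp
    then have "z [^] int (Suc k) \<otimes> y = z \<otimes> y \<otimes> c" using c zc y by (simp add: m_assoc)
    also have "\<dots> = y \<otimes> (inv y \<otimes> (z \<otimes> y) \<otimes> c)" using c zc y by (simp add: m_assoc)
    finally show ?case using c fx subC by (blast intro: subgroup.m_closed)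
  qed
  have "finite {n::int. \<exists>c\<in>C. \<beta> y (g [^] n \<otimes> \<one> \<otimes> c) \<noteq> 0}"
    using y g_pow_C by (intro finite_orbit_support) auto
  then have fin: "finite {n::int. \<exists>c\<in>C. \<beta> y (g [^] n \<otimes> c) \<noteq> 0}" (is "finite ?S") by simp
  \<comment> \<open>Beyond \<open>R\<close>, the path from \<open>A\<close> to its image under
    \<open>y\<close> contains no edge \<open>g [^] n\<close>.\<close>
  then obtain R where R: "\<And>n. n \<in> ?S \<Longrightarrow> \<bar>n\<bar> \<le> R" "R \<ge> 0"
  proof -
    from fin have "finite (abs ` ?S)" by simp
    then have "\<forall>n\<in>?S. \<bar>n\<bar> \<le> Max (insert 0 (abs ` ?S))" "0 \<le> Max (insert 0 (abs ` ?S))" by auto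
    then show thesis using that by blast
  qed
  \<comment> \<open>The edge \<open>g [^] i\<close> lies beyond this bound on one side; shifting it
    back by the translation length \<open>J\<close> of \<open>z [^] int k\<close> takes it beyond
    the bound on the other side.\<close>
  define k where "k = nat (2 * R + 3)"
  define i where "i = R + 1"
  define J where "J = nat (j * int k)"
  have J: "int J = j * int k" using j by (simp add: J_def)
  have k: "int J \<ge> 2 * R + 3" using j R(2) mult_right_mono[of 1 j "int k"] by (simp add: J k_def)
  obtain c where c: "c \<in> C" "z [^] int k \<otimes> y = y \<otimes> c" using pow by blast
  \<comment> \<open>Both sides expand the cocycle of
    \<open>z [^] int k \<otimes> y = y \<otimes> c\<close>. The right side vanishes and the first
    term on the left is 1, so the shifted edge would have to lie on the path of
    \<open>y\<close>.\<close>
  have "\<beta> (z [^] int k) (g [^] i) + \<beta> y (inv (z [^] int k) \<otimes> g [^] i) = \<beta> y (g [^] i) + \<beta> c (inv y \<otimes> g [^] i)"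
    using cocycle[of "z [^] int k" y "g [^] i"] cocycle[of y c "g [^] i"] c y zc by simp
  moreover have "\<beta> c (inv y \<otimes> g [^] i) = 0" using c y cocycle_A CA by auto
  moreover have "\<beta> y (g [^] i) = 0"
  proof -
    have "i \<notin> ?S" using R(1)[of i] R(2) by (auto simp: i_def)
    then show ?thesis by (auto dest!: bspec[OF _ one_C])
  qed
  moreover have "\<beta> (z [^] int k) (g [^] i) = 1"
  proof -
    have gi: "g [^] i \<in> carrier G" by simp
    have on: "on_g i (g [^] i)" by (simp add: on_g_def flip: int_pow_mult)
    have "\<beta> (z [^] int k) (g [^] i) = \<beta> (g [^] int J) (g [^] i)"
      using cocycle_translates[OF translates_pow[OF z], of "g [^] i" "int k"] J by (metis g_carrier int_pow_closed)
    moreover have "of_bool (on_g (int l + 1) (g [^] i)) - of_bool (on_s (int l) (g [^] i)) =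
        (if l = nat R then 1 else (0::int))" for l
    proof -
      have "\<not> on_s (int l) (g [^] i)" by (rule notI) (rule not_on_g_on_s[OF gi on])
      moreover have "on_g (int l + 1) (g [^] i) \<longleftrightarrow> int l + 1 = i"
        by (rule iffI, erule on_g_unique[OF gi _ on], simp add: on)
      ultimately show ?thesis using R(2) by (auto simp: i_def)
    qed
    then have "\<beta> (g [^] int J) (g [^] i) = (\<Sum>l<J. if l = nat R then 1 else 0)"
      using cocycle_g_pow[of "g [^] i" J] by simp
    moreover have "nat R < J" using k R(2) by linarith
    ultimately show ?thesis by simp
  qed
  ultimately have "\<beta> y (inv (z [^] int k) \<otimes> g [^] i) \<noteq> 0" by simp
  moreover obtain c' where "c' \<in> C" "inv (z [^] int k) \<otimes> g [^] i = g [^] (i + - int J) \<otimes> c'"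
    using translates_inv[OF translates_pow[OF z, of "int k"]] unfolding translates_iff J by blast
  ultimately have "i - int J \<in> ?S" by auto
  then show False using R(1)[of "i - int J"] R(2) k by (simp add: i_def)
qed

lemma translates_free:
  assumes z: "translates z j" and j: "j \<noteq> 0" and y: "y \<in> carrier G"
    and fx: "inv y \<otimes> (z [^] (n::int) \<otimes> y) \<in> C"
  shows "n = 0"
proof (rule ccontr)
  assume n: "n \<noteq> 0"
  note tr = translates_pow[OF z, of n]
  have zn: "z [^] n \<in> carrier G" using tr by (rule translates_carrier)
  show False
  proof (cases "j * n > 0")
    case True
    then show False using translates_free_pos[OF tr _ y fx] by blast
  next
    case False
    then have "- (j * n) > 0" using n j by (simp add: linorder_not_less order_less_le)
    moreover have "inv (inv y \<otimes> (z [^] n \<otimes> y)) \<in> C" using fx subC by (simp add: subgroup.m_inv_closed)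
    then have "inv y \<otimes> (inv (z [^] n) \<otimes> y) \<in> C" using y zn by (simp add: inv_mult_group m_assoc)
    ultimately show False using translates_free_pos[OF translates_inv[OF tr] _ y] by blast
  qed
qed

text \<open>A nontrivial translation acts freely on edges, so the orbit of \<open>y\<close> leaves
  the finite path belonging to \<open>x\<close>.\<close>

lemma cocycle_vanishes:
  assumes z: "translates z j" and j: "j \<noteq> 0" and x: "x \<in> carrier G" and y: "y \<in> carrier G"
  shows "\<exists>N. \<forall>n. N \<le> \<bar>n\<bar> \<longrightarrow> \<beta> x (z [^] (n::int) \<otimes> y) = 0"
proof -
  have zc: "z \<in> carrier G" using z by (rule translates_carrier)
  have "finite {n::int. \<exists>c\<in>C. \<beta> x (z [^] n \<otimes> y \<otimes> c) \<noteq> 0}" (is "finite ?S")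
    by (rule finite_orbit_support[OF x y zc translates_free[OF z j y]])
  then have fin: "finite (abs ` ?S)" by simp
  have "\<beta> x (z [^] n \<otimes> y) = 0" if "Max (insert 0 (abs ` ?S)) + 1 \<le> \<bar>n\<bar>" for n
  proof (rule ccontr)
    assume "\<beta> x (z [^] n \<otimes> y) \<noteq> 0"
    then have "n \<in> ?S" using y zc by (auto intro!: bexI[of _ \<one>])
    then have "\<bar>n\<bar> \<le> Max (insert 0 (abs ` ?S))" using fin by auto
    then show False using that by simp
  qed
  then show ?thesis by blast
qed

section \<open>Elements commuting with a translation\<close>

text \<open>Expand the cocycle of \<open>x \<otimes> z [^] n = z [^] n \<otimes> x\<close> in both
  orders. Subtracting the equations for a large \<open>n\<close> and its negative removes
  \<open>\<beta> x y\<close>; the values of \<open>\<beta> x\<close> at shifted edges vanish, and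
  what remains are the limits of \<open>axis_limit\<close> at \<open>y\<close> and at
  \<open>inv x \<otimes> y\<close>.\<close>

lemma axis_invariant:
  assumes z: "translates z j" and j: "j > 0" and x: "x \<in> carrier G" and y: "y \<in> carrier G"
    and comm: "x \<otimes> z = z \<otimes> x"
  shows "axis (inv x \<otimes> y) = axis y"
proof -
  have zc: "z \<in> carrier G" using z by (rule translates_carrier)
  define y' where "y' = inv x \<otimes> y"
  have y': "y' \<in> carrier G" using x y by (simp add: y'_def)
  obtain N where N: "\<And>n. N \<le> n \<Longrightarrow> \<beta> (g [^] int n) y - \<beta> (g [^] (- int n)) y = axis y"
    using axis_limit[OF y] by blast
  obtain M where M: "\<And>n. M \<le> n \<Longrightarrow> \<beta> (g [^] int n) y' - \<beta> (g [^] (- int n)) y' = axis y'"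
    using axis_limit[OF y'] by blast
  obtain L where L: "\<And>n. L \<le> \<bar>n\<bar> \<Longrightarrow> \<beta> x (z [^] (n::int) \<otimes> y) = 0"
    using cocycle_vanishes[OF z _ x y] j by auto
  \<comment> \<open>\<open>N\<close> and \<open>M\<close> serve the two limits, \<open>L\<close> the
    vanishing of the cocycle of \<open>x\<close>; \<open>J\<close> is at least \<open>k\<close>
    because \<open>j\<close> is positive.\<close>
  define k where "k = N + M + nat \<bar>L\<bar>"
  define J where "J = nat (j * int k)"
  have J: "int J = j * int k" "J \<ge> k" using j mult_right_mono[of 1 j "int k"] by (auto simp: J_def)
  have NM: "N \<le> J" "M \<le> J" using J(2) by (auto simp: k_def)
  have bz: "\<beta> (z [^] (int k)) v = \<beta> (g [^] int J) v" "\<beta> (z [^] (- int k)) v = \<beta> (g [^] (- int J)) v"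
    if "v \<in> carrier G" for v
    using cocycle_translates[OF translates_pow[OF z, of "int k"] that]
      cocycle_translates[OF translates_pow[OF z, of "- int k"] that] J by simp_all
  have comm_pow: "x \<otimes> z [^] (n::int) = z [^] n \<otimes> x" for n
  proof -
    have *: "x \<otimes> z [^] int n = z [^] int n \<otimes> x" for n
    proof (induction n)
      case (Suc n)
      have "z [^] int (Suc n) = z \<otimes> z [^] int n"
        using int_pow_mult[of z 1 "int n"] zc by simp
      then show ?case using Suc comm zc x by (simp flip: m_assoc) (simp add: m_assoc)
    qed (use x in simp)
    show ?thesis
    proof (cases "n \<ge> 0")
      case True
      then show ?thesis using *[of "nat n"] by simp
    next
      case False
      then have "x \<otimes> inv (z [^] n) = inv (z [^] n) \<otimes> x"
        using *[of "nat (- n)"] zc by (simp add: int_pow_neg)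
      then show ?thesis using commute_inv[of x "inv (z [^] n)"] zc x by simp
    qed
  qed
  have eq: "\<beta> x y + \<beta> (z [^] n) y' = \<beta> (z [^] n) y + \<beta> x (z [^] (- n) \<otimes> y)" for n :: int
    using cocycle[of x "z [^] n" y] cocycle[of "z [^] n" x y] x y zc comm_pow[of n]
    by (simp add: y'_def int_pow_neg)
  have Lk: "\<beta> x (z [^] int k \<otimes> y) = 0" "\<beta> x (z [^] (- int k) \<otimes> y) = 0"
    using L[of "int k"] L[of "- int k"] by (auto simp: k_def)
  have "\<beta> (z [^] (int k)) y' - \<beta> (z [^] (- int k)) y' = \<beta> (z [^] (int k)) y - \<beta> (z [^] (- int k)) y"
    using eq[of "int k"] eq[of "- int k"] Lk by simp
  then show ?thesis
    using N[OF NM(1)] M[OF NM(2)] by (simp only: bz[OF y] bz[OF y'] flip: y'_def)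
qed

lemma axis_eq_1: "y \<in> carrier G \<Longrightarrow> axis y = 1 \<longleftrightarrow> (\<exists>i. on_g i y)"
  and axis_eq_minus_1: "y \<in> carrier G \<Longrightarrow> axis y = - 1 \<longleftrightarrow> (\<exists>i. on_s i y)"
  using not_on_g_on_s[of y] by (auto simp: axis_def)

lemma on_s_iff: "y \<in> carrier G \<Longrightarrow> on_s i y \<longleftrightarrow> (\<exists>c\<in>C. y = g [^] i \<otimes> s \<otimes> c)"
proof
  assume y: "y \<in> carrier G" and "on_s i y"
  then have "g [^] i \<otimes> (s \<otimes> (inv s \<otimes> (g [^] (- i) \<otimes> y))) = y" "inv s \<otimes> (g [^] (- i) \<otimes> y) \<in> C"
    by (simp_all add: on_s_def int_pow_neg)
  then show "\<exists>c\<in>C. y = g [^] i \<otimes> s \<otimes> c"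
    by (metis g_carrier in_carrier(3) int_pow_closed m_assoc s_t_carrier(1))
qed (auto simp: on_s_def m_assoc)

text \<open>Consecutive edges of the axis share a vertex, which is a coset of \<open>A\<close> or of \<open>B\<close>.\<close>

lemma translates_if_axis_invariant:
  assumes x: "x \<in> carrier G" and inv: "\<And>y. y \<in> carrier G \<Longrightarrow> axis (inv x \<otimes> y) = axis y"
  shows "\<exists>j. translates x j"
proof -
  have inv': "axis (x \<otimes> y) = axis y" if "y \<in> carrier G" for y
    using inv[of "x \<otimes> y"] that x by simp
  have "\<exists>j. on_g j (x \<otimes> g [^] i)" for i :: int
  proof -
    have "on_g i (g [^] i)" by (simp add: on_g_def flip: int_pow_mult)
    then have "axis (x \<otimes> g [^] i) = 1" using inv' axis_eq_1 by auto
    then show ?thesis using axis_eq_1 x by simp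
  qed
  then obtain f where f: "\<And>i. on_g (f i) (x \<otimes> g [^] (i::int))" by metis
  have "\<exists>j. on_s j (x \<otimes> (g [^] i \<otimes> s))" for i :: int
  proof -
    have "on_s i (g [^] i \<otimes> s)" by (simp add: on_s_def)
    then have "axis (x \<otimes> (g [^] i \<otimes> s)) = - 1" using inv' axis_eq_minus_1 by auto
    then show ?thesis using axis_eq_minus_1 x by simp
  qed
  then obtain f' where f': "\<And>i. on_s (f' i) (x \<otimes> (g [^] (i::int) \<otimes> s))" by metis
  \<comment> \<open>The edges of \<open>g [^] i\<close> and \<open>g [^] i \<otimes> s\<close> meet
    in a coset of \<open>A\<close>, and so do their images; this puts a power of \<open>g\<close>
    into \<open>A\<close>.\<close>
  have ff': "f' i = f i" for i
  proof -
    obtain c where c: "c \<in> C" "x \<otimes> g [^] i = g [^] f i \<otimes> c" using f on_g_iff x by force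
    obtain c' where c': "c' \<in> C" "x \<otimes> (g [^] i \<otimes> s) = g [^] f' i \<otimes> s \<otimes> c'" using f' on_s_iff x by force
    have "x \<otimes> (g [^] i \<otimes> s) = x \<otimes> g [^] i \<otimes> s" using x by (simp add: m_assoc)
    then have "g [^] f i \<otimes> (c \<otimes> s) = g [^] f' i \<otimes> (s \<otimes> c')"
      using c c' by (simp add: m_assoc)
    then have "g [^] (- f' i) \<otimes> (g [^] f i \<otimes> (c \<otimes> s)) = s \<otimes> c'" using c' by simp
    then have "g [^] (f i - f' i) \<otimes> (c \<otimes> s) = s \<otimes> c'" using c by simp
    then have "g [^] (f i - f' i) = s \<otimes> c' \<otimes> inv (c \<otimes> s)" using c c'
      by (metis g_carrier in_carrier(3) int_pow_closed inv_solve_right m_closed s_t_carrier(1))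
    also have "\<dots> \<in> A" using c c' CA sA subA by (meson subgroup.m_closed subgroup.m_inv_closed subsetD)
    finally show ?thesis using g_pow_A by force
  qed
  \<comment> \<open>The edges of \<open>g [^] i \<otimes> s\<close> and \<open>g [^] (i + 1)\<close>
    meet in a coset of \<open>B\<close>, so the same argument runs in \<open>B\<close>.\<close>
  have step: "f (i + 1) = f i + 1" for i
  proof -
    obtain c where c: "c \<in> C" "x \<otimes> g [^] (i + 1) = g [^] f (i + 1) \<otimes> c" using f on_g_iff x by force
    obtain c' where c': "c' \<in> C" "x \<otimes> (g [^] i \<otimes> s) = g [^] f i \<otimes> s \<otimes> c'"
      using f'[of i] on_s_iff x by (force simp: ff')
    have "x \<otimes> g [^] (i + 1) = x \<otimes> (g [^] i \<otimes> s) \<otimes> t"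
      using x by (simp add: int_pow_mult m_assoc) (simp add: g_def)
    then have "g [^] f (i + 1) \<otimes> c = g [^] f i \<otimes> s \<otimes> c' \<otimes> t" using c c' by simp
    also have "\<dots> = g [^] f i \<otimes> (g \<otimes> (inv t \<otimes> c' \<otimes> t))" using c' by (simp add: m_assoc g_def)
    also have "\<dots> = g [^] (f i + 1) \<otimes> (inv t \<otimes> c' \<otimes> t)"
      using c' by (simp add: int_pow_mult m_assoc)
    finally have "g [^] (- (f i + 1)) \<otimes> (g [^] f (i + 1) \<otimes> c) = inv t \<otimes> c' \<otimes> t"
      using c' by simp
    then have "g [^] (f (i + 1) - (f i + 1)) \<otimes> c = inv t \<otimes> c' \<otimes> t" using c by (simp add: algebra_simps)
    then have "g [^] (f (i + 1) - (f i + 1)) = inv t \<otimes> c' \<otimes> t \<otimes> inv c" using c c'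
      by (metis g_carrier in_carrier(3) int_pow_closed inv_solve_right inv_closed m_closed s_t_carrier(2))
    also have "\<dots> \<in> B" using c c' CB tB subB by (meson subgroup.m_closed subgroup.m_inv_closed subsetD)
    finally show ?thesis using g_pow_B by force
  qed
  have "f i = i + f 0" for i
  proof (induction i rule: int_induct[where k = 0])
    case (step2 i)
    then show ?case using step[of "i - 1"] by simp
  qed (simp_all add: step)
  then have "translates x (f 0)" using f x unfolding translates_def by metis
  then show ?thesis ..
qed

lemma translates_if_commutes:
  assumes z: "translates z j" and j: "j \<noteq> 0" and x: "x \<in> carrier G" and comm: "x \<otimes> z = z \<otimes> x"
  shows "\<exists>i. translates x i"
proof (cases "j > 0")
  case True
  then show ?thesis using axis_invariant[OF z True x _ comm] translates_if_axis_invariant[OF x] by blast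
next
  case False
  have "x \<otimes> inv z = inv z \<otimes> x"
    using commute_inv[OF x translates_carrier[OF z] comm] .
  then show ?thesis
    using False j axis_invariant[OF translates_inv[OF z] _ x] translates_if_axis_invariant[OF x] by simp
qed

section \<open>Commuting factors of the group\<close>

lemma translates_s_t: "translates g 1"
proof -
  have "g \<otimes> g [^] i = g [^] (i + 1) \<otimes> \<one>" for i :: int
    using int_pow_mult[of g 1 i] by (simp add: add.commute)
  then show ?thesis unfolding translates_iff using one_C g_carrier by blast
qed

lemma translates_on_g: "translates x i \<Longrightarrow> on_g i x"
  unfolding translates_def by (metis add_0 int_pow_0 r_one)

lemma translates_0_C: "translates x 0 \<Longrightarrow> x \<in> C"
  using translates_on_g[of x 0] translates_carrier[of x 0] by (simp add: on_g_def)

lemma translates_unique: "translates x i \<Longrightarrow> translates x j \<Longrightarrow> i = j"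
  by (blast intro: on_g_unique translates_on_g translates_carrier)

text \<open>The element \<open>t\<close> fixes the vertex \<open>B\<close> of the axis, so it could
  only translate by 0, and would then lie in \<open>C\<close>.\<close>

lemma not_all_translate: "\<not> (\<forall>x\<in>carrier G. \<exists>i. translates x i)"
proof
  assume "\<forall>x\<in>carrier G. \<exists>i. translates x i"
  then obtain i where "translates t i" by force
  then have "on_g i t" by (rule translates_on_g)
  then obtain c where c: "c \<in> C" "t = g [^] i \<otimes> c" using on_g_iff by force
  then have "g [^] i = t \<otimes> inv c" by (metis g_carrier in_carrier(3) int_pow_closed inv_solve_right s_t_carrier(2))
  also have "\<dots> \<in> B" using c CB tB subB by (meson subgroup.m_closed subgroup.m_inv_closed subsetD)
  finally have "i = 0" by (rule g_pow_B)
  then have "t = c" using c by simp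
  then show False using c tC by simp
qed

theorem commuting_factor_in_edge_group:
  assumes H: "subgroup H G" and K: "subgroup K G"
    and comm: "\<And>h k. h \<in> H \<Longrightarrow> k \<in> K \<Longrightarrow> h \<otimes> k = k \<otimes> h"
    and gen: "\<And>x. x \<in> carrier G \<Longrightarrow> \<exists>h\<in>H. \<exists>k\<in>K. x = h \<otimes> k"
  shows "H \<subseteq> C \<or> K \<subseteq> C"
proof -
  have not_both_translate: False
    if HT: "\<And>h. h \<in> H \<Longrightarrow> \<exists>m. translates h m" and KT: "\<And>k. k \<in> K \<Longrightarrow> \<exists>m. translates k m"
  proof -
    have "\<exists>m. translates x m" if x: "x \<in> carrier G" for x
    proof -
      obtain h k where hk: "h \<in> H" "k \<in> K" "x = h \<otimes> k" using gen[OF x] by blast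
      obtain m n where "translates h m" "translates k n"
        using HT[OF hk(1)] KT[OF hk(2)] by blast
      then show ?thesis using translates_mult hk(3) by blast
    qed
    then show False using not_all_translate by blast
  qed
  have Hc: "h \<in> carrier G" if "h \<in> H" for h using that H by (rule subgroup.mem_carrier[rotated])
  have Kc: "k \<in> carrier G" if "k \<in> K" for k using that K by (rule subgroup.mem_carrier[rotated])
  obtain h k where hk: "h \<in> H" "k \<in> K" "g = h \<otimes> k" using gen[of g] by auto
  have hkc: "h \<in> carrier G" "k \<in> carrier G" using hk Hc Kc by auto
  \<comment> \<open>The components of \<open>g\<close> commute with each other, hence with
    \<open>g\<close>, which translates the axis.\<close>
  have "h \<otimes> g = g \<otimes> h"
    unfolding hk(3) using comm[OF hk(1,2)] hkc by (metis m_assoc)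
  moreover have "k \<otimes> g = g \<otimes> k"
    unfolding hk(3) using comm[OF hk(1,2)] hkc by (metis m_assoc)
  ultimately obtain i j where ij: "translates h i" "translates k j"
    using translates_if_commutes[OF translates_s_t one_neq_zero] hkc by blast
  have "i + j = 1" using translates_mult[OF ij] translates_s_t translates_unique unfolding hk(3) by blast
  then consider "i \<noteq> 0" | "j \<noteq> 0" by linarith
  then show ?thesis
  proof cases
    case 1
    then have KT: "\<exists>n. translates k' n" if "k' \<in> K" for k'
      using translates_if_commutes[OF ij(1) 1 Kc[OF that]] comm[OF hk(1) that] by simp
    \<comment> \<open>A nonzero translation in \<open>K\<close> would force all of \<open>H\<close>
      to translate the axis as well, and with it the whole group.\<close>
    have "n = 0" if k': "k' \<in> K" "translates k' n" for k' n
    proof (rule ccontr)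
      assume "n \<noteq> 0"
      then have "\<exists>m. translates h' m" if "h' \<in> H" for h'
        using translates_if_commutes[OF k'(2) _ Hc[OF that]] comm[OF that k'(1)] by blast
      then show False using KT not_both_translate by blast
    qed
    then have "translates k' 0" if "k' \<in> K" for k' using KT that by blast
    then show ?thesis using translates_0_C by blast
  next
    case 2
    then have HT: "\<exists>n. translates h' n" if "h' \<in> H" for h'
      using translates_if_commutes[OF ij(2) 2 Hc[OF that]] comm[OF that hk(2)] by simp
    have "n = 0" if h': "h' \<in> H" "translates h' n" for h' n
    proof (rule ccontr)
      assume "n \<noteq> 0"
      then have "\<exists>m. translates k' m" if "k' \<in> K" for k'
        using translates_if_commutes[OF h'(2) _ Kc[OF that]] comm[OF h'(1) that] by simp
      then show False using HT not_both_translate by blast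
    qed
    then have "translates h' 0" if "h' \<in> H" for h' using HT that by blast
    then show ?thesis using translates_0_C by blast
  qed
qed

end


section \<open>Roots of a Coxeter system\<close>

text \<open>Chebyshev polynomials of the second kind at \<open>x / 2\<close>, with the index shifted by one.\<close>

fun chebyshev :: "real \<Rightarrow> nat \<Rightarrow> real" where
  "chebyshev x 0 = 0"
| "chebyshev x (Suc 0) = 1"
| "chebyshev x (Suc (Suc n)) = x * chebyshev x (Suc n) - chebyshev x n"

lemma chebyshev_2: "chebyshev 2 n = real n"
  by (induction n rule: induct_nat_012) auto

lemma chebyshev_cos: "chebyshev (2 * cos \<theta>) n * sin \<theta> = sin (real n * \<theta>)"
proof (induction n rule: induct_nat_012)
  case (ge2 n)
  have e: "real (Suc (Suc n)) * \<theta> = real (Suc n) * \<theta> + \<theta>" "real n * \<theta> = real (Suc n) * \<theta> - \<theta>"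
    by (simp_all add: algebra_simps)
  have "sin (real (Suc (Suc n)) * \<theta>) + sin (real n * \<theta>) = 2 * cos \<theta> * sin (real (Suc n) * \<theta>)"
    unfolding e sin_add sin_diff by simp
  then show ?case using ge2 by (simp add: algebra_simps)
qed simp_all

fun alternating :: "nat \<Rightarrow> 'a \<Rightarrow> 'a \<Rightarrow> 'a list" where
  "alternating 0 s t = []"
| "alternating (Suc n) s t = s # alternating n t s"

definition alt_letter :: "nat \<Rightarrow> 'a \<Rightarrow> 'a \<Rightarrow> 'a" where
  "alt_letter k s t = (if even k then s else t)"

lemma alt_letter_0 [simp]: "alt_letter 0 s t = s" and alt_letter_Suc [simp]: "alt_letter (Suc k) s t = alt_letter k t s"
  by (simp_all add: alt_letter_def)

lemma length_alternating [simp]: "length (alternating k s t) = k"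
  by (induction k s t rule: alternating.induct) auto

lemma set_alternating: "set (alternating k s t) \<subseteq> {s, t}"
  by (induction k s t rule: alternating.induct) auto

lemma alternating_snoc: "alternating (Suc k) s t = alternating k s t @ [alt_letter k s t]"
  by (induction k s t rule: alternating.induct) auto

lemma alternating_append: "\<exists>r. alternating (k + j) s t = alternating k s t @ r \<and> length r = j \<and> set r \<subseteq> {s, t}"
  by (induction k s t rule: alternating.induct) (use set_alternating length_alternating in fastforce)+

lemma take_alternating: "j \<le> k \<Longrightarrow> take j (alternating k s t) = alternating j s t"
  by (metis alternating_append append_eq_conv_conj le_add_diff_inverse length_alternating)

lemma nth_alternating: "j < k \<Longrightarrow> alternating k s t ! j = alt_letter j s t"
  using take_alternating[of "Suc j" k s t]
  by (metis Suc_leI alternating_snoc length_alternating nth_append_length nth_take lessI)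

definition simple_root :: "'a \<Rightarrow> 'a \<Rightarrow> real" where "simple_root s u = of_bool (u = s)"
definition nonneg :: "('a \<Rightarrow> real) \<Rightarrow> bool" where "nonneg v \<longleftrightarrow> (\<forall>u. v u \<ge> 0)"

lemma simple_root_inj [simp]: "simple_root s = simple_root t \<longleftrightarrow> s = t"
  unfolding simple_root_def fun_eq_iff by auto

lemma simple_root_simps [simp]: "simple_root s s = 1" "u \<noteq> s \<Longrightarrow> simple_root s u = 0"
  by (auto simp: simple_root_def)

lemma nonneg_simple_root [simp]: "nonneg (simple_root s)"
  by (simp add: nonneg_def simple_root_def)

locale coxeter_matrix =
  fixes S :: "'a set" and m :: "'a \<Rightarrow> 'a \<Rightarrow> nat"
  assumes fin: "finite S"
    and m_sym: "\<And>s t. m s t = m t s"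
    and m_cases: "\<And>s t. s \<noteq> t \<Longrightarrow> m s t = 0 \<or> 2 \<le> m s t"
begin

text \<open>Twice the Tits form; the value \<open>m s t = 0\<close> stands for the label infinity.\<close>

definition c :: "'a \<Rightarrow> 'a \<Rightarrow> real" where
  "c s t = (if s = t then 2 else if m s t = 0 then - 2 else - 2 * cos (pi / m s t))"

definition pair :: "'a \<Rightarrow> ('a \<Rightarrow> real) \<Rightarrow> real" where
  "pair s v = (\<Sum>u\<in>S. c s u * v u)"

definition refl :: "'a \<Rightarrow> ('a \<Rightarrow> real) \<Rightarrow> 'a \<Rightarrow> real" where
  "refl s v = (\<lambda>u. v u - pair s v * simple_root s u)"

definition rho :: "'a list \<Rightarrow> ('a \<Rightarrow> real) \<Rightarrow> 'a \<Rightarrow> real" where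
  "rho = foldr refl"

definition form :: "('a \<Rightarrow> real) \<Rightarrow> ('a \<Rightarrow> real) \<Rightarrow> real" where
  "form v w = (\<Sum>s\<in>S. v s * pair s w)"

lemma c_sym: "c s t = c t s" by (simp add: c_def m_sym)
lemma c_self [simp]: "c s s = 2" by (simp add: c_def)

lemma pair_lin: "pair s (\<lambda>u. a * v u + b * w u) = a * pair s v + b * pair s w"
  by (simp add: pair_def algebra_simps sum.distrib sum_distrib_left)

lemma pair_diff: "pair s (\<lambda>u. v u - b * w u) = pair s v - b * pair s w"
  using pair_lin[of s 1 v "- b" w] by simp

lemma pair_simple_root [simp]: "t \<in> S \<Longrightarrow> pair s (simple_root t) = c s t"
  using fin by (simp add: pair_def simple_root_def of_bool_def if_distrib cong: if_cong)

lemma refl_lin: "refl s (\<lambda>u. a * v u + b * w u) = (\<lambda>u. a * refl s v u + b * refl s w u)"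
  by (simp add: refl_def pair_lin algebra_simps)

lemma refl_simple_root: "t \<in> S \<Longrightarrow> refl s (simple_root t) = (\<lambda>u. simple_root t u - c s t * simple_root s u)"
  by (simp add: refl_def)

lemma refl_simple_root_self [simp]: "s \<in> S \<Longrightarrow> refl s (simple_root s) = (\<lambda>u. - simple_root s u)"
  by (simp add: refl_simple_root)

lemma pair_refl: "t \<in> S \<Longrightarrow> pair s (refl t v) = pair s v - pair t v * c s t"
  by (simp add: refl_def pair_diff)

lemma refl_refl [simp]: "s \<in> S \<Longrightarrow> refl s (refl s v) = v"
  using pair_refl[of s s v] by (auto simp: refl_def)

lemma rho_Nil [simp]: "rho [] = id" by (auto simp: rho_def)
lemma rho_Cons [simp]: "rho (s # l) = refl s \<circ> rho l" by (auto simp: rho_def)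
lemma rho_append [simp]: "rho (l @ l') = rho l \<circ> rho l'" by (auto simp: rho_def)

lemma rho_lin: "rho l (\<lambda>u. a * v u + b * w u) = (\<lambda>u. a * rho l v u + b * rho l w u)"
  by (induction l) (simp_all add: refl_lin)

lemma rho_neg: "rho l (\<lambda>u. - v u) = (\<lambda>u. - rho l v u)"
  using rho_lin[of l "- 1" v 0 v] by simp

lemma rho_zero: "rho l (\<lambda>u. 0) = (\<lambda>u. 0)"
  using rho_lin[of l 0 "\<lambda>u. 0" 0 "\<lambda>u. 0"] by simp

lemma rho_rev [simp]: "set l \<subseteq> S \<Longrightarrow> rho l (rho (rev l) v) = v"
  by (induction l arbitrary: v) simp_all

lemma rho_rev' [simp]: "set l \<subseteq> S \<Longrightarrow> rho (rev l) (rho l v) = v"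
  using rho_rev[of "rev l" v] by simp

lemma inv_rho: "set l \<subseteq> S \<Longrightarrow> inv_into UNIV (rho l) = rho (rev l)"
  by (rule inv_equality) simp_all

lemma form_sym: "form v w = form w v"
proof -
  have "form v w = (\<Sum>s\<in>S. \<Sum>u\<in>S. c s u * v s * w u)"
    by (simp add: form_def pair_def sum_distrib_left algebra_simps)
  also have "\<dots> = (\<Sum>u\<in>S. \<Sum>s\<in>S. c s u * v s * w u)" by (rule sum.swap)
  also have "\<dots> = form w v"
    by (simp add: form_def pair_def sum_distrib_left algebra_simps c_sym)
  finally show ?thesis .
qed

lemma form_lin: "form v (\<lambda>u. a * w u + b * w' u) = a * form v w + b * form v w'"
  by (simp add: form_def pair_lin algebra_simps sum.distrib sum_distrib_left)

lemma form_diff: "form v (\<lambda>u. w u - b * w' u) = form v w - b * form v w'"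
  using form_lin[of v 1 w "- b" w'] by simp

lemma form_simple_root: "s \<in> S \<Longrightarrow> form (simple_root s) w = pair s w"
  using fin by (simp add: form_def simple_root_def of_bool_def if_distrib if_distribR cong: if_cong)

lemma form_refl: "s \<in> S \<Longrightarrow> form (refl s v) (refl s w) = form v w"
proof -
  assume s: "s \<in> S"
  have 1: "form x (refl s y) = form x y - pair s y * pair s x" for x y
    unfolding refl_def form_diff using form_simple_root[OF s] form_sym by metis
  have "form (refl s v) (refl s w) = form w (refl s v) - pair s w * pair s (refl s v)"
    using 1[of "refl s v" w] form_sym by metis
  also have "pair s (refl s v) = - pair s v" using s by (simp add: pair_refl)
  finally show ?thesis using 1[of w v] form_sym[of v w] by simp
qed

lemma form_rho: "set l \<subseteq> S \<Longrightarrow> form (rho l v) (rho l w) = form v w"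
  by (induction l) (simp_all add: form_refl)

lemma pair_rho:
  assumes "set l \<subseteq> S" "s \<in> S" "x \<in> S" "rho l (simple_root s) = simple_root x"
  shows "pair x (rho l v) = pair s v"
  using form_rho[OF assms(1), of "simple_root s" v] assms by (simp add: form_simple_root)

text \<open>An isometry conjugates the reflection in a root to the reflection in the image of that
  root.\<close>

lemma rho_conj:
  assumes "set l \<subseteq> S" "s \<in> S" "x \<in> S" "rho l (simple_root s) = simple_root x"
  shows "rho l \<circ> refl s = refl x \<circ> rho l"
proof
  fix v
  have "rho l (refl s v) = (\<lambda>u. rho l v u - pair s v * rho l (simple_root s) u)"
    using rho_lin[of l 1 v "- pair s v" "simple_root s"] by (simp add: refl_def)
  also have "\<dots> = refl x (rho l v)"
    using pair_rho[OF assms] assms(4) by (simp add: refl_def)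
  finally show "(rho l \<circ> refl s) v = (refl x \<circ> rho l) v" by simp
qed

text \<open>The cosine is injective on the angles in question, and no finite label gives the value
  -2, so the form determines the label.\<close>

lemma c_inj:
  assumes "s \<noteq> t" "x \<noteq> y" "c s t = c x y"
  shows "m s t = m x y"
proof -
  have lt: "cos (pi / real n) < 1" "pi / real n \<le> pi" "0 \<le> pi / real n" if "n \<ge> 2" for n
  proof -
    have "0 < pi / real n" "pi / real n \<le> pi" using that by (auto simp: field_simps)
    then show "cos (pi / real n) < 1" "pi / real n \<le> pi" "0 \<le> pi / real n"
      using cos_monotone_0_pi[of 0 "pi / real n"] by auto
  qed
  show ?thesis
  proof (cases "m s t = 0 \<or> m x y = 0")
    case True
    then show ?thesis using assms lt(1)[of "m s t"] lt(1)[of "m x y"] m_cases[of s t] m_cases[of x y]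
      by (auto simp: c_def split: if_splits)
  next
    case False
    then have "cos (pi / m s t) = cos (pi / m x y)"
      using assms(3) unfolding c_def if_not_P[OF assms(1)] if_not_P[OF assms(2)] by simp
    then have "pi / m s t = pi / m x y"
      using lt(2,3)[of "m s t"] lt(2,3)[of "m x y"] False m_cases[OF assms(1)] m_cases[OF assms(2)]
      by (metis cos_inj_pi)
    then show ?thesis using False by (simp add: field_simps)
  qed
qed

section \<open>Dihedral subsystems\<close>

abbreviation U :: "'a \<Rightarrow> 'a \<Rightarrow> nat \<Rightarrow> real" where "U s t \<equiv> chebyshev (- c s t)"

lemma U_sym: "U s t = U t s" by (simp add: c_sym)

lemma U_sin:
  assumes "s \<noteq> t" "m s t \<noteq> 0"
  shows "U s t n * sin (pi / m s t) = sin (real n * (pi / m s t))" and "sin (pi / m s t) > 0"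
proof -
  show "U s t n * sin (pi / m s t) = sin (real n * (pi / m s t))"
    using assms chebyshev_cos[of "pi / m s t" n] by (simp add: c_def)
  have "real (m s t) \<ge> 2" using m_cases assms by force
  then show "sin (pi / m s t) > 0" by (intro sin_gt_zero) (simp_all add: field_simps)
qed

lemma U_nonneg:
  assumes "s \<noteq> t" "m s t = 0 \<or> n \<le> m s t"
  shows "U s t n \<ge> 0"
proof (cases "m s t = 0")
  case True
  then show ?thesis using assms by (simp add: c_def chebyshev_2)
next
  case False
  then have "real n * (pi / m s t) \<le> pi" using assms(2) by (simp add: field_simps)
  then have "sin (real n * (pi / m s t)) \<ge> 0" by (intro sin_ge_zero) auto
  then show ?thesis using U_sin[OF assms(1) False] by (metis mult_less_0_iff not_le)
qed

lemma U_reflect: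
  assumes "s \<noteq> t" "m s t \<noteq> 0" "n \<le> m s t"
  shows "U s t (m s t - n) = U s t n"
proof -
  have "real (m s t - n) * (pi / m s t) = pi - real n * (pi / m s t)"
    using assms by (simp add: of_nat_diff field_simps)
  then have "U s t (m s t - n) * sin (pi / m s t) = U s t n * sin (pi / m s t)"
    using U_sin(1)[OF assms(1,2)] by simp
  then show ?thesis using U_sin(2)[OF assms(1,2)] by simp
qed

lemma U_m:
  assumes "s \<noteq> t" "m s t \<noteq> 0"
  shows "U s t (m s t) = 0" "U s t (m s t - 1) = 1" "U s t (Suc (m s t)) = - 1"
proof -
  have m: "m s t \<ge> 2" using m_cases[OF assms(1)] assms(2) by simp
  show 1: "U s t (m s t) = 0" using U_reflect[OF assms, of 0] by simp
  show 2: "U s t (m s t - 1) = 1" using U_reflect[OF assms, of 1] m by simp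
  have "U s t (Suc (Suc (m s t - 1))) = - c s t * U s t (Suc (m s t - 1)) - U s t (m s t - 1)"
    by simp
  then show "U s t (Suc (m s t)) = - 1" using 1 2 m by (simp del: chebyshev.simps)
qed

text \<open>Each further reflection performs one step of the recursion of \<open>chebyshev\<close>
  on the two coefficients.\<close>

lemma alternating_root:
  assumes "s \<in> S" "t \<in> S"
  shows "rho (alternating k s t) (simple_root (alt_letter k s t)) = (\<lambda>u. U s t (Suc k) * simple_root s u + U s t k * simple_root t u)"
  using assms
proof (induction k arbitrary: s t)
  case (Suc k)
  have "rho (alternating (Suc k) s t) (simple_root (alt_letter (Suc k) s t)) =
      refl s (\<lambda>u. U s t (Suc k) * simple_root t u + U s t k * simple_root s u)"
    using Suc.IH[OF Suc.prems(2,1)] by (simp add: c_sym del: chebyshev.simps)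
  also have "\<dots> = (\<lambda>u. U s t (Suc (Suc k)) * simple_root s u + U s t (Suc k) * simple_root t u)"
    unfolding refl_lin using Suc.prems by (simp add: refl_simple_root algebra_simps)
  finally show ?case .
qed simp

text \<open>Both words act alike on the two simple roots and fix every vector orthogonal to both.
  For a finite label the form is nondegenerate on the plane of the two roots, so every vector splits
  accordingly.\<close>

lemma braid_rho:
  assumes st: "s \<in> S" "t \<in> S" "s \<noteq> t" and m0: "m s t \<noteq> 0"
  shows "rho (alternating (m s t) s t) = rho (alternating (m s t) t s)"
proof -
  define k where "k = m s t"
  obtain k' where k': "k = Suc k'" using m0 by (cases k) (auto simp: k_def)
  note Um = U_m[OF st(3) m0, folded k_def]
  \<comment> \<open>One word gives minus a simple root by the values of \<open>U\<close> at
    \<open>m s t\<close> and its successor. The other word ends in the letter of the root, which is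
    negated first; the remaining shorter word is then evaluated by
    \<open>alternating_root\<close>.\<close>
  have root: "rho (alternating k x y) (simple_root (alt_letter k x y)) = rho (alternating k y x) (simple_root (alt_letter k x y))"
    if "x \<in> S" "y \<in> S" "U x y = U s t" for x y
  proof -
    have "rho (alternating k x y) (simple_root (alt_letter k x y)) = (\<lambda>u. - simple_root x u)"
      using alternating_root[OF that(1,2), of k] Um by (simp add: that(3) del: chebyshev.simps)
    moreover have "rho (alternating k y x) (simple_root (alt_letter k x y)) = (\<lambda>u. - simple_root x u)"
    proof -
      have "rho (alternating k y x) (simple_root (alt_letter k x y)) = rho (alternating k' y x) (\<lambda>u. - simple_root (alt_letter k' y x) u)"
        unfolding k' alternating_snoc using that by (simp add: alt_letter_def)
      also have "\<dots> = (\<lambda>u. - simple_root x u)"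
        unfolding rho_neg using alternating_root[OF that(2,1), of k'] Um k' that(3) U_sym[of x y]
        by (simp del: chebyshev.simps)
      finally show ?thesis .
    qed
    ultimately show ?thesis by simp
  qed
  have both: "rho (alternating k s t) (simple_root x) = rho (alternating k t s) (simple_root x)" if "x = s \<or> x = t" for x
    using root[OF st(1,2) HOL.refl] root[OF st(2,1) U_sym] that by (auto simp: alt_letter_def split: if_splits)
  have perp: "rho (alternating n x y) v = v" if "pair s v = 0" "pair t v = 0" "{x, y} = {s, t}" for n x y v
  proof -
    have "rho l v = v" if "set l \<subseteq> {s, t}" for l
      using that \<open>pair s v = 0\<close> \<open>pair t v = 0\<close> by (induction l) (auto simp: refl_def)
    then show ?thesis using set_alternating[of n x y] that(3) by auto
  qed
  show ?thesis
  proof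
    fix v
    define d where "d = 4 - (c s t)\<^sup>2"
    have "c s t = - 2 * cos (pi / k)" using st(3) m0 by (simp add: c_def k_def)
    then have "d = 4 * (sin (pi / k))\<^sup>2"
      by (simp add: d_def power_mult_distrib sin_squared_eq)
    then have d: "d \<noteq> 0" using U_sin(2)[OF st(3) m0] by (simp add: k_def)
    \<comment> \<open>Cramer's rule for the projection to the plane of the two roots;
      \<open>d\<close> is the Gram determinant.\<close>
    define a where "a = (2 * pair s v - c s t * pair t v) / d"
    define b where "b = (2 * pair t v - c s t * pair s v) / d"
    define v0 where "v0 = (\<lambda>u. 1 * v u + (-1) * (a * simple_root s u + b * simple_root t u))"
    have "pair s v0 = pair s v - (2 * a + c s t * b)" "pair t v0 = pair t v - (c s t * a + 2 * b)"
      unfolding v0_def pair_lin using st by (simp_all add: c_sym algebra_simps)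
    moreover have "d * (2 * a + c s t * b) = d * pair s v" "d * (c s t * a + 2 * b) = d * pair t v"
    proof -
      have da: "d * a = 2 * pair s v - c s t * pair t v" "d * b = 2 * pair t v - c s t * pair s v"
        using d by (simp_all add: a_def b_def)
      have "d * (2 * a + c s t * b) = 2 * (d * a) + c s t * (d * b)"
        "d * (c s t * a + 2 * b) = c s t * (d * a) + 2 * (d * b)"
        by (simp_all add: algebra_simps)
      then show "d * (2 * a + c s t * b) = d * pair s v" "d * (c s t * a + 2 * b) = d * pair t v"
        unfolding da by (simp_all add: d_def power2_eq_square algebra_simps)
    qed
    ultimately have v0: "pair s v0 = 0" "pair t v0 = 0" using d by simp_all
    have "v = (\<lambda>u. 1 * v0 u + 1 * (a * simple_root s u + b * simple_root t u))"
      by (simp add: v0_def)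
    then have "rho l v = (\<lambda>u. rho l v0 u + (a * rho l (simple_root s) u + b * rho l (simple_root t) u))" for l
      using rho_lin[of l 1 v0 1 "\<lambda>u. a * simple_root s u + b * simple_root t u"]
        rho_lin[of l a "simple_root s" b "simple_root t"] by simp
    then show "rho (alternating (m s t) s t) v = rho (alternating (m s t) t s) v"
      using both perp[OF v0] by (simp add: k_def insert_commute)
  qed
qed

text \<open>A word in two letters alternates unless two equal letters are adjacent, and these
  cancel.\<close>

lemma alt_or_shorter:
  assumes "s \<in> S" "t \<in> S" "set u \<subseteq> {s, t}"
  shows "(\<exists>u'. set u' \<subseteq> {s, t} \<and> rho u' = rho u \<and> length u' < length u) \<or>
    u = alternating (length u) s t \<or> u = alternating (length u) t s"
  using assms(3)
proof (induction u)
  case (Cons a u)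
  then consider u' where "set u' \<subseteq> {s, t}" "rho u' = rho u" "length u' < length u"
    | x y where "{x, y} = {s, t}" "u = alternating (length u) x y"
    by force
  then show ?case
  proof cases
    case 1
    then have "set (a # u') \<subseteq> {s, t} \<and> rho (a # u') = rho (a # u) \<and> length (a # u') < length (a # u)"
      using Cons.prems by simp
    then show ?thesis by blast
  next
    case 2
    have a: "a \<in> {x, y}" using 2 Cons.prems by auto
    show ?thesis
    proof (cases "length u")
      case 0
      then show ?thesis using Cons.prems by auto
    next
      case (Suc n)
      then have u: "u = x # alternating n y x" using 2 by simp
      show ?thesis
      proof (cases "a = x")
        case True
        have "x \<in> S" using 2 assms by (auto simp: doubleton_eq_iff)
        then have "rho (alternating n y x) = rho (a # u)" using True by (auto simp: u)
        moreover have "set (alternating n y x) \<subseteq> {s, t}" using set_alternating[of n y x] 2 by auto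
        moreover have "length (alternating n y x) < length (a # u)" using Suc by simp
        ultimately show ?thesis by blast
      next
        case False
        then have "a # u = alternating (length (a # u)) y x" using a u by simp
        then show ?thesis using 2(1) by (auto simp: doubleton_eq_iff)
      qed
    qed
  qed
qed simp

text \<open>Behind the first letter, the braid relation turns the next \<open>m s t\<close> letters
  into a word beginning with \<open>s\<close>, and the two letters \<open>s\<close> cancel.\<close>

lemma braid_shorten:
  assumes st: "s \<in> S" "t \<in> S" "s \<noteq> t" and m: "m s t \<noteq> 0" "m s t \<le> k"
  shows "\<exists>u. set u \<subseteq> {s, t} \<and> rho u = rho (alternating (Suc k) s t) \<and> length u < k"
proof -
  obtain r where r: "alternating (Suc k) s t = alternating (Suc (m s t)) s t @ r" "length r = k - m s t" "set r \<subseteq> {s, t}"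
    using alternating_append[of "Suc (m s t)" "k - m s t" s t] m(2) by auto
  obtain m' where m': "m s t = Suc m'" using m(1) by (cases "m s t") auto
  have m_pos: "m t s \<noteq> 0" using m(1) m_sym by metis
  have "rho (alternating (m s t) t s) = rho (alternating (m s t) s t)" using braid_rho[OF st m(1)] by simp
  then have "rho (alternating (Suc (m s t)) s t) = refl s \<circ> rho (alternating (m s t) s t)" by simp
  also have "\<dots> = rho (alternating m' t s)" using st by (auto simp: m')
  finally have eq: "rho (alternating (Suc (m s t)) s t) = rho (alternating m' t s)" .
  have "rho (alternating m' t s @ r) = rho (alternating (Suc k) s t)" unfolding r(1) rho_append eq ..
  moreover have "length (alternating m' t s @ r) < k" using r(2) m' m(2) by simp
  moreover have "set (alternating m' t s @ r) \<subseteq> {s, t}" using r(3) set_alternating[of m' t s] by auto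
  ultimately show ?thesis by blast
qed

text \<open>The word \<open>u\<close> alternates by \<open>min\<close>, and by \<open>min'\<close>
  it does not end in \<open>s\<close>. So \<open>u @ [s]\<close> alternates too, and by
  \<open>braid_shorten\<close> its length is at most a finite label, the range where
  \<open>U_nonneg\<close> applies.\<close>

lemma dihedral_root:
  assumes st: "s \<in> S" "t \<in> S" "s \<noteq> t" and u: "set u \<subseteq> {s, t}"
    and min: "\<And>u'. set u' \<subseteq> {s, t} \<Longrightarrow> rho u' = rho u \<Longrightarrow> length u \<le> length u'"
    and min': "\<And>u'. set u' \<subseteq> {s, t} \<Longrightarrow> rho u' = rho (u @ [s]) \<Longrightarrow> length u \<le> length u'"
  shows "\<exists>p q. 0 \<le> p \<and> 0 \<le> q \<and> rho u (simple_root s) = (\<lambda>y. p * simple_root s y + q * simple_root t y)"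
proof -
  define k where "k = length u"
  have "u = alternating k s t \<or> u = alternating k t s"
    using alt_or_shorter[OF st(1,2) u] min unfolding k_def by (meson leD)
  then obtain x y where xy: "{x, y} = {s, t}" "u = alternating k x y" by blast
  have xyS: "x \<in> S" "y \<in> S" "x \<noteq> y" using xy st by (auto simp: doubleton_eq_iff)
  have "alt_letter k x y \<in> {s, t}" unfolding xy(1)[symmetric] by (simp add: alt_letter_def)
  then consider "k = 0" | "k > 0" "alt_letter k x y = t" | "alt_letter k x y = s" by blast
  then show ?thesis
  proof cases
    case 1
    then show ?thesis using xy by (intro exI[of _ 1] exI[of _ 0]) simp
  next
    case 2
    then obtain k' where k': "k = Suc k'" by (cases k) auto
    have "alt_letter k' x y = s" using 2(2) xy(1) st by (auto simp: k' alt_letter_def doubleton_eq_iff split: if_splits)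
    then have "u = alternating k' x y @ [s]" using xy k' alternating_snoc by metis
    then have "rho (alternating k' x y) = rho (u @ [s])" using st by auto
    moreover have "set (alternating k' x y) \<subseteq> {s, t}" using set_alternating[of k' x y] xy(1) by auto
    ultimately have "length u \<le> k'" using min'[of "alternating k' x y"] by simp
    then show ?thesis using k' by (simp add: k_def)
  next
    case 3
    have le: "m x y = 0 \<or> Suc k \<le> m x y"
    proof (rule ccontr)
      assume "\<not> ?thesis"
      then have mk: "m x y \<noteq> 0" "m x y \<le> k" by auto
      obtain u' where "set u' \<subseteq> {x, y}" "rho u' = rho (alternating (Suc k) x y)" "length u' < k"
        using braid_shorten[OF xyS mk] by blast
      moreover have "alternating (Suc k) x y = u @ [s]" using alternating_snoc xy(2) 3 by metis
      ultimately show False using min'[of u'] xy(1) by (metis k_def leD)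
    qed
    have "rho u (simple_root s) = (\<lambda>v. U x y (Suc k) * simple_root x v + U x y k * simple_root y v)"
      using alternating_root[OF xyS(1,2), of k] 3 xy(2) by simp
    moreover have "U x y (Suc k) \<ge> 0" "U x y k \<ge> 0"
      using le by (intro U_nonneg[OF xyS(3)]; linarith)+
    moreover have "x = s \<and> y = t \<or> x = t \<and> y = s" using xy(1) by (auto simp: doubleton_eq_iff)
    ultimately show ?thesis
    proof (elim disjE conjE)
      assume "rho u (simple_root s) = (\<lambda>v. U x y (Suc k) * simple_root x v + U x y k * simple_root y v)"
        "0 \<le> U x y (Suc k)" "0 \<le> U x y k" "x = t" "y = s"
      then show ?thesis
        by (intro exI[of _ "U x y k"] exI[of _ "U x y (Suc k)"]) (simp add: add.commute)
    qed blast
  qed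
qed

section \<open>Length and signs of roots\<close>

text \<open>The Coxeter group is realised as its image in the geometric representation.\<close>

definition W :: "(('a \<Rightarrow> real) \<Rightarrow> 'a \<Rightarrow> real) set" where "W = rho ` {l. set l \<subseteq> S}"

definition len :: "(('a \<Rightarrow> real) \<Rightarrow> 'a \<Rightarrow> real) \<Rightarrow> nat" where
  "len w = (LEAST n. \<exists>l. set l \<subseteq> S \<and> length l = n \<and> rho l = w)"

lemma len_rho_le: "set l \<subseteq> S \<Longrightarrow> len (rho l) \<le> length l"
  unfolding len_def by (rule Least_le) blast

lemma len_ex:
  assumes "w \<in> W"
  obtains l where "set l \<subseteq> S" "length l = len w" "rho l = w"
proof -
  have "\<exists>n l. set l \<subseteq> S \<and> length l = n \<and> rho l = w" using assms by (auto simp: W_def)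
  then have "\<exists>l. set l \<subseteq> S \<and> length l = len w \<and> rho l = w" unfolding len_def by (rule LeastI_ex)
  then show thesis using that by blast
qed

lemma rho_W [simp]: "set l \<subseteq> S \<Longrightarrow> rho l \<in> W" by (auto simp: W_def)

lemma W_comp: "v \<in> W \<Longrightarrow> w \<in> W \<Longrightarrow> v \<circ> w \<in> W"
proof -
  assume "v \<in> W" "w \<in> W"
  then obtain l l' where "set l \<subseteq> S" "set l' \<subseteq> S" "v = rho l" "w = rho l'" by (auto simp: W_def)
  then have "v \<circ> w = rho (l @ l')" "set (l @ l') \<subseteq> S" by auto
  then show ?thesis using rho_W by metis
qed

lemma refl_W [simp]: "s \<in> S \<Longrightarrow> refl s \<in> W"
  using rho_W[of "[s]"] by simp

lemma len_comp_rho: "v \<in> W \<Longrightarrow> set u \<subseteq> S \<Longrightarrow> len (v \<circ> rho u) \<le> len v + length u"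
proof -
  assume "v \<in> W" and u: "set u \<subseteq> S"
  then obtain l where "set l \<subseteq> S" "length l = len v" "rho l = v" by (elim len_ex)
  then show ?thesis using len_rho_le[of "l @ u"] u by simp
qed

text \<open>
  If \<open>l\<close> is a reduced word for \<open>w\<close> ending in \<open>t\<close>, one splits off from \<open>w\<close> a right factor in the dihedral
  group of \<open>s\<close> and \<open>t\<close> that is as long as possible; the remaining factor \<open>v\<close> is shortest in its coset.
\<close>

theorem nonneg_if_len_le:
  assumes "w \<in> W" "s \<in> S" "len w \<le> len (w \<circ> refl s)"
  shows "nonneg (w (simple_root s))"
  using assms
proof (induction "len w" arbitrary: w s rule: less_induct)
  case less
  note w = less.prems(1) and s = less.prems(2)
  obtain l where l: "set l \<subseteq> S" "length l = len w" "rho l = w" using w by (rule len_ex)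
  show ?case
  proof (cases l rule: rev_cases)
    case Nil
    then show ?thesis using l by auto
  next
    case (snoc l0 t)
    have t: "t \<in> S" and l0: "set l0 \<subseteq> S" using l snoc by auto
    have w_eq: "w = rho l0 \<circ> refl t" using l snoc by auto
    have st: "s \<noteq> t"
    proof
      assume "s = t"
      then have "w \<circ> refl s = rho l0" using t by (auto simp: w_eq)
      then show False using less.prems(3) len_rho_le[OF l0] l(2) snoc by simp
    qed
    have J: "{s, t} \<subseteq> S" using s t by simp
    define Q where "Q k \<longleftrightarrow> (\<exists>v u. v \<in> W \<and> set u \<subseteq> {s, t} \<and> length u = k \<and> v \<circ> rho u = w \<and>
      len v + k = len w)" for k
    \<comment> \<open>Splitting off the last letter \<open>t\<close> shows that the maximal
      \<open>k\<close> is positive, so that \<open>v\<close> is shorter than \<open>w\<close> and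
      the induction hypothesis applies to it.\<close>
    have Q1: "Q 1"
    proof -
      have "len (rho l0) + 1 = len w"
        using len_rho_le[OF l0] l(2) snoc len_comp_rho[OF rho_W[OF l0], of "[t]"] t
        by (simp add: w_eq[symmetric])
      then show ?thesis unfolding Q_def using l0 w_eq
        by (intro exI[of _ "rho l0"] exI[of _ "[t]"]) auto
    qed
    have Q_le: "k \<le> len w" if "Q k" for k using that by (auto simp: Q_def)
    obtain k where k: "Q k" "\<And>k'. Q k' \<Longrightarrow> k' \<le> k"
      using GreatestI_nat[of Q, OF Q1 Q_le] Greatest_le_nat[of Q _ "len w"] Q_le by blast
    then obtain v u where v: "v \<in> W" and u: "set u \<subseteq> {s, t}" "length u = k" and vu: "v \<circ> rho u = w"
      and lv: "len v + k = len w" by (auto simp: Q_def)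
    have k1: "k \<ge> 1" using k(2)[OF Q1] .
    have vx: "nonneg (v (simple_root x))" if x: "x \<in> {s, t}" for x
    proof (rule less.hyps)
      show "len v < len w" "v \<in> W" "x \<in> S" using lv k1 v x J by auto
      show "len v \<le> len (v \<circ> refl x)"
      proof (rule ccontr)
        \<comment> \<open>Moving \<open>x\<close> from \<open>v\<close> into the dihedral factor
          would lengthen that factor, against the maximality of \<open>k\<close>.\<close>
        assume less: "\<not> ?thesis"
        have xS: "x \<in> S" using x J by blast
        have eq: "(v \<circ> refl x) \<circ> rho (x # u) = w" using vu xS by auto
        have vxW: "v \<circ> refl x \<in> W" using v xS by (simp add: W_comp)
        have "len w \<le> len (v \<circ> refl x) + (k + 1)"
          using len_comp_rho[OF vxW, of "x # u"] eq u J xS by auto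
        then have "len (v \<circ> refl x) + (k + 1) = len w" using less lv by simp
        moreover have "set (x # u) \<subseteq> {s, t}" "length (x # u) = k + 1" using u x by auto
        ultimately have "Q (k + 1)" unfolding Q_def using vxW eq by blast
        then show False using k(2)[of "k + 1"] by simp
      qed
    qed
    have min: "length u \<le> length u'" if "set u' \<subseteq> {s, t}" "rho u' = rho u" for u'
      using len_comp_rho[OF v subset_trans[OF that(1) J]] that(2) vu lv u(2) by simp
    have min': "length u \<le> length u'" if "set u' \<subseteq> {s, t}" "rho u' = rho (u @ [s])" for u'
    proof -
      have "w \<circ> refl s = v \<circ> rho u'" by (simp add: that(2) o_assoc vu)
      then show ?thesis
        using len_comp_rho[OF v subset_trans[OF that(1) J]] less.prems(3) lv u(2) by simp
    qed
    obtain p q where pq: "0 \<le> p" "0 \<le> q" "rho u (simple_root s) = (\<lambda>y. p * simple_root s y + q * simple_root t y)"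
      using dihedral_root[OF s t st u(1) min min'] by blast
    obtain lv where lv: "v = rho lv" using v by (auto simp: W_def)
    have "w (simple_root s) = v (rho u (simple_root s))" using vu by auto
    also have "\<dots> = (\<lambda>y. p * v (simple_root s) y + q * v (simple_root t) y)"
      unfolding pq(3) lv rho_lin ..
    finally show ?thesis using pq(1,2) vx by (simp add: nonneg_def)
  qed
qed

text \<open>If \<open>refl s\<close> shortens \<open>w\<close>, then \<open>nonneg_if_len_le\<close>
  applies to \<open>w \<circ> refl s\<close>, which takes the simple root to the negative of its
  image under \<open>w\<close>.\<close>

lemma root_sign:
  assumes w: "w \<in> W" and s: "s \<in> S"
  shows "nonneg (w (simple_root s)) \<or> nonneg (\<lambda>u. - w (simple_root s) u)"
proof (cases "len w \<le> len (w \<circ> refl s)")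
  case False
  obtain l where l: "w = rho l" using w by (auto simp: W_def)
  have "(w \<circ> refl s) \<circ> refl s = w" using s by auto
  then have "nonneg ((w \<circ> refl s) (simple_root s))"
    using False nonneg_if_len_le[of "w \<circ> refl s" s] s w by (simp add: W_comp)
  then show ?thesis using s by (simp add: l rho_neg)
qed (use nonneg_if_len_le assms in blast)

section \<open>Minimal coset representatives\<close>

definition supp :: "'a set \<Rightarrow> ('a \<Rightarrow> real) set" where
  "supp X = {v. \<forall>u. u \<notin> X \<longrightarrow> v u = 0}"

text \<open>The minimal representatives of the cosets \<open>W\<^sub>X w\<close>.\<close>

definition D :: "'a set \<Rightarrow> (('a \<Rightarrow> real) \<Rightarrow> 'a \<Rightarrow> real) set" where
  "D X = {w \<in> W. \<forall>x\<in>X. nonneg (inv_into UNIV w (simple_root x))}"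

lemma simple_root_supp [simp]: "simple_root s \<in> supp X \<longleftrightarrow> s \<in> X"
  by (auto simp: supp_def simple_root_def)

lemma supp_neg: "(\<lambda>u. - v u) \<in> supp X \<longleftrightarrow> v \<in> supp X"
  by (simp add: supp_def)

lemma refl_supp: "x \<in> X \<Longrightarrow> refl x v \<in> supp X \<longleftrightarrow> v \<in> supp X"
  by (force simp: supp_def refl_def simple_root_def)

lemma rho_supp: "set l \<subseteq> X \<Longrightarrow> rho l v \<in> supp X \<longleftrightarrow> v \<in> supp X"
  by (induction l) (auto simp: refl_supp)

lemma rho_expand:
  assumes "finite X" "v \<in> supp X"
  shows "rho l v u = (\<Sum>x\<in>X. v x * rho l (simple_root x) u)"
  using assms
proof (induction X arbitrary: v)
  case empty
  then have "v = (\<lambda>u. 0)" by (auto simp: supp_def)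
  then show ?case by (simp add: rho_zero)
next
  case (insert x X)
  define v' where "v' = v(x := 0)"
  have "v = (\<lambda>u. 1 * v' u + v x * simple_root x u)" by (auto simp: v'_def simple_root_def)
  then have "rho l v u = rho l v' u + v x * rho l (simple_root x) u"
    using rho_lin[of l 1 v' "v x" "simple_root x"] by simp
  moreover have "v' \<in> supp X" using insert.prems by (auto simp: supp_def v'_def)
  moreover have "(\<Sum>y\<in>X. v' y * rho l (simple_root y) u) = (\<Sum>y\<in>X. v y * rho l (simple_root y) u)"
    using insert.hyps by (intro sum.cong) (auto simp: v'_def)
  ultimately show ?case using insert by simp
qed

lemma D_rho: "set l \<subseteq> S \<Longrightarrow> rho l \<in> D X \<longleftrightarrow> (\<forall>x\<in>X. nonneg (rho (rev l) (simple_root x)))"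
  by (simp add: D_def inv_rho)

lemma D_ex: "w \<in> D X \<Longrightarrow> \<exists>l. set l \<subseteq> S \<and> w = rho l"
  by (auto simp: D_def W_def)

lemma id_D: "id \<in> D X"
  using D_rho[of "[]" X] by simp

text \<open>Applying the inverse of \<open>w\<close> writes the simple root of \<open>s\<close> as a
  nonnegative combination of nonnegative vectors. Comparing coordinates, any vector that occurs is a
  multiple of this simple root, and invariance of the form makes the factor 1.\<close>

lemma D_root:
  assumes w: "w \<in> D X" and X: "X \<subseteq> S" and s: "s \<in> S" and supp: "w (simple_root s) \<in> supp X"
  shows "\<exists>x\<in>X. w (simple_root s) = simple_root x"
proof -
  obtain l where l: "set l \<subseteq> S" "w = rho l" using D_ex[OF w] by blast
  define v where "v = w (simple_root s)"
  have pos: "rho (rev l) (simple_root x) u \<ge> 0" if "x \<in> X" for x u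
    using w l D_rho[OF l(1), of X] that by (auto simp: nonneg_def)
  have vs: "v \<in> supp X" using supp by (simp add: v_def)
  have finX: "finite X" using X fin by (rule finite_subset)
  have "rho (rev l) v = simple_root s" using l by (simp add: v_def)
  then have ex: "simple_root s u = (\<Sum>x\<in>X. v x * rho (rev l) (simple_root x) u)" for u
    using rho_expand[OF finX vs, of "rev l" u] by simp
  have v0: "v x \<ge> 0" for x
  proof -
    have "\<not> nonneg (\<lambda>u. - v u)"
    proof
      assume "nonneg (\<lambda>u. - v u)"
      then have "(\<Sum>x\<in>X. v x * rho (rev l) (simple_root x) s) \<le> 0"
        using pos by (intro sum_nonpos) (simp add: nonneg_def mult_nonpos_nonneg)
      then show False using ex[of s] by simp
    qed
    then show ?thesis using root_sign[OF _ s, of w] l by (auto simp: v_def nonneg_def)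
  qed
  have "\<exists>x\<in>X. v x \<noteq> 0"
    using ex[of s] by (metis (no_types, lifting) mult_eq_0_iff simple_root_simps(1) sum.neutral zero_neq_one)
  then obtain x where x: "x \<in> X" "v x > 0" using v0 by (metis order_le_less)
  have zero: "rho (rev l) (simple_root x) u = 0" if "u \<noteq> s" for u
  proof -
    have "v x * rho (rev l) (simple_root x) u = 0"
      using ex[of u] that sum_nonneg_eq_0_iff[OF finX, of "\<lambda>x. v x * rho (rev l) (simple_root x) u"] pos v0 x(1)
      by simp
    then show ?thesis using x by simp
  qed
  define \<kappa> where "\<kappa> = rho (rev l) (simple_root x) s"
  have \<kappa>: "\<kappa> \<ge> 0" using pos x by (simp add: \<kappa>_def)
  have "rho (rev l) (simple_root x) = (\<lambda>u. \<kappa> * simple_root s u + 0 * simple_root s u)"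
    using zero by (auto simp: \<kappa>_def simple_root_def)
  then have "simple_root x = rho l (\<lambda>u. \<kappa> * simple_root s u + 0 * simple_root s u)"
    using l by (metis rho_rev)
  then have xv: "simple_root x = (\<lambda>u. \<kappa> * v u + 0 * v u)"
    unfolding rho_lin v_def l(2) .
  have xS: "x \<in> S" using x X by blast
  have "form (simple_root x) (simple_root x) = \<kappa> * (\<kappa> * form v v)"
    by (subst (2) xv, subst form_lin, subst form_sym, subst xv, subst form_lin) simp
  moreover have "form v v = 2" using form_rho[OF l(1), of "simple_root s" "simple_root s"] s l by (simp add: v_def form_simple_root)
  moreover have "form (simple_root x) (simple_root x) = 2" using xS by (simp add: form_simple_root)
  ultimately have "\<kappa>\<^sup>2 = 1" by (simp add: power2_eq_square)
  then have "\<kappa> = 1" using \<kappa> by (simp add: power2_eq_1_iff)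
  then have "w (simple_root s) = simple_root x" using xv by (simp add: v_def)
  then show ?thesis using x(1) by blast
qed

text \<open>\<open>refl s\<close> alters only the coordinate at \<open>s\<close>. If it made a
  nonnegative root negative, that root would be a multiple of the simple root of \<open>s\<close>,
  and \<open>w\<close> would take the latter into \<open>supp X\<close>.\<close>

lemma D_step:
  assumes w: "w \<in> D X" and X: "X \<subseteq> S" and s: "s \<in> S" and supp: "w (simple_root s) \<notin> supp X"
  shows "w \<circ> refl s \<in> D X"
proof -
  obtain l where l: "set l \<subseteq> S" "w = rho l" using D_ex[OF w] by blast
  have "nonneg (refl s (rho (rev l) (simple_root x)))" if x: "x \<in> X" for x
  proof (rule ccontr)
    define b where "b = rho (rev l) (simple_root x)"
    have b: "nonneg b" using w l D_rho[OF l(1), of X] x by (simp add: b_def)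
    assume "\<not> nonneg (refl s (rho (rev l) (simple_root x)))"
    then have "nonneg (\<lambda>u. - refl s b u)"
      using root_sign[OF rho_W[of "s # rev l"], of x] x X s l by (auto simp: b_def)
    moreover have "refl s b u = b u" if "u \<noteq> s" for u using that by (simp add: refl_def)
    ultimately have "b u = 0" if "u \<noteq> s" for u using b that unfolding nonneg_def
      by (metis neg_0_le_iff_le order_antisym)
    then have "b = (\<lambda>u. b s * simple_root s u + 0 * simple_root s u)" by (auto simp: simple_root_def)
    moreover have "rho l b = simple_root x" using l by (simp add: b_def)
    ultimately have e: "simple_root x = (\<lambda>u. b s * w (simple_root s) u)"
      using rho_lin[of l "b s" "simple_root s" 0 "simple_root s"] l by simp
    have "w (simple_root s) u = 0" if "u \<notin> X" for u
    proof -
      have "b s \<noteq> 0" using fun_cong[OF e, of x] by auto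
      moreover have "b s * w (simple_root s) u = 0" using fun_cong[OF e, of u] that x by (metis simple_root_simps(2))
      ultimately show ?thesis by simp
    qed
    then show False using supp by (simp add: supp_def)
  qed
  then show ?thesis using l s D_rho[of "l @ [s]" X] by simp
qed

end


section \<open>Retractions onto parabolic subgroups\<close>

definition pos :: "'a list \<Rightarrow> 'a word" where "pos = map (\<lambda>x. (x, True))"

lemma pos_simps [simp]: "pos [] = []" "pos (x # l) = (x, True) # pos l" "pos (l @ l') = pos l @ pos l'"
  "map fst (pos l) = l"
  by (simp_all add: pos_def o_def)

lemma pos_words [simp]: "pos l \<in> words S \<longleftrightarrow> set l \<subseteq> S"
  by (induction l) auto

lemma words_fst: "w \<in> words S \<Longrightarrow> set (map fst w) \<subseteq> S"
  by (auto simp: words_def)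

lemma words_mono: "w \<in> words X \<Longrightarrow> X \<subseteq> Y \<Longrightarrow> w \<in> words Y"
  by (auto simp: words_def)

lemma alternating_word_eq: "alternating_word n s t = pos (alternating n s t)"
  by (induction n s t rule: alternating.induct) auto

lemma set_alternating_subset: "s \<in> X \<Longrightarrow> t \<in> X \<Longrightarrow> set (alternating k s t) \<subseteq> X"
  using set_alternating[of k s t] by auto

section \<open>Words and parabolic subgroups of the Artin group\<close>

locale artin =
  fixes \<Gamma> :: "'a pair_pre_digraph" and \<mu> :: "'a set \<Rightarrow> nat"
  assumes graph: "pair_graph \<Gamma>"
    and label: "\<And>s t. (s, t) \<in> parcs \<Gamma> \<Longrightarrow> 2 \<le> \<mu> {s, t}"
begin

lemma arcs: "(s, t) \<in> parcs \<Gamma> \<Longrightarrow> s \<in> pverts \<Gamma>" "(s, t) \<in> parcs \<Gamma> \<Longrightarrow> t \<in> pverts \<Gamma>"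
  "(s, t) \<in> parcs \<Gamma> \<Longrightarrow> (t, s) \<in> parcs \<Gamma>" "(s, t) \<in> parcs \<Gamma> \<Longrightarrow> s \<noteq> t"
  and finite_verts: "finite (pverts \<Gamma>)"
proof -
  interpret pair_graph \<Gamma> by (rule graph)
  show "(s, t) \<in> parcs \<Gamma> \<Longrightarrow> s \<in> pverts \<Gamma>" "(s, t) \<in> parcs \<Gamma> \<Longrightarrow> t \<in> pverts \<Gamma>"
    using in_arcsD1 in_arcsD2 by auto
  show "(s, t) \<in> parcs \<Gamma> \<Longrightarrow> (t, s) \<in> parcs \<Gamma>"
    using pair_sym_arcs by (auto simp: symmetric_def sym_def)
  show "(s, t) \<in> parcs \<Gamma> \<Longrightarrow> s \<noteq> t" using pair_no_loops by force
  show "finite (pverts \<Gamma>)" by (rule pair_finite_verts)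
qed

definition m :: "'a \<Rightarrow> 'a \<Rightarrow> nat" where
  "m s t = (if (s, t) \<in> parcs \<Gamma> then \<mu> {s, t} else 0)"

sublocale coxeter_matrix "pverts \<Gamma>" m
proof
  show "finite (pverts \<Gamma>)" by (rule finite_verts)
  show "m s t = m t s" for s t using arcs(3) by (auto simp: m_def insert_commute)
  show "m s t = 0 \<or> 2 \<le> m s t" if "s \<noteq> t" for s t using label by (simp add: m_def)
qed

abbreviation S :: "'a set" where "S \<equiv> pverts \<Gamma>"
abbreviation rel :: "('a word \<times> 'a word) set" where "rel \<equiv> pres_rel S (artin_relations \<Gamma> \<mu>)"
abbreviation G :: "'a word set monoid" where "G \<equiv> artin_group \<Gamma> \<mu>"

definition cls :: "'a word \<Rightarrow> 'a word set" where "cls w = rel `` {w}"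
definition winv :: "'a word \<Rightarrow> 'a word" where "winv w = rev (map (\<lambda>(s, b). (s, \<not> b)) w)"
definition parabolic :: "'a set \<Rightarrow> 'a word set set" where "parabolic X = cls ` words X"

sublocale group G by (rule group_artin_group)

lemma cls_eq: "(u, v) \<in> rel \<Longrightarrow> cls u = cls v"
  unfolding cls_def by (rule equiv_class_eq[OF equiv_pres_rel])

lemma cls_eqD: "cls u = cls v \<Longrightarrow> v \<in> words S \<Longrightarrow> (u, v) \<in> rel"
  unfolding cls_def by (rule eq_equiv_class[OF _ equiv_pres_rel])

lemma cls_mult [simp]: "u \<in> words S \<Longrightarrow> v \<in> words S \<Longrightarrow> cls u \<otimes>\<^bsub>G\<^esub> cls v = cls (u @ v)"
  unfolding cls_def artin_group_def by (rule presented_group_mult)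

lemma cls_one: "\<one>\<^bsub>G\<^esub> = cls []"
  unfolding cls_def artin_group_def by (rule presented_group_one)

lemma cls_carrier [simp]: "w \<in> words S \<Longrightarrow> cls w \<in> carrier G"
  unfolding cls_def artin_group_def by (rule presented_group_carrierI)

lemma carrier_cls: "x \<in> carrier G \<Longrightarrow> \<exists>w\<in>words S. x = cls w"
  unfolding cls_def artin_group_def by (metis presented_group_carrierE)

lemma winv_words [simp]: "winv w \<in> words X \<longleftrightarrow> w \<in> words X"
  by (force simp: winv_def words_def in_lists_conv_set)

lemma cls_inv [simp]: "w \<in> words S \<Longrightarrow> inv\<^bsub>G\<^esub> cls w = cls (winv w)"
proof (rule inv_equality)
  assume w: "w \<in> words S"
  then have "(winv w @ w, []) \<in> rel"
    unfolding winv_def by (rule pres_rel_left_inverse)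
  then show "cls (winv w) \<otimes>\<^bsub>G\<^esub> cls w = \<one>\<^bsub>G\<^esub>"
    using w cls_eq by (simp add: cls_one)
qed simp_all

lemma cls_append_cong:
  "cls u = cls u' \<Longrightarrow> cls v = cls v' \<Longrightarrow> {u, u', v, v'} \<subseteq> words S \<Longrightarrow> cls (u @ v) = cls (u' @ v')"
  by (metis cls_mult insert_subset)

lemma subgroup_parabolic: "X \<subseteq> S \<Longrightarrow> subgroup (parabolic X) G"
proof
  assume X: "X \<subseteq> S"
  note w = words_mono[OF _ X]
  show "parabolic X \<subseteq> carrier G" using w by (auto simp: parabolic_def)
  show "\<one>\<^bsub>G\<^esub> \<in> parabolic X" by (auto simp: parabolic_def cls_one)
  show "x \<otimes>\<^bsub>G\<^esub> y \<in> parabolic X" if "x \<in> parabolic X" "y \<in> parabolic X" for x y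
    using that w by (auto simp: parabolic_def)
  show "inv\<^bsub>G\<^esub> x \<in> parabolic X" if "x \<in> parabolic X" for x
    using that w by (auto simp: parabolic_def)
qed

lemma relation_cases:
  assumes "(l, r) \<in> artin_relations \<Gamma> \<mu>"
  obtains s t where "(s, t) \<in> parcs \<Gamma>" "l = pos (alternating (m s t) s t)" "r = pos (alternating (m s t) t s)"
  using assms by (auto simp: artin_relations_def alternating_word_eq m_def)

lemma braid_cls: "(s, t) \<in> parcs \<Gamma> \<Longrightarrow> cls (pos (alternating (m s t) s t)) = cls (pos (alternating (m s t) t s))"
proof -
  assume st: "(s, t) \<in> parcs \<Gamma>"
  have "set (alternating (m s t) s t) \<subseteq> S" "set (alternating (m s t) t s) \<subseteq> S"
    using arcs(1,2)[OF st] by (simp_all add: set_alternating_subset)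
  moreover have "(pos (alternating (m s t) s t), pos (alternating (m s t) t s)) \<in> artin_relations \<Gamma> \<mu>"
    using st by (auto simp: artin_relations_def alternating_word_eq m_def)
  ultimately have "([] @ pos (alternating (m s t) s t) @ [], [] @ pos (alternating (m s t) t s) @ []) \<in> rel"
    by (intro pres_rel.relation) auto
  then show ?thesis using cls_eq by simp
qed

text \<open>Forgetting exponents gives the projection of the Artin group to the Coxeter group: braid
  relations hold by \<open>braid_rho\<close>, and reflections are involutions.\<close>

lemma rho_rel: "(u, v) \<in> rel \<Longrightarrow> rho (map fst u) = rho (map fst v)"
proof (induction rule: pres_rel.induct)
  case (cancel u v s b)
  then show ?case by (auto simp: fun_eq_iff)
next
  case (relation l r u v)
  from relation(1) obtain s t where st: "(s, t) \<in> parcs \<Gamma>" "l = pos (alternating (m s t) s t)"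
    "r = pos (alternating (m s t) t s)" by (rule relation_cases)
  have "m s t \<noteq> 0" using label[OF st(1)] st(1) by (simp add: m_def)
  then have "rho (map fst l) = rho (map fst r)"
    using braid_rho[of s t] arcs[OF st(1)] st by simp
  then show ?case by simp
qed simp_all

section \<open>The retraction on words\<close>

text \<open>Unspecified on other vectors; \<open>D_root\<close> ensures that it is applied to simple
  roots only, as long as the state is minimal.\<close>

definition root_index :: "('a \<Rightarrow> real) \<Rightarrow> 'a" where "root_index v = (THE x. v = simple_root x)"

lemma root_index_simple_root [simp]: "root_index (simple_root x) = x" by (simp add: root_index_def)

text \<open>
  The retraction of Charney and Paris onto a parabolic subgroup: a word is read from left to right
  while the minimal representative \<open>w\<close> of the coset \<open>W\<^sub>X w\<close> moves, and a letter is output, transported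
  back to \<open>X\<close>, whenever it fixes this coset.
\<close>

primrec retract :: "'a set \<Rightarrow> 'a word \<Rightarrow> (('a \<Rightarrow> real) \<Rightarrow> 'a \<Rightarrow> real) \<Rightarrow> (('a \<Rightarrow> real) \<Rightarrow> 'a \<Rightarrow> real) \<times> 'a word"
  where
  "retract X [] w = (w, [])"
| "retract X (a # u) w =
    (if w (simple_root (fst a)) \<in> supp X
     then (fst (retract X u w), (root_index (w (simple_root (fst a))), snd a) # snd (retract X u w))
     else retract X u (w \<circ> refl (fst a)))"

lemma retract_append:
  "fst (retract X (u @ v) w) = fst (retract X v (fst (retract X u w)))"
  "snd (retract X (u @ v) w) = snd (retract X u w) @ snd (retract X v (fst (retract X u w)))"
  by (induction u arbitrary: w) auto

text \<open>\<open>D_root\<close> handles the letters that are output, \<open>D_step\<close> those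
  that move the coset.\<close>

lemma retract_D:
  assumes "X \<subseteq> S" "w \<in> D X" "u \<in> words S"
  shows "fst (retract X u w) \<in> D X \<and> snd (retract X u w) \<in> words X"
  using assms(2,3)
proof (induction u arbitrary: w)
  case (Cons a u)
  have a: "fst a \<in> S" and u: "u \<in> words S" using Cons.prems by auto
  show ?case
  proof (cases "w (simple_root (fst a)) \<in> supp X")
    case True
    then obtain x where "x \<in> X" "w (simple_root (fst a)) = simple_root x"
      using D_root[OF Cons.prems(1) assms(1) a] by blast
    then show ?thesis using Cons.IH[OF Cons.prems(1) u] by simp
  next
    case False
    then show ?thesis using Cons.IH[OF D_step[OF Cons.prems(1) assms(1) a False] u] by (simp add: comp_def)
  qed
qed simp

lemma retract_no_output:
  assumes "\<And>j. j < length l \<Longrightarrow> w (rho (take j l) (simple_root (l ! j))) \<notin> supp X"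
  shows "retract X (pos l) w = (w \<circ> rho l, [])"
  using assms
proof (induction l arbitrary: w)
  case (Cons a l)
  have "w (simple_root a) \<notin> supp X" using Cons.prems[of 0] by simp
  moreover have "retract X (pos l) (w \<circ> refl a) = (w \<circ> refl a \<circ> rho l, [])"
    using Cons.prems[of "Suc _"] by (intro Cons.IH) simp
  ultimately show ?case by (simp add: comp_def)
qed simp

text \<open>The output letter does not move the state, so the later states omit its reflection. By
  \<open>rho_conj\<close> it can be moved to the left as \<open>refl x\<close>, which preserves
  \<open>supp X\<close> and hence the outcome of all later tests.\<close>

lemma retract_one_output:
  assumes X: "X \<subseteq> S" and l: "set l \<subseteq> S" and w: "w \<in> W" and i: "i < length l"
    and x: "x \<in> X" "w (rho (take i l) (simple_root (l ! i))) = simple_root x"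
    and no: "\<And>j. j < length l \<Longrightarrow> j \<noteq> i \<Longrightarrow> w (rho (take j l) (simple_root (l ! j))) \<notin> supp X"
  shows "retract X (pos l) w = (refl x \<circ> w \<circ> rho l, [(x, True)])"
proof -
  define l1 l2 where "l1 = take i l" and "l2 = drop (Suc i) l"
  have l_eq: "l = l1 @ (l ! i) # l2" using i by (simp add: l1_def l2_def id_take_nth_drop)
  have len1: "length l1 = i" using i by (simp add: l1_def)
  have li: "l ! i \<in> S" using l i by auto
  obtain lw where lw: "set lw \<subseteq> S" "w = rho lw" using w by (auto simp: W_def)
  have l1S: "set l1 \<subseteq> S" using l by (auto simp: l1_def dest: in_set_takeD)
  have conj: "w \<circ> rho l1 \<circ> refl (l ! i) = refl x \<circ> (w \<circ> rho l1)"
    using rho_conj[of "lw @ l1" "l ! i" x] lw l1S li x X by (auto simp: l1_def)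
  have xS: "x \<in> S" using x X by blast
  have 1: "retract X (pos l1) w = (w \<circ> rho l1, [])"
  proof (rule retract_no_output)
    fix j assume j: "j < length l1"
    then have "take j l1 = take j l" "l1 ! j = l ! j" by (simp_all add: l1_def)
    then show "w (rho (take j l1) (simple_root (l1 ! j))) \<notin> supp X" using no[of j] j len1 i by simp
  qed
  have 2: "retract X (pos l2) (w \<circ> rho l1) = (w \<circ> rho l1 \<circ> rho l2, [])"
  proof (rule retract_no_output)
    fix j assume j: "j < length l2"
    have idx: "Suc i + j < length l" "Suc i + j \<noteq> i" using j i by (auto simp: l2_def)
    have tk: "take (Suc i + j) l = l1 @ (l ! i) # take j l2"
      unfolding take_add using i by (simp add: l1_def l2_def take_Suc_conv_app_nth)
    have "w (rho (take (Suc i + j) l) (simple_root (l ! (Suc i + j)))) =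
        (w \<circ> rho l1 \<circ> refl (l ! i)) (rho (take j l2) (simple_root (l2 ! j)))"
      unfolding tk using j by (simp add: l2_def)
    also have "\<dots> = refl x (w (rho l1 (rho (take j l2) (simple_root (l2 ! j)))))"
      unfolding conj by simp
    finally show "(w \<circ> rho l1) (rho (take j l2) (simple_root (l2 ! j))) \<notin> supp X"
      using no[OF idx] refl_supp[OF x(1)] by simp
  qed
  have "refl x \<circ> w \<circ> rho l = w \<circ> rho l1 \<circ> rho l2"
  proof -
    have "rho l = rho l1 \<circ> (refl (l ! i) \<circ> rho l2)" by (subst l_eq) simp
    then have "refl x \<circ> w \<circ> rho l = (refl x \<circ> (w \<circ> rho l1)) \<circ> refl (l ! i) \<circ> rho l2"
      by (simp add: o_assoc)
    also have "\<dots> = w \<circ> rho l1 \<circ> (refl (l ! i) \<circ> refl (l ! i)) \<circ> rho l2"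
      unfolding conj[symmetric] by (simp add: o_assoc)
    also have "refl (l ! i) \<circ> refl (l ! i) = id" using li by auto
    finally show ?thesis by (simp only: comp_id)
  qed
  moreover have "retract X (pos l) w = (w \<circ> rho l1 \<circ> rho l2, [(x, True)])"
  proof -
    have hit: "(w \<circ> rho l1) (simple_root (l ! i)) = simple_root x" using x(2) by (simp add: l1_def)
    have "pos l = pos l1 @ (l ! i, True) # pos l2" by (subst l_eq) simp
    then show ?thesis
      using retract_append[of X "pos l1" "(l ! i, True) # pos l2" w] 1 2 hit x(1)
      by (intro prod_eqI) simp_all
  qed
  ultimately show ?thesis by simp
qed

lemma retract_stay:
  assumes "w (simple_root s) = simple_root x" "w (simple_root t) = simple_root y" "x \<in> X" "y \<in> X"
  shows "retract X (pos (alternating k s t)) w = (w, pos (alternating k x y))"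
  using assms by (induction k arbitrary: s t x y) simp_all

text \<open>Up to the factor \<open>(sin h)\<^sup>2\<close>, the determinant is the product of
  \<open>sin h\<close> and \<open>sin (j * h - i * h)\<close>, and both angles lie strictly between
  0 and \<open>pi\<close>.\<close>

lemma U_det:
  assumes "s \<noteq> t" "m s t \<noteq> 0" "i < j" "j < m s t"
  shows "U s t (Suc i) * U s t j \<noteq> U s t i * U s t (Suc j)"
proof
  define h where "h = pi / m s t"
  have U: "U s t n * sin h = sin (n * h)" for n
    using U_sin(1)[OF assms(1,2)] by (simp add: h_def)
  assume "U s t (Suc i) * U s t j = U s t i * U s t (Suc j)"
  then have "(U s t (Suc i) * sin h) * (U s t j * sin h) = (U s t i * sin h) * (U s t (Suc j) * sin h)"
    by (simp del: chebyshev.simps)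
  then have "sin (Suc i * h) * sin (j * h) = sin (i * h) * sin (Suc j * h)"
    unfolding U .
  moreover have "sin (Suc i * h) * sin (j * h) - sin (i * h) * sin (Suc j * h) = sin h * sin (j * h - i * h)"
  proof -
    have e: "real (Suc i) * h = i * h + h" "real (Suc j) * h = j * h + h" by (simp_all add: algebra_simps)
    show ?thesis unfolding e sin_add sin_diff by (simp add: algebra_simps)
  qed
  ultimately have "sin h * sin (j * h - i * h) = 0" by simp
  moreover have "sin h > 0" using U_sin(2)[OF assms(1,2)] by (simp add: h_def)
  moreover have "sin (j * h - i * h) > 0"
  proof (rule sin_gt_zero)
    have h: "h > 0" using assms(2) by (simp add: h_def)
    show "0 < j * h - i * h" using assms(3) h by simp
    have "j * h < m s t * h" using assms(4) h by simp
    also have "\<dots> = pi" using assms(2) by (simp add: h_def)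
    finally show "j * h - i * h < pi" using h by (smt (verit) mult_nonneg_nonneg of_nat_0_le_iff)
  qed
  ultimately show False by simp
qed

text \<open>If both simple roots land in \<open>supp X\<close>, the outputs are the two sides of a
  braid relation with the same label. Otherwise at most one root of the dihedral subsystem lands
  there, since two would span both simple roots; the two words then output the same single letter,
  or nothing.\<close>

lemma retract_braid:
  assumes X: "X \<subseteq> S" and w: "w \<in> D X" and st: "(s, t) \<in> parcs \<Gamma>"
  defines "n \<equiv> m s t"
  shows "fst (retract X (pos (alternating n s t)) w) = fst (retract X (pos (alternating n t s)) w) \<and>
    cls (snd (retract X (pos (alternating n s t)) w)) = cls (snd (retract X (pos (alternating n t s)) w))"
proof -
  note S = arcs[OF st]
  have n2: "n \<ge> 2" using label[OF st] st by (simp add: n_def m_def)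
  then have n0: "m s t \<noteq> 0" by (simp add: n_def)
  have wW: "w \<in> W" using w by (simp add: D_def)
  obtain lw where lw: "set lw \<subseteq> S" "w = rho lw" using D_ex[OF w] by blast
  \<comment> \<open>\<open>\<gamma> j\<close> is the root met at position \<open>j\<close> of the
    word beginning with \<open>s\<close>; the other word meets the same roots in reverse
    order.\<close>
  define \<gamma> where "\<gamma> j = (\<lambda>u. U s t (Suc j) * simple_root s u + U s t j * simple_root t u)" for j
  have root: "rho (take j (alternating n s t)) (simple_root (alternating n s t ! j)) = \<gamma> j" if "j < n" for j
    using that alternating_root[OF S(1,2), of j] by (simp add: take_alternating nth_alternating \<gamma>_def del: chebyshev.simps)
  have root': "rho (take j (alternating n t s)) (simple_root (alternating n t s ! j)) = \<gamma> (n - 1 - j)" if "j < n" for j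
  proof -
    have "U s t (Suc (n - 1 - j)) = U s t j" "U s t (n - 1 - j) = U s t (Suc j)"
      using U_reflect[OF S(4) n0, of j] U_reflect[OF S(4) n0, of "Suc j"] that
      by (simp_all add: n_def Suc_diff_Suc del: chebyshev.simps)
    then show ?thesis
      using that alternating_root[OF S(2,1), of j]
      by (simp add: take_alternating nth_alternating \<gamma>_def U_sym[of t s] add.commute del: chebyshev.simps)
  qed
  have setS: "set (alternating n s t) \<subseteq> S" "set (alternating n t s) \<subseteq> S"
    using S(1,2) by (simp_all add: set_alternating_subset)
  have braid: "rho (alternating n s t) = rho (alternating n t s)"
    unfolding n_def using braid_rho[OF S(1,2,4) n0] .
  show ?thesis
  proof (cases "w (simple_root s) \<in> supp X \<and> w (simple_root t) \<in> supp X")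
    case True
    obtain x where x: "x \<in> X" "w (simple_root s) = simple_root x" using D_root[OF w X S(1)] True by blast
    obtain y where y: "y \<in> X" "w (simple_root t) = simple_root y" using D_root[OF w X S(2)] True by blast
    have xy: "x \<noteq> y" using x y S(4) lw by (metis rho_rev' simple_root_inj)
    have xyS: "x \<in> S" "y \<in> S" using x y X by auto
    have "c x y = c s t"
      using pair_rho[OF lw(1) S(1) xyS(1), of "simple_root t"] x y lw(2) S(2) xyS by simp
    then have mm: "m x y = m s t" using c_inj[OF xy S(4)] by simp
    then have "(x, y) \<in> parcs \<Gamma>" using n0 by (auto simp: m_def split: if_splits)
    then have "cls (pos (alternating n x y)) = cls (pos (alternating n y x))"
      using braid_cls[of x y] mm by (simp add: n_def)
    then show ?thesis using retract_stay x y by simp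
  next
    case False
    have unique: "i = j" if "i < n" "j < n" "w (\<gamma> i) \<in> supp X" "w (\<gamma> j) \<in> supp X" for i j
    proof (rule ccontr)
      have *: False if ij: "i < j" "j < n" "w (\<gamma> i) \<in> supp X" "w (\<gamma> j) \<in> supp X" for i j
      proof -
        \<comment> \<open>The determinant for solving for the two simple roots in terms of
          \<open>\<gamma> i\<close> and \<open>\<gamma> j\<close>.\<close>
        define d where "d = U s t (Suc i) * U s t j - U s t i * U s t (Suc j)"
        have d: "d \<noteq> 0" using U_det[OF S(4) n0, of i j] ij by (simp add: d_def n_def)
        have wg: "w (\<gamma> k) u = U s t (Suc k) * w (simple_root s) u + U s t k * w (simple_root t) u" for k u
          unfolding \<gamma>_def lw(2) rho_lin ..
        have lc: "d * w (simple_root s) u = U s t j * w (\<gamma> i) u - U s t i * w (\<gamma> j) u"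
          "d * w (simple_root t) u = U s t (Suc i) * w (\<gamma> j) u - U s t (Suc j) * w (\<gamma> i) u" for u
          unfolding wg d_def by (simp_all add: algebra_simps del: chebyshev.simps)
        have "w (simple_root s) u = 0 \<and> w (simple_root t) u = 0" if u: "u \<notin> X" for u
        proof -
          have "w (\<gamma> i) u = 0" "w (\<gamma> j) u = 0" using ij(3,4) u by (auto simp: supp_def)
          then have "d * w (simple_root s) u = 0" "d * w (simple_root t) u = 0" using lc[of u] by simp_all
          then show ?thesis using d by simp
        qed
        then show False using False by (simp add: supp_def)
      qed
      assume "i \<noteq> j"
      then show False using *[of i j] *[of j i] that by (meson linorder_neqE_nat)
    qed
    show ?thesis
    proof (cases "\<exists>i<n. w (\<gamma> i) \<in> supp X")
      case True
      then obtain i where i: "i < n" "w (\<gamma> i) \<in> supp X" by blast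
      \<comment> \<open>Nothing is output before position \<open>i\<close>, so the state reached
        there is still minimal and \<open>D_root\<close> applies.\<close>
      have "w \<circ> rho (take i (alternating n s t)) \<in> D X"
      proof -
        have "retract X (pos (take i (alternating n s t))) w = (w \<circ> rho (take i (alternating n s t)), [])"
        proof (rule retract_no_output)
          fix j assume "j < length (take i (alternating n s t))"
          then show "w (rho (take j (take i (alternating n s t))) (simple_root (take i (alternating n s t) ! j))) \<notin> supp X"
            using root[of j] unique[of i j] i by auto
        qed
        then show ?thesis
          using retract_D[OF X w, of "pos (take i (alternating n s t))"] setS(1)
          by (auto dest: in_set_takeD)
      qed
      moreover have "alternating n s t ! i \<in> S" using setS(1) i(1) by (simp add: subset_code(1))
      moreover have "(w \<circ> rho (take i (alternating n s t))) (simple_root (alternating n s t ! i)) \<in> supp X"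
        using i root by simp
      ultimately obtain x where x: "x \<in> X" "w (\<gamma> i) = simple_root x"
        using D_root[OF _ X] root[OF i(1)] by (metis comp_apply)
      have "retract X (pos (alternating n s t)) w = (refl x \<circ> w \<circ> rho (alternating n s t), [(x, True)])"
        using i x unique by (intro retract_one_output[OF X setS(1) wW, of i]) (auto simp: root)
      moreover have "retract X (pos (alternating n t s)) w = (refl x \<circ> w \<circ> rho (alternating n t s), [(x, True)])"
      proof (rule retract_one_output[OF X setS(2) wW, of "n - 1 - i"])
        show "n - 1 - i < length (alternating n t s)" using i by simp
        show "w (rho (take (n - 1 - i) (alternating n t s)) (simple_root (alternating n t s ! (n - 1 - i)))) = simple_root x"
          using i x root'[of "n - 1 - i"] by simp
        show "w (rho (take j (alternating n t s)) (simple_root (alternating n t s ! j))) \<notin> supp X"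
          if "j < length (alternating n t s)" "j \<noteq> n - 1 - i" for j
          using that root'[of j] unique[of i "n - 1 - j"] i by auto
      qed (rule x)
      ultimately show ?thesis using braid by simp
    next
      case no: False
      have "retract X (pos (alternating n s t)) w = (w \<circ> rho (alternating n s t), [])"
        using no by (intro retract_no_output) (auto simp: root)
      moreover have "retract X (pos (alternating n t s)) w = (w \<circ> rho (alternating n t s), [])"
        using no by (intro retract_no_output) (auto simp: root')
      ultimately show ?thesis using braid by simp
    qed
  qed
qed

text \<open>Either both letters are output and cancel, or the state moves by \<open>refl s\<close>
  and, the tested root being merely negated, moves back.\<close>

lemma retract_cancel:
  assumes X: "X \<subseteq> S" and w: "w \<in> D X" and s: "s \<in> S"
  shows "fst (retract X [(s, b), (s, \<not> b)] w) = w \<and> cls (snd (retract X [(s, b), (s, \<not> b)] w)) = cls []"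
proof (cases "w (simple_root s) \<in> supp X")
  case True
  then obtain x where x: "x \<in> X" "w (simple_root s) = simple_root x" using D_root[OF w X s] by blast
  have "([] @ [(x, b), (x, \<not> b)] @ [], [] @ []) \<in> rel"
    using x(1) X by (intro pres_rel.cancel) auto
  then show ?thesis using x cls_eq by simp
next
  case False
  obtain lw where lw: "set lw \<subseteq> S" "w = rho lw" using D_ex[OF w] by blast
  have "w (refl s (simple_root s)) = (\<lambda>u. - w (simple_root s) u)" using s by (simp add: lw rho_neg)
  then have "w (refl s (simple_root s)) \<notin> supp X" using False supp_neg by simp
  moreover have "w \<circ> refl s \<circ> refl s = w" using s by auto
  ultimately show ?thesis using False by (simp del: refl_simple_root_self)
qed

text \<open>Hence the retraction descends to the Artin group as a map of sets.\<close>

lemma retract_rel: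
  assumes X: "X \<subseteq> S"
  shows "(u, v) \<in> rel \<Longrightarrow> w \<in> D X \<Longrightarrow>
    fst (retract X u w) = fst (retract X v w) \<and> cls (snd (retract X u w)) = cls (snd (retract X v w))"
proof (induction arbitrary: w rule: pres_rel.induct)
  \<comment> \<open>Since \<open>p\<close> and \<open>q\<close> lead to the same state, the suffix
    \<open>v\<close> is processed identically after either of them.\<close>
  have subst: "fst (retract X (u @ p @ v) w) = fst (retract X (u @ q @ v) w) \<and>
      cls (snd (retract X (u @ p @ v) w)) = cls (snd (retract X (u @ q @ v) w))"
    if w: "w \<in> D X" and wd: "u \<in> words S" "v \<in> words S" "p \<in> words S" "q \<in> words S"
      and eq: "\<And>w. w \<in> D X \<Longrightarrow>
        fst (retract X p w) = fst (retract X q w) \<and> cls (snd (retract X p w)) = cls (snd (retract X q w))"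
    for w u v p q
  proof -
    define w1 where "w1 = fst (retract X u w)"
    have w1: "w1 \<in> D X" using retract_D[OF X w wd(1)] by (simp add: w1_def)
    define w2 where "w2 = fst (retract X p w1)"
    have w2: "w2 \<in> D X" "w2 = fst (retract X q w1)" using retract_D[OF X w1 wd(3)] eq[OF w1] by (simp_all add: w2_def)
    have wS: "snd (retract X a b) \<in> words S" if "a \<in> words S" "b \<in> D X" for a b
      using retract_D[OF X that(2,1)] words_mono[OF _ X] by blast
    have "cls (snd (retract X p w1) @ snd (retract X v w2)) = cls (snd (retract X q w1) @ snd (retract X v w2))"
      by (rule cls_append_cong[OF conjunct2[OF eq[OF w1]] HOL.refl]) (use wS wd w1 w2 in auto)
    then have "cls (snd (retract X u w) @ snd (retract X p w1) @ snd (retract X v w2)) =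
        cls (snd (retract X u w) @ snd (retract X q w1) @ snd (retract X v w2))"
      by (rule cls_append_cong[OF HOL.refl]) (use wS wd w w1 w2 in auto)
    then show ?thesis using w2(2) by (simp add: retract_append flip: w1_def w2_def)
  qed
  {
    case (cancel u v s b)
    then show ?case
      using subst[of w u v "[(s, b), (s, \<not> b)]" "[]"] retract_cancel[OF X, of _ s b] by auto
  next
    case (relation l r u v)
    from relation(1) obtain s t where st: "(s, t) \<in> parcs \<Gamma>" "l = pos (alternating (m s t) s t)"
      "r = pos (alternating (m s t) t s)" by (rule relation_cases)
    show ?case
      using relation retract_braid[OF X _ st(1)] by (intro subst) (simp_all add: st)
  }
qed auto

section \<open>Normal subgroups contained in a parabolic subgroup\<close>

lemma rho_outside: "set l \<subseteq> X \<Longrightarrow> u \<notin> X \<Longrightarrow> rho l v u = v u"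
proof (induction l)
  case (Cons x l)
  then show ?case by (auto simp: refl_def simple_root_def)
qed simp

text \<open>Serves to refute membership in a parabolic subgroup: reflections in \<open>X\<close>
  change only coordinates in \<open>X\<close>.\<close>

lemma parabolic_rho_outside:
  assumes "cls w \<in> parabolic X" "w \<in> words S" "X \<subseteq> S" "u \<notin> X"
  shows "rho (map fst w) v u = v u"
proof -
  obtain w' where w': "w' \<in> words X" "cls w = cls w'" using assms(1) by (auto simp: parabolic_def)
  then have "(w, w') \<in> rel" using cls_eqD words_mono assms(3) by blast
  then show ?thesis using rho_rel rho_outside[OF words_fst[OF w'(1)] assms(4)] by simp
qed

lemma retract_within:
  assumes "w \<in> words X"
  shows "retract X w id = (id, w)"
  using assms by (induction w) auto

text \<open>The state keeps the form \<open>refl s \<circ> rho l\<close> with \<open>l\<close> over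
  \<open>X\<close>. If \<open>y\<close> is output, \<open>refl s\<close> maps its simple root into
  \<open>supp X\<close>, so the coordinate at \<open>s\<close>, which is \<open>- c s y\<close>,
  vanishes.\<close>

lemma retract_from_reflection:
  assumes X: "X \<subseteq> S" and s: "s \<in> S" "s \<notin> X"
    and "u \<in> words X" "set l \<subseteq> X" "refl s \<circ> rho l \<in> D X"
  shows "snd (retract X u (refl s \<circ> rho l)) \<in> words {x \<in> X. c s x = 0}"
  using assms(4-6)
proof (induction u arbitrary: l)
  case (Cons a u)
  let ?w = "refl s \<circ> rho l"
  have x: "fst a \<in> X" "fst a \<in> S" and u: "u \<in> words X" using Cons.prems X by auto
  show ?case
  proof (cases "?w (simple_root (fst a)) \<in> supp X")
    case True
    obtain y where y: "y \<in> X" "?w (simple_root (fst a)) = simple_root y"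
      using D_root[OF Cons.prems(3) X x(2) True] by blast
    have "rho l (simple_root (fst a)) = refl s (simple_root y)"
      using y(2) s(1) by (metis comp_apply refl_refl)
    then have "refl s (simple_root y) \<in> supp X"
      using x Cons.prems(2) by (metis rho_supp simple_root_supp)
    then have "refl s (simple_root y) s = 0" using s(2) by (simp add: supp_def)
    then have "c s y = 0" using y(1) s X by (simp add: refl_simple_root subsetD) (metis simple_root_simps(2) add_0 diff_0 neg_equal_0_iff_equal)
    then show ?thesis using True y Cons.IH[OF u Cons.prems(2,3)] by simp
  next
    case False
    have "?w \<circ> refl (fst a) = refl s \<circ> rho (l @ [fst a])" by auto
    moreover have "?w \<circ> refl (fst a) \<in> D X" using D_step[OF Cons.prems(3) X x(2) False] .
    moreover have "set (l @ [fst a]) \<subseteq> X" using Cons.prems(2) x by simp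
    ultimately show ?thesis using Cons.IH[OF u, of "l @ [fst a]"] False by (simp add: comp_def)
  qed
qed simp

text \<open>Retracting \<open>s k s\<^sup>-\<^sup>1 \<in> A\<^sub>X\<close> onto \<open>A\<^sub>X\<close> does not change it, but outputs only letters commuting
  with \<open>s\<close>.\<close>

lemma normal_descent:
  assumes K: "K \<lhd> G" and KX: "K \<subseteq> parabolic X" and X: "X \<subseteq> S" and s: "s \<in> S" "s \<notin> X"
  shows "K \<subseteq> parabolic {x \<in> X. c s x = 0}"
proof
  fix k assume k: "k \<in> K"
  let ?\<sigma> = "cls [(s, True)]"
  have \<sigma>: "?\<sigma> \<in> carrier G" using s by simp
  have kc: "k \<in> carrier G" using K k by (meson normal_imp_subgroup subgroup.mem_carrier)
  have "inv\<^bsub>G\<^esub> ?\<sigma> \<otimes>\<^bsub>G\<^esub> k \<otimes>\<^bsub>G\<^esub> ?\<sigma> \<in> K" using normal.inv_op_closed1[OF K \<sigma> k] .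
  then obtain u where u: "u \<in> words X" "inv\<^bsub>G\<^esub> ?\<sigma> \<otimes>\<^bsub>G\<^esub> k \<otimes>\<^bsub>G\<^esub> ?\<sigma> = cls u"
    using KX by (auto simp: parabolic_def)
  obtain u' where u': "u' \<in> words X" "k = cls u'" using KX k by (auto simp: parabolic_def)
  have wS: "u \<in> words S" "u' \<in> words S" using u(1) u'(1) words_mono X by blast+
  have "k = ?\<sigma> \<otimes>\<^bsub>G\<^esub> (inv\<^bsub>G\<^esub> ?\<sigma> \<otimes>\<^bsub>G\<^esub> k \<otimes>\<^bsub>G\<^esub> ?\<sigma>) \<otimes>\<^bsub>G\<^esub> inv\<^bsub>G\<^esub> ?\<sigma>"
    using \<sigma> kc by (simp add: m_assoc del: cls_inv cls_mult)
  also have "\<dots> = cls ((s, True) # u @ [(s, False)])"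
    unfolding u(2) using s wS by (simp add: winv_def)
  finally have eq: "cls ((s, True) # u @ [(s, False)]) = cls u'" using u'(2) by simp
  then have "((s, True) # u @ [(s, False)], u') \<in> rel" using wS by (intro cls_eqD)
  from retract_rel[OF X this id_D] retract_within[OF u'(1)]
  have retract: "fst (retract X ((s, True) # u @ [(s, False)]) id) = id"
    "cls (snd (retract X ((s, True) # u @ [(s, False)]) id)) = cls u'" by simp_all
  have start: "retract X ((s, True) # u @ [(s, False)]) id = retract X (u @ [(s, False)]) (refl s)"
    using s by simp
  define w where "w = fst (retract X u (refl s))"
  \<comment> \<open>Were the last letter output, the final state \<open>id\<close> would already
    have been reached before it; but \<open>id\<close> does not take the simple root of
    \<open>s\<close> into \<open>supp X\<close>.\<close>
  have "snd (retract X [(s, False)] w) = []"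
  proof (cases "w (simple_root s) \<in> supp X")
    case True
    then have "w = id" using retract(1) unfolding start retract_append by (simp flip: w_def)
    then show ?thesis using True s by simp
  qed simp
  then have "cls (snd (retract X u (refl s))) = cls u'"
    using retract(2) unfolding start retract_append by (simp flip: w_def)
  moreover have "refl s \<in> D X"
    using D_step[OF id_D X s(1)] s by simp
  then have "snd (retract X u (refl s)) \<in> words {x \<in> X. c s x = 0}"
    using retract_from_reflection[OF X s u(1), of "[]"] by simp
  then have "cls (snd (retract X u (refl s))) \<in> parabolic {x \<in> X. c s x = 0}"
    unfolding parabolic_def by (rule imageI)
  ultimately show "k \<in> parabolic {x \<in> X. c s x = 0}" using u'(2) by simp
qed

text \<open>Turns adjacency in the Coxeter graph into non-orthogonality: the cosine of
  \<open>pi / n\<close> is positive from label 3 on.\<close>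

lemma coxeter_arc_c:
  assumes "(x, s) \<in> parcs (coxeter_graph \<Gamma> \<mu>)"
  shows "x \<in> S" "s \<in> S" "x \<noteq> s" "c s x \<noteq> 0"
proof -
  show xs: "x \<in> S" "s \<in> S" "x \<noteq> s" using assms by (auto simp: coxeter_graph_def)
  have "m s x = 0 \<or> 3 \<le> m s x" using assms arcs(3)
    by (auto simp: coxeter_graph_def m_def insert_commute)
  moreover have "cos (pi / real n) > 0" if "3 \<le> n" for n :: nat
  proof (rule cos_gt_zero_pi)
    show "- (pi / 2) < pi / real n" using that by (simp add: field_simps) (smt (verit) pi_gt_zero of_nat_0_le_iff mult_nonneg_nonneg)
    have "pi * 2 < pi * real n" using that by simp
    then show "pi / real n < pi / 2" using that by (simp add: field_simps)
  qed
  ultimately show "c s x \<noteq> 0" using xs(3) by (fastforce simp: c_def)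
qed

lemma irreducible_boundary:
  assumes irr: "artin_irreducible \<Gamma> \<mu>" and X: "X \<subseteq> S" "X \<noteq> {}" "X \<noteq> S"
  shows "\<exists>x\<in>X. \<exists>s\<in>S - X. c s x \<noteq> 0"
proof (rule ccontr)
  assume no: "\<not> ?thesis"
  \<comment> \<open>\<open>connected\<close> is strong connectedness of the symmetric
    closure.\<close>
  let ?M = "with_proj (mk_symmetric (with_proj (coxeter_graph \<Gamma> \<mu>)))"
  have verts: "pverts (coxeter_graph \<Gamma> \<mu>) = S" by (simp add: coxeter_graph_def)
  obtain x s where x: "x \<in> X" and s: "s \<in> S" "s \<notin> X" using X by blast
  have "x \<rightarrow>\<^sup>*\<^bsub>?M\<^esub> s"
    using irr x s X(1) verts unfolding artin_irreducible_def Digraph_Component.connected_def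
    by (auto simp: strongly_connected_def)
  then have "s \<in> X"
    unfolding reachable_def
  proof (induction rule: rtrancl_on_induct)
    case base
    then show ?case using x by simp
  next
    case (step u v)
    then have "(u, v) \<in> parcs (coxeter_graph \<Gamma> \<mu>) \<or> (v, u) \<in> parcs (coxeter_graph \<Gamma> \<mu>)"
      by (auto simp: parcs_mk_symmetric)
    then have "v \<in> S" "c v u \<noteq> 0" using coxeter_arc_c[of u v] coxeter_arc_c[of v u] c_sym by metis+
    then show ?case using no step.IH by blast
  qed
  then show False using s by simp
qed

lemma normal_in_parabolic_trivial:
  assumes irr: "artin_irreducible \<Gamma> \<mu>" and K: "K \<lhd> G" "K \<subseteq> parabolic X" and X: "X \<subseteq> S" "X \<noteq> S"
  shows "K = {\<one>\<^bsub>G\<^esub>}"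
  using K(2) X
proof (induction "card X" arbitrary: X rule: less_induct)
  case less
  have "\<one>\<^bsub>G\<^esub> \<in> K" using K(1) by (meson normal_imp_subgroup subgroup.one_closed)
  show ?case
  proof (cases "X = {}")
    case True
    then have "parabolic X = {\<one>\<^bsub>G\<^esub>}" by (auto simp: parabolic_def words_def cls_one)
    then show ?thesis using less.prems(1) \<open>\<one>\<^bsub>G\<^esub> \<in> K\<close> by blast
  next
    case False
    obtain x s where xs: "x \<in> X" "s \<in> S" "s \<notin> X" "c s x \<noteq> 0"
      using irreducible_boundary[OF irr less.prems(2) False less.prems(3)] by blast
    let ?Y = "{x \<in> X. c s x = 0}"
    have "card ?Y < card X"
      using xs finite_subset[OF less.prems(2) finite_verts] by (intro psubset_card_mono) auto
    moreover have "K \<subseteq> parabolic ?Y" using normal_descent[OF K(1) less.prems(1,2) xs(2,3)] .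
    ultimately show ?thesis using less.hyps[of ?Y] less.prems(2) xs by blast
  qed
qed

end

section \<open>The Bass--Serre cocycle of two non-adjacent vertices\<close>

text \<open>
  The value \<open>path u y\<close> is the multiplicity of the edge \<open>y\<close> in the path of
  the Bass--Serre tree from the vertex stabilised by \<open>S - {t}\<close> to its image under \<open>u\<close>.
\<close>

locale artin_nonadjacent = artin +
  fixes s t :: 'a
  assumes s: "s \<in> S" and t: "t \<in> S" and st: "s \<noteq> t" and nonadj: "(s, t) \<notin> parcs \<Gamma>"
begin

abbreviation E :: "'a word set set" where "E \<equiv> parabolic (S - {s, t})"

primrec path :: "'a word \<Rightarrow> 'a word set \<Rightarrow> int" where
  "path [] y = 0"
| "path (a # u) y =
    (if fst a = t then of_bool (inv\<^bsub>G\<^esub> cls [a] \<otimes>\<^bsub>G\<^esub> y \<in> E) - of_bool (y \<in> E) else 0) +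
    path u (inv\<^bsub>G\<^esub> cls [a] \<otimes>\<^bsub>G\<^esub> y)"

lemma cls_Cons: "a # u \<in> words S \<Longrightarrow> cls (a # u) = cls [a] \<otimes>\<^bsub>G\<^esub> cls u"
  by simp

lemma inv_cls_Cons:
  assumes "a # u \<in> words S" "y \<in> carrier G"
  shows "inv\<^bsub>G\<^esub> cls (a # u) \<otimes>\<^bsub>G\<^esub> y = inv\<^bsub>G\<^esub> cls u \<otimes>\<^bsub>G\<^esub> (inv\<^bsub>G\<^esub> cls [a] \<otimes>\<^bsub>G\<^esub> y)"
proof -
  have "cls [a] \<in> carrier G" "cls u \<in> carrier G" using assms by auto
  then show ?thesis
    unfolding cls_Cons[OF assms(1)] using assms(2)
    by (simp add: inv_mult_group m_assoc del: cls_mult cls_inv)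
qed

lemma inv_cls_closed: "u \<in> words S \<Longrightarrow> y \<in> carrier G \<Longrightarrow> inv\<^bsub>G\<^esub> cls u \<otimes>\<^bsub>G\<^esub> y \<in> carrier G"
  by (simp del: cls_inv)

lemma path_append:
  "u \<in> words S \<Longrightarrow> v \<in> words S \<Longrightarrow> y \<in> carrier G \<Longrightarrow>
    path (u @ v) y = path u y + path v (inv\<^bsub>G\<^esub> cls u \<otimes>\<^bsub>G\<^esub> y)"
proof (induction u arbitrary: y)
  case Nil
  then show ?case by (simp flip: cls_one del: cls_inv)
next
  case (Cons a u)
  have y': "inv\<^bsub>G\<^esub> cls [a] \<otimes>\<^bsub>G\<^esub> y \<in> carrier G" using Cons.prems by (intro inv_cls_closed) auto
  show ?case using Cons.IH[OF _ Cons.prems(2) y'] Cons.prems inv_cls_Cons[OF Cons.prems(1,3)]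
    by (simp del: cls_inv)
qed

lemma subgroup_E: "subgroup E G" by (rule subgroup_parabolic) blast

lemma E_mult_iff: "x \<in> E \<Longrightarrow> y \<in> carrier G \<Longrightarrow> inv\<^bsub>G\<^esub> x \<otimes>\<^bsub>G\<^esub> y \<in> E \<longleftrightarrow> y \<in> E"
proof
  assume x: "x \<in> E" and y: "y \<in> carrier G"
  have xc: "x \<in> carrier G" using x subgroup_E by (rule subgroup.mem_carrier[rotated])
  show "y \<in> E" if "inv\<^bsub>G\<^esub> x \<otimes>\<^bsub>G\<^esub> y \<in> E"
    using subgroup.m_closed[OF subgroup_E x that] xc y by simp
  show "inv\<^bsub>G\<^esub> x \<otimes>\<^bsub>G\<^esub> y \<in> E" if "y \<in> E"
    using subgroup.m_closed[OF subgroup_E subgroup.m_inv_closed[OF subgroup_E x] that] .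
qed

text \<open>Letters other than \<open>t\<close> lie in \<open>E\<close> and do not affect membership
  in it, so the sum telescopes. The result depends on the class of \<open>u\<close> only.\<close>

lemma path_B:
  "u \<in> words (S - {s}) \<Longrightarrow> y \<in> carrier G \<Longrightarrow>
    path u y = of_bool (inv\<^bsub>G\<^esub> cls u \<otimes>\<^bsub>G\<^esub> y \<in> E) - of_bool (y \<in> E)"
proof (induction u arbitrary: y)
  case Nil
  then show ?case by (simp flip: cls_one)
next
  case (Cons a u)
  have aS: "a # u \<in> words S" using Cons.prems(1) by (rule words_mono) blast
  have y': "inv\<^bsub>G\<^esub> cls [a] \<otimes>\<^bsub>G\<^esub> y \<in> carrier G" using aS Cons.prems by (intro inv_cls_closed) auto
  have "fst a = t \<or> cls [a] \<in> E" using Cons.prems(1) by (auto simp: parabolic_def)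
  then show ?case
    using Cons.IH[OF _ y'] Cons.prems E_mult_iff[of "cls [a]" y]
    by (auto simp: inv_cls_Cons[OF aS] simp del: cls_inv)
qed

lemma path_A: "u \<in> words (S - {t}) \<Longrightarrow> path u y = 0"
  by (induction u arbitrary: y) auto

text \<open>As \<open>s\<close> and \<open>t\<close> are not adjacent, no defining relation involves
  both. Each lies over \<open>S - {s}\<close> or over \<open>S - {t}\<close>, where
  \<open>path_B\<close> or \<open>path_A\<close> applies.\<close>

lemma path_rel: "(u, v) \<in> rel \<Longrightarrow> y \<in> carrier G \<Longrightarrow> path u y = path v y"
proof (induction arbitrary: y rule: pres_rel.induct)
  have subst: "path (u @ p @ v) y = path (u @ q @ v) y"
    if "y \<in> carrier G" "u \<in> words S" "v \<in> words S" "p \<in> words S" "q \<in> words S" "cls p = cls q"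
      and "\<And>y. y \<in> carrier G \<Longrightarrow> path p y = path q y" for u v p q y
    using that inv_cls_closed by (simp add: path_append del: cls_inv)
  {
    case (cancel u v x b)
    have eq: "cls [(x, b), (x, \<not> b)] = cls []"
      using cls_eq[OF pres_rel.cancel[of "[]" S "[]" x b]] cancel by simp
    have "path [(x, b), (x, \<not> b)] y = path [] y" if y: "y \<in> carrier G" for y
    proof (cases "x = t")
      case True
      then have w: "[(x, b), (x, \<not> b)] \<in> words (S - {s})" using t st by auto
      show ?thesis unfolding path_B[OF w y] eq using y by (simp flip: cls_one)
    qed simp
    then show ?case using cancel subst[of y u v "[(x, b), (x, \<not> b)]" "[]"] eq by simp
  next
    case (relation l r u v)
    from relation(1) obtain p q where pq: "(p, q) \<in> parcs \<Gamma>" "l = pos (alternating (m p q) p q)"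
      "r = pos (alternating (m p q) q p)" by (rule relation_cases)
    have eq: "cls l = cls r" using braid_cls pq by simp
    have "path l y = path r y" if y: "y \<in> carrier G" for y
    proof (cases "t \<in> {p, q}")
      case True
      then have "p \<in> S - {s}" "q \<in> S - {s}"
        using arcs[OF pq(1)] pq(1) nonadj st arcs(3) by auto
      then have "l \<in> words (S - {s})" "r \<in> words (S - {s})" using pq by (simp_all add: set_alternating_subset)
      then show ?thesis using path_B y eq by simp
    next
      case False
      then have "p \<in> S - {t}" "q \<in> S - {t}" using arcs[OF pq(1)] by auto
      then have "l \<in> words (S - {t})" "r \<in> words (S - {t})" using pq by (simp_all add: set_alternating_subset)
      then show ?thesis using path_A by simp
    qed
    then show ?case using relation subst eq by blast
  }
qed auto

definition \<beta> :: "'a word set \<Rightarrow> 'a word set \<Rightarrow> int" where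
  "\<beta> x = path (SOME w. w \<in> words S \<and> x = cls w)"

lemma \<beta>_cls: "w \<in> words S \<Longrightarrow> y \<in> carrier G \<Longrightarrow> \<beta> (cls w) y = path w y"
proof -
  assume w: "w \<in> words S" and y: "y \<in> carrier G"
  define w' where "w' = (SOME w'. w' \<in> words S \<and> cls w = cls w')"
  have "w' \<in> words S \<and> cls w = cls w'" unfolding w'_def by (rule someI) (use w in simp)
  then have "(w, w') \<in> rel" using cls_eqD by blast
  then show ?thesis using path_rel y unfolding \<beta>_def w'_def by simp
qed

lemma path_finite_support:
  "u \<in> words S \<Longrightarrow> \<exists>F. finite F \<and> F \<subseteq> carrier G \<and>
    (\<forall>y\<in>carrier G. path u y \<noteq> 0 \<longrightarrow> (\<exists>f\<in>F. inv\<^bsub>G\<^esub> f \<otimes>\<^bsub>G\<^esub> y \<in> E))"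
proof (induction u)
  case Nil
  then show ?case by auto
next
  case (Cons a u)
  let ?a = "cls [a]"
  have a: "?a \<in> carrier G" using Cons.prems by auto
  obtain F where F: "finite F" "F \<subseteq> carrier G"
    "\<And>y. y \<in> carrier G \<Longrightarrow> path u y \<noteq> 0 \<Longrightarrow> \<exists>f\<in>F. inv\<^bsub>G\<^esub> f \<otimes>\<^bsub>G\<^esub> y \<in> E"
    using Cons by auto
  let ?F = "insert \<one>\<^bsub>G\<^esub> (insert ?a ((\<lambda>f. ?a \<otimes>\<^bsub>G\<^esub> f) ` F))"
  have "\<exists>f\<in>?F. inv\<^bsub>G\<^esub> f \<otimes>\<^bsub>G\<^esub> y \<in> E" if y: "y \<in> carrier G" "path (a # u) y \<noteq> 0" for y
  proof -
    have y': "inv\<^bsub>G\<^esub> ?a \<otimes>\<^bsub>G\<^esub> y \<in> carrier G" using a y by (simp del: cls_inv)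
    consider "inv\<^bsub>G\<^esub> ?a \<otimes>\<^bsub>G\<^esub> y \<in> E" | "y \<in> E" | "path u (inv\<^bsub>G\<^esub> ?a \<otimes>\<^bsub>G\<^esub> y) \<noteq> 0"
      using y(2) by (cases "inv\<^bsub>G\<^esub> ?a \<otimes>\<^bsub>G\<^esub> y \<in> E"; cases "y \<in> E")
        (simp_all del: cls_inv split: if_split_asm)
    then show ?thesis
    proof cases
      case 3
      then obtain f where f: "f \<in> F" "inv\<^bsub>G\<^esub> f \<otimes>\<^bsub>G\<^esub> (inv\<^bsub>G\<^esub> ?a \<otimes>\<^bsub>G\<^esub> y) \<in> E" using F(3) y' by blast
      then have "inv\<^bsub>G\<^esub> (?a \<otimes>\<^bsub>G\<^esub> f) \<otimes>\<^bsub>G\<^esub> y \<in> E"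
        using a y(1) F(2) by (simp add: inv_mult_group m_assoc subsetD del: cls_inv)
      then show ?thesis using f(1) by blast
    qed (use y(1) in auto)
  qed
  moreover have "finite ?F" "?F \<subseteq> carrier G" using F(1,2) a by auto
  ultimately show ?case by blast
qed

lemma c_st: "c s t = - 2" "c t s = - 2"
  using st nonadj arcs(3) by (auto simp: c_def m_def)

text \<open>The value -2 of the form makes the coefficients grow linearly, as in the infinite
  dihedral group.\<close>

lemma rho_st_power:
  "rho (concat (replicate n [s, t])) (simple_root s) =
    (\<lambda>u. (2 * real n + 1) * simple_root s u + 2 * real n * simple_root t u)"
proof (induction n)
  case (Suc n)
  have rs: "refl t (simple_root s) = (\<lambda>u. 1 * simple_root s u + 2 * simple_root t u)"
    "refl s (simple_root t) = (\<lambda>u. 1 * simple_root t u + 2 * simple_root s u)"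
    using s t by (simp_all add: refl_simple_root c_st)
  have "rho (concat (replicate (Suc n) [s, t])) (simple_root s) =
      refl s (refl t (\<lambda>u. (2 * real n + 1) * simple_root s u + 2 * real n * simple_root t u))"
    using Suc by simp
  also have "\<dots> = (\<lambda>u. (2 * real n + 1) * (1 * - simple_root s u + 2 * (1 * simple_root t u + 2 * simple_root s u)) +
      2 * real n * - (1 * simple_root t u + 2 * simple_root s u))"
  proof -
    have "refl s (\<lambda>u. - simple_root t u) = (\<lambda>u. - (1 * simple_root t u + 2 * simple_root s u))"
      using rho_neg[of "[s]" "simple_root t"] rs by simp
    then show ?thesis
      unfolding refl_lin refl_simple_root_self[OF t] rs(1) unfolding refl_lin rs(2) refl_simple_root_self[OF s] by simp
  qed
  also have "\<dots> = (\<lambda>u. (2 * real (Suc n) + 1) * simple_root s u + 2 * real (Suc n) * simple_root t u)"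
    by (auto simp: algebra_simps)
  finally show ?case .
qed simp

text \<open>After passing to a nonnegative exponent \<open>k\<close>, the coordinate at the vertex
  outside \<open>X\<close> yields \<open>2 * k + 1 = 1\<close> or \<open>2 * k = 0\<close>.\<close>

lemma st_power_in_parabolic:
  assumes X: "X = S - {s} \<or> X = S - {t}"
    and mem: "(cls [(s, True)] \<otimes>\<^bsub>G\<^esub> cls [(t, True)]) [^]\<^bsub>G\<^esub> (n::int) \<in> parabolic X"
  shows "n = 0"
proof -
  let ?g = "cls [(s, True)] \<otimes>\<^bsub>G\<^esub> cls [(t, True)]"
  have XS: "X \<subseteq> S" using X by blast
  have gc: "?g \<in> carrier G" using s t by simp
  define k where "k = nat \<bar>n\<bar>"
  have "?g [^]\<^bsub>G\<^esub> (- n) \<in> parabolic X"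
    using subgroup.m_inv_closed[OF subgroup_parabolic[OF XS] mem] gc by (simp add: int_pow_neg del: cls_inv cls_mult)
  then have "?g [^]\<^bsub>G\<^esub> int k \<in> parabolic X" using mem by (cases "n \<ge> 0") (simp_all add: k_def del: cls_mult)
  moreover have pow: "?g [^]\<^bsub>G\<^esub> int j = cls (concat (replicate j [(s, True), (t, True)])) \<and>
      concat (replicate j [(s, True), (t, True)]) \<in> words S" for j
  proof (induction j)
    case (Suc j)
    have "?g [^]\<^bsub>G\<^esub> int (Suc j) = ?g \<otimes>\<^bsub>G\<^esub> ?g [^]\<^bsub>G\<^esub> int j"
      using int_pow_mult[OF gc, of 1 "int j"] gc by (simp del: cls_mult)
    then show ?case using Suc s t by simp
  qed (simp add: cls_one)
  ultimately have "rho (map fst (concat (replicate k [(s, True), (t, True)]))) (simple_root s) u = simple_root s u"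
    if "u \<notin> X" for u
    using parabolic_rho_outside[OF _ _ XS that] pow by metis
  moreover have "map fst (concat (replicate k [(s, True), (t, True)])) = concat (replicate k [s, t])"
    by (simp add: map_concat)
  ultimately have *: "(2 * real k + 1) * simple_root s u + 2 * real k * simple_root t u = simple_root s u"
    if "u \<notin> X" for u using that rho_st_power[of k] by simp
  have "k = 0" using X st *[of s] *[of t] by auto
  then show ?thesis by (simp add: k_def)
qed

lemma gen_not_E: "x = s \<or> x = t \<Longrightarrow> cls [(x, True)] \<notin> E"
  using parabolic_rho_outside[of "[(x, True)]" "S - {s, t}" x "simple_root x"] s t by auto

lemma bass_serre_axis:
  "axis_cocycle G (parabolic (S - {t})) (parabolic (S - {s})) E (cls [(s, True)]) (cls [(t, True)]) \<beta>"
proof (intro axis_cocycle.intro axis_cocycle_axioms.intro, goal_cases)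
  case 1 show ?case by (rule is_group)
next
  case 2 show ?case by (rule subgroup_parabolic) blast
next
  case 3 show ?case by (rule subgroup_parabolic) blast
next
  case 4 show ?case by (rule subgroup_E)
next
  case 5 show ?case using words_mono[of _ "S - {s, t}" "S - {t}"] by (auto simp: parabolic_def)
next
  case 6 show ?case using words_mono[of _ "S - {s, t}" "S - {s}"] by (auto simp: parabolic_def)
next
  case 7 show ?case using s st by (auto simp: parabolic_def)
next
  case 8 show ?case using t st by (auto simp: parabolic_def)
next
  case 9 show ?case by (rule gen_not_E) simp
next
  case 10 show ?case by (rule gen_not_E) simp
next
  case (11 n) then show ?case using st_power_in_parabolic by blast
next
  case (12 n) then show ?case using st_power_in_parabolic by blast
next
  case (13 x x' y)
  obtain u v where uv: "u \<in> words S" "x = cls u" "v \<in> words S" "x' = cls v"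
    using carrier_cls 13 by metis
  then show ?case using 13 path_append[of u v y] inv_cls_closed[of u y]
    by (simp add: \<beta>_cls del: cls_inv)
next
  case (14 a y)
  then obtain u where u: "u \<in> words (S - {t})" "a = cls u" by (auto simp: parabolic_def)
  then show ?case using 14 \<beta>_cls[OF words_mono[OF u(1)], of y] path_A by auto
next
  case (15 y)
  have "[(t, True)] \<in> words (S - {s})" "[(t, True)] \<in> words S" using t st by auto
  then show ?case using 15 \<beta>_cls path_B by simp
next
  case (16 x)
  then obtain u where u: "u \<in> words S" "x = cls u" using carrier_cls by blast
  then show ?case using path_finite_support[OF u(1)] \<beta>_cls[OF u(1)] by simp
qed

end

section \<open>Direct decompositions of the Artin group\<close>

text \<open>The commutator of \<open>h\<close> and \<open>k\<close> lies in both normal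
  subgroups.\<close>

lemma (in group) direct_decomposition_commute:
  assumes "direct_decomposition G H K" "h \<in> H" "k \<in> K"
  shows "h \<otimes> k = k \<otimes> h"
proof -
  have H: "H \<lhd> G" and K: "K \<lhd> G" and HK: "H \<inter> K = {\<one>}"
    using assms(1) by (auto simp: direct_decomposition_def)
  have sH: "subgroup H G" and sK: "subgroup K G" using H K by (simp_all add: normal_imp_subgroup)
  have hk: "h \<in> carrier G" "k \<in> carrier G"
    using assms sH sK by (auto dest: subgroup.mem_carrier)
  have "h \<otimes> k \<otimes> inv h \<otimes> inv k \<in> K"
    using normal.inv_op_closed2[OF K hk(1) assms(3)] assms(3) sK
    by (simp add: subgroup.m_closed subgroup.m_inv_closed)
  moreover have "h \<otimes> (k \<otimes> inv h \<otimes> inv k) \<in> H"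
    using normal.inv_op_closed2[OF H hk(2) subgroup.m_inv_closed[OF sH assms(2)]] assms(2) sH
    by (simp add: subgroup.m_closed)
  ultimately have "h \<otimes> k \<otimes> inv h \<otimes> inv k \<in> H \<inter> K" using hk by (simp add: m_assoc)
  then have "h \<otimes> k \<otimes> inv (k \<otimes> h) = \<one>" using HK hk by (simp add: inv_mult_group m_assoc)
  then show ?thesis using hk by (metis inv_closed inv_equality inv_inv m_closed)
qed

theorem artin_directly_indecomposable:
  assumes "pair_graph \<Gamma>" and "\<And>s t. (s, t) \<in> parcs \<Gamma> \<Longrightarrow> 2 \<le> \<mu> {s, t}"
    and irr: "artin_irreducible \<Gamma> \<mu>" and "\<not> is_clique \<Gamma>"
  shows "directly_indecomposable (artin_group \<Gamma> \<mu>)"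
proof -
  interpret artin \<Gamma> \<mu> by (rule artin.intro) (use assms in auto)
  obtain s t where st': "s \<in> S" "t \<in> S" "s \<noteq> t" "(s, t) \<notin> parcs \<Gamma>"
    using assms(4) by (auto simp: is_clique_def)
  interpret artin_nonadjacent \<Gamma> \<mu> s t using st' by unfold_locales
  interpret axis_cocycle G "parabolic (S - {t})" "parabolic (S - {s})" E "cls [(s, True)]" "cls [(t, True)]" \<beta>
    by (rule bass_serre_axis)
  have "H = {\<one>\<^bsub>G\<^esub>} \<or> K = {\<one>\<^bsub>G\<^esub>}" if HK: "direct_decomposition G H K" for H K
  proof -
    have n: "H \<lhd> G" "K \<lhd> G" and gen: "H <#>\<^bsub>G\<^esub> K = carrier G"
      using HK by (auto simp: direct_decomposition_def)
    have "H \<subseteq> E \<or> K \<subseteq> E"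
    proof (rule commuting_factor_in_edge_group)
      show "subgroup H G" "subgroup K G" using n by (simp_all add: normal_imp_subgroup)
      show "h \<otimes>\<^bsub>G\<^esub> k = k \<otimes>\<^bsub>G\<^esub> h" if "h \<in> H" "k \<in> K" for h k
        using direct_decomposition_commute[OF HK that] .
      show "\<exists>h\<in>H. \<exists>k\<in>K. x = h \<otimes>\<^bsub>G\<^esub> k" if "x \<in> carrier G" for x
      proof -
        have "x \<in> H <#>\<^bsub>G\<^esub> K" using that gen by simp
        then show ?thesis by (auto simp: set_mult_def)
      qed
    qed
    moreover have ne: "S - {s, t} \<noteq> S" using st'(1) by blast
    have "N = {\<one>\<^bsub>G\<^esub>}" if "N \<lhd> G" "N \<subseteq> E" for N
      by (rule normal_in_parabolic_trivial[OF irr that Diff_subset ne])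
    ultimately show ?thesis using n by metis
  qed
  then show ?thesis unfolding directly_indecomposable_def by blast
qed

theorem corollary1p5:
  fixes \<Gamma> \<Gamma>\<^sub>0 :: "'a pair_pre_digraph" and \<mu> :: "'a set \<Rightarrow> nat"
  assumes "pair_graph \<Gamma>"
    and "\<And>s t. (s, t) \<in> parcs \<Gamma> \<Longrightarrow> 2 \<le> \<mu> {s, t}"
    and "artin_irreducible \<Gamma> \<mu>"
    and "\<not> is_clique \<Gamma>"
    and "\<Gamma>\<^sub>0 = maximal_clique_factor \<Gamma>"
  shows "virtually_directly_indecomposable (artin_group \<Gamma> \<mu>) \<and>
    (\<not> (\<exists>H K. direct_decomposition (artin_subgroup \<Gamma> \<mu> \<Gamma>\<^sub>0) H K \<and>
              finite H \<and> H \<noteq> {\<one>\<^bsub>artin_subgroup \<Gamma> \<mu> \<Gamma>\<^sub>0\<^esub>})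
      \<longrightarrow> directly_indecomposable (artin_group \<Gamma> \<mu>))"
proof -
  have ind: "directly_indecomposable (artin_group \<Gamma> \<mu>)"
    by (rule artin_directly_indecomposable) (use assms in auto)
  then have "finite H \<or> finite K" if "direct_decomposition (artin_group \<Gamma> \<mu>) H K" for H K
    unfolding directly_indecomposable_def using that by (metis finite.emptyI finite_insert)
  then have "virtually_directly_indecomposable (artin_group \<Gamma> \<mu>)"
    unfolding virtually_directly_indecomposable_def by blast
  with ind show ?thesis by simp
qed

end
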